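(* Let $\kappa=\sigma_1/\sigma_r$ denote the ratio of the largest to the smallest nonzero eigenvalues of $X^\star$. There exists a universal constant $c_0$ such that if $m\ge c_0\,\kappa^2 r^3 n\log n$, then with high probability the spectral initialization $Z^0$ satisfies $$d(Z^0,Z^\star)\le\sqrt{\tfrac{3}{16}\sigma_r}.\qquad( * )$$ Moreover, there exists a universal constant $c_1$ such that when using the constant step size $\mu/\|Z^\star\|_F^2$ with $\mu\le\dfrac{c_1}{\kappa n}$ and an initial value $Z^0$ obeying $( * )$, the $k$th iterate $Z^k$ of the gradient descent algorithm $Z^{k+1}=Z^k-\frac{\mu}{\|Z^\star\|_F^2}\nabla f(Z^k)$ satisfies $$d(Z^k,Z^\star)\le\sqrt{\tfrac{3}{16}\sigma_r}\,\Bigl(1-\frac{\mu}{12\kappa r}\Bigr)^{k/2}$$ with high probability.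
   Context: $X^\star\in\mathbb{R}^{n\times n}$ is symmetric positive semidefinite of rank $r\ge1$; the rank $r$ is assumed to be correctly specified to the algorithm. $A_1,\dots,A_m$ are independent random symmetric $n\times n$ matrices from the Gaussian Orthogonal Ensemble (GOE): the entries on and above the diagonal are independent, with diagonal entries $\mathcal N(0,2)$ and off-diagonal entries $\mathcal N(0,1)$. The measurements are $b_i=\operatorname{tr}(A_iX^\star)$, $i=1,\dots,m$. Probability is with respect to the random matrices $A_i$; "with high probability" is not quantified in the statement. Let $X^\star=U^\star\Sigma{U^\star}^\top$ be the eigendecomposition with $\Sigma=\operatorname{diag}(\sigma_1,\dots,\sigma_r)$, where $\sigma_1\ge\cdots\ge\sigma_r>0$ are the nonzero eigenvalues and $U^\star\in\mathbb{R}^{n\times r}$ has orthonormal columns; put $Z^\star=U^\star\Sigma^{1/2}\in\mathbb{R}^{n\times r}$. For $Z\in\mathbb{R}^{n\times r}$, $$f(Z)=\frac1{4m}\sum_{i=1}^m\bigl(\operatorname{tr}(Z^\top A_iZ)-b_i\bigr)^2,\qquad\nabla f(Z)=\frac1m\sum_{i=1}^m\bigl(\operatorname{tr}(Z^\top A_iZ)-b_i\bigr)A_iZ,$$ and $d(Z,Z^\star)=\min_{U\in\mathbb{R}^{r\times r},\,UU^\top=U^\top U=I}\|Z-Z^\star U\|_F$, with $\|\cdot\|_F$ the Frobenius norm. Spectral initialization: let $(v_1,\lambda_1),\dots,(v_r,\lambda_r)$ be the top $r$ eigenpairs (unit eigenvectors) of $\frac1m\sum_{i=1}^m b_iA_i$,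 ordered so that $|\lambda_1|\ge\cdots\ge|\lambda_r|$; then $Z^0=[z^0_1,\dots,z^0_r]$ with $z^0_s=\sqrt{|\lambda_s|/2}\;v_s$. *)

theory Defs
  imports "HOL-Probability.Probability" "Jordan_Normal_Form.DL_Rank" "Jordan_Normal_Form.Char_Poly"
begin

text \<open>The constants of the main result are uniform in the dimensions, so matrices are
  \<open>real mat\<close> with explicit carriers rather than matrices over index types.
  All indices start at 0; in particular the eigenvalues are \<open>\<sigma> 0 \<ge> \<dots> \<ge> \<sigma> (r - 1)\<close>.\<close>

definition mat_tr :: "real mat \<Rightarrow> real" where
  "mat_tr B = (\<Sum>i<dim_row B. B $$ (i, i))"

definition frob_norm :: "real mat \<Rightarrow> real" where
  "frob_norm B = sqrt (\<Sum>i<dim_row B. \<Sum>j<dim_col B. (B $$ (i, j))\<^sup>2)"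

definition sym_psd :: "nat \<Rightarrow> real mat \<Rightarrow> bool" where
  "sym_psd n X \<longleftrightarrow> X \<in> carrier_mat n n \<and> X\<^sup>T = X \<and> (\<forall>v\<in>carrier_vec n. 0 \<le> v \<bullet> (X *\<^sub>v v))"

definition mat_rank :: "nat \<Rightarrow> real mat \<Rightarrow> nat" where
  "mat_rank n X = vec_space.rank n X"

definition eigendecomposition :: "nat \<Rightarrow> nat \<Rightarrow> real mat \<Rightarrow> real mat \<Rightarrow> (nat \<Rightarrow> real) \<Rightarrow> bool" where
  "eigendecomposition n r X U \<sigma> \<longleftrightarrow>
     U \<in> carrier_mat n r \<and> U\<^sup>T * U = 1\<^sub>m r \<and>
     (\<forall>s<r. 0 < \<sigma> s) \<and> (\<forall>s t. s \<le> t \<and> t < r \<longrightarrow> \<sigma> t \<le> \<sigma> s) \<and>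
     X = U * mat_diag r \<sigma> * U\<^sup>T"

definition factor :: "nat \<Rightarrow> real mat \<Rightarrow> (nat \<Rightarrow> real) \<Rightarrow> real mat" where
  "factor r U \<sigma> = U * mat_diag r (\<lambda>s. sqrt (\<sigma> s))"

text \<open>The infimum is over a nonempty compact set of orthogonal matrices, so it is a minimum.\<close>

definition proc_dist :: "nat \<Rightarrow> real mat \<Rightarrow> real mat \<Rightarrow> real" where
  "proc_dist r Z W =
     (INF Q \<in> {Q \<in> carrier_mat r r. Q * Q\<^sup>T = 1\<^sub>m r \<and> Q\<^sup>T * Q = 1\<^sub>m r}. frob_norm (Z - W * Q))"

text \<open>A sample assigns a real number to each \<open>(i, j, k)\<close> with \<open>i < m\<close> and \<open>j \<le> k < n\<close>: entry
  \<open>(j, k)\<close> on or above the diagonal of the \<open>i\<close>-th matrix. \<open>normal_density\<close> takes the standard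
  deviation, hence \<open>sqrt 2\<close> for diagonal variance 2.\<close>

definition goe_index :: "nat \<Rightarrow> nat \<Rightarrow> (nat \<times> nat \<times> nat) set" where
  "goe_index m n = {(i, j, k). i < m \<and> j \<le> k \<and> k < n}"

definition goe_entry_law :: "nat \<times> nat \<times> nat \<Rightarrow> real measure" where
  "goe_entry_law = (\<lambda>(i, j, k). density lborel (normal_density 0 (if j = k then sqrt 2 else 1)))"

definition goe_space :: "nat \<Rightarrow> nat \<Rightarrow> (nat \<times> nat \<times> nat \<Rightarrow> real) measure" where
  "goe_space m n = (\<Pi>\<^sub>M e\<in>goe_index m n. goe_entry_law e)"

definition goe_mat :: "nat \<Rightarrow> (nat \<times> nat \<times> nat \<Rightarrow> real) \<Rightarrow> nat \<Rightarrow> real mat" where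
  "goe_mat n \<omega> i = mat n n (\<lambda>(j, k). \<omega> (i, min j k, max j k))"

definition measurement :: "(nat \<Rightarrow> real mat) \<Rightarrow> real mat \<Rightarrow> nat \<Rightarrow> real" where
  "measurement A X i = mat_tr (A i * X)"

definition loss :: "nat \<Rightarrow> (nat \<Rightarrow> real mat) \<Rightarrow> (nat \<Rightarrow> real) \<Rightarrow> real mat \<Rightarrow> real" where
  "loss m A b Z = 1 / (4 * real m) * (\<Sum>i<m. (mat_tr (Z\<^sup>T * A i * Z) - b i)\<^sup>2)"

text \<open>Entrywise form of \<open>(1 / m) \<Sum>\<^sub>i (tr (Z\<^sup>T A\<^sub>i Z) - b\<^sub>i) A\<^sub>i Z\<close>;
  \<open>loss_grad_is_gradient\<close> below relates it to \<open>loss\<close>.\<close>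

definition loss_grad :: "nat \<Rightarrow> (nat \<Rightarrow> real mat) \<Rightarrow> (nat \<Rightarrow> real) \<Rightarrow> real mat \<Rightarrow> real mat" where
  "loss_grad m A b Z = mat (dim_row Z) (dim_col Z)
     (\<lambda>(p, q). 1 / real m * (\<Sum>i<m. (mat_tr (Z\<^sup>T * A i * Z) - b i) * (A i * Z) $$ (p, q)))"

definition surrogate :: "nat \<Rightarrow> nat \<Rightarrow> (nat \<Rightarrow> real mat) \<Rightarrow> (nat \<Rightarrow> real) \<Rightarrow> real mat" where
  "surrogate n m A b = mat n n (\<lambda>(p, q). 1 / real m * (\<Sum>i<m. b i * A i $$ (p, q)))"

text \<open>The top \<open>r\<close> eigenpairs are the first \<open>r\<close> members of a full orthonormal eigenbasis sorted by
  absolute eigenvalue. They need not be unique, hence a predicate.\<close>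

definition spectral_init ::
    "nat \<Rightarrow> nat \<Rightarrow> nat \<Rightarrow> (nat \<Rightarrow> real mat) \<Rightarrow> (nat \<Rightarrow> real) \<Rightarrow> real mat \<Rightarrow> bool" where
  "spectral_init n r m A b Z0 \<longleftrightarrow>
     (\<exists>v l. (\<forall>s<n. eigenvector (surrogate n m A b) (v s) (l s)) \<and>
            (\<forall>s<n. \<forall>t<n. v s \<bullet> v t = (if s = t then 1 else 0)) \<and>
            (\<forall>s t. s \<le> t \<and> t < n \<longrightarrow> \<bar>l t\<bar> \<le> \<bar>l s\<bar>) \<and>
            Z0 = mat_of_cols n (map (\<lambda>s. sqrt (\<bar>l s\<bar> / 2) \<cdot>\<^sub>v v s) [0..<r]))"

primrec grad_descent ::
    "nat \<Rightarrow> (nat \<Rightarrow> real mat) \<Rightarrow> (nat \<Rightarrow> real) \<Rightarrow> real \<Rightarrow> real mat \<Rightarrow> nat \<Rightarrow> real mat" where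
  "grad_descent m A b \<eta> Z0 0 = Z0"
| "grad_descent m A b \<eta> Z0 (Suc k) =
     grad_descent m A b \<eta> Z0 k - \<eta> \<cdot>\<^sub>m loss_grad m A b (grad_descent m A b \<eta> Z0 k)"


lemma prob_space_goe_entry_law: "prob_space (goe_entry_law e)"
  by (cases e) (auto simp: goe_entry_law_def intro!: prob_space_normal_density)

lemma prob_space_goe_space: "prob_space (goe_space m n)"
  unfolding goe_space_def by (intro prob_space_PiM prob_space_goe_entry_law)

text \<open>\<open>goe_space\<close> is the joint law of any family of independent Gaussian entries with the GOE
  variances, so working on this canonical space loses no generality.\<close>

lemma (in prob_space) goe_space_canonical:
  assumes "m > 0" "n > 0"
    and indep: "indep_vars (\<lambda>_. borel) Y (goe_index m n)"
    and distr: "\<And>i j k. (i, j, k) \<in> goe_index m n \<Longrightarrow>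
      distributed M lborel (Y (i, j, k)) (normal_density 0 (if j = k then sqrt 2 else 1))"
  shows "distr M (\<Pi>\<^sub>M e\<in>goe_index m n. borel) (\<lambda>w. \<lambda>e\<in>goe_index m n. Y e w) = goe_space m n"
proof -
  have ne: "goe_index m n \<noteq> {}"
    using assms(1,2) by (auto simp: goe_index_def)
  have rv: "random_variable borel (Y e)" if "e \<in> goe_index m n" for e
    using indep that by (auto simp: indep_vars_def)
  have law: "distr M borel (Y e) = goe_entry_law e" if e: "e \<in> goe_index m n" for e
  proof -
    obtain i j k where ijk: "e = (i, j, k)" by (cases e) auto
    have "distr M lborel (Y (i, j, k)) =
        density lborel (normal_density 0 (if j = k then sqrt 2 else 1))"
      using distr e ijk distributed_distr_eq_density by blast
    moreover have "distr M borel (Y e) = distr M lborel (Y e)"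
      by (rule distr_cong) auto
    ultimately show ?thesis by (simp add: ijk goe_entry_law_def)
  qed
  have "distr M (\<Pi>\<^sub>M e\<in>goe_index m n. borel) (\<lambda>w. \<lambda>e\<in>goe_index m n. Y e w)
      = (\<Pi>\<^sub>M e\<in>goe_index m n. distr M borel (Y e))"
    using indep_vars_iff_distr_eq_PiM'[of "goe_index m n" Y "\<lambda>_. borel"] ne rv indep by simp
  also have "\<dots> = goe_space m n"
    unfolding goe_space_def by (rule PiM_cong) (auto simp: law)
  finally show ?thesis .
qed

lemma mat_tr_quadratic:
  assumes "A \<in> carrier_mat n n" "Z \<in> carrier_mat n r" "W \<in> carrier_mat n r"
  shows "mat_tr (Z\<^sup>T * A * W) = (\<Sum>q<r. \<Sum>p<n. \<Sum>u<n. Z $$ (p, q) * A $$ (p, u) * W $$ (u, q))"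
proof -
  have "Z\<^sup>T * A * W = Z\<^sup>T * (A * W)"
    using assms by (intro assoc_mult_mat) auto
  then show ?thesis
    using assms by (simp add: mat_tr_def scalar_prod_def atLeast0LessThan sum_distrib_left mult.assoc)
qed

lemma loss_grad_is_gradient:
  assumes A: "\<And>i. i < m \<Longrightarrow> A i \<in> carrier_mat n n \<and> (A i)\<^sup>T = A i"
    and Z: "Z \<in> carrier_mat n r" and H: "H \<in> carrier_mat n r"
  shows "((\<lambda>t. loss m A b (Z + t \<cdot>\<^sub>m H)) has_real_derivative
      (\<Sum>p<n. \<Sum>q<r. loss_grad m A b Z $$ (p, q) * H $$ (p, q))) (at 0)"
proof -
  let ?B = "\<lambda>i V W. \<Sum>q<r. \<Sum>p<n. \<Sum>u<n. V $$ (p, q) * A i $$ (p, u) * W $$ (u, q)"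
  have sym: "?B i H Z = ?B i Z H" if "i < m" for i
  proof -
    have s: "A i $$ (p, u) = A i $$ (u, p)" if "p < n" "u < n" for p u
      using A[OF \<open>i < m\<close>] that by (metis carrier_matD index_transpose_mat(1))
    have "?B i H Z = (\<Sum>q<r. \<Sum>u<n. \<Sum>p<n. H $$ (p, q) * A i $$ (p, u) * Z $$ (u, q))"
      by (rule sum.cong[OF refl]) (rule sum.swap)
    also have "\<dots> = ?B i Z H"
      by (intro sum.cong refl) (simp add: s)
    finally show ?thesis .
  qed
  have quad: "mat_tr ((Z + t \<cdot>\<^sub>m H)\<^sup>T * A i * (Z + t \<cdot>\<^sub>m H))
      = ?B i Z Z + 2 * t * ?B i Z H + t\<^sup>2 * ?B i H H" if i: "i < m" for i t
  proof -
    have "mat_tr ((Z + t \<cdot>\<^sub>m H)\<^sup>T * A i * (Z + t \<cdot>\<^sub>m H)) = ?B i (Z + t \<cdot>\<^sub>m H) (Z + t \<cdot>\<^sub>m H)"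
      using A[OF i] Z H by (intro mat_tr_quadratic) auto
    also have "\<dots> = (\<Sum>q<r. \<Sum>p<n. \<Sum>u<n. Z $$ (p, q) * A i $$ (p, u) * Z $$ (u, q)
        + t * (H $$ (p, q) * A i $$ (p, u) * Z $$ (u, q))
        + t * (Z $$ (p, q) * A i $$ (p, u) * H $$ (u, q))
        + t\<^sup>2 * (H $$ (p, q) * A i $$ (p, u) * H $$ (u, q)))"
      using Z H by (intro sum.cong refl) (simp add: algebra_simps power2_eq_square)
    also have "\<dots> = ?B i Z Z + t * ?B i H Z + t * ?B i Z H + t\<^sup>2 * ?B i H H"
      by (simp add: sum.distrib sum_distrib_left)
    finally show ?thesis using sym[OF i] by simp
  qed
  have grad: "(\<Sum>p<n. \<Sum>q<r. loss_grad m A b Z $$ (p, q) * H $$ (p, q))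
      = 1 / real m * (\<Sum>i<m. (?B i Z Z - b i) * ?B i Z H)"
  proof -
    have "loss_grad m A b Z $$ (p, q) * H $$ (p, q)
        = (\<Sum>i<m. 1 / real m * ((?B i Z Z - b i) *
            (\<Sum>u<n. H $$ (p, q) * A i $$ (p, u) * Z $$ (u, q))))" if "p < n" "q < r" for p q
    proof -
      have pull: "c * (\<Sum>i<m. f i * g i) * h = (\<Sum>i<m. c * (f i * (h * g i)))"
        for c h :: real and f g :: "nat \<Rightarrow> real"
        by (simp add: sum_distrib_left sum_distrib_right mult_ac)
      have "mat_tr (Z\<^sup>T * A i * Z) = ?B i Z Z" if "i < m" for i
        using A[OF that] Z by (intro mat_tr_quadratic) auto
      moreover have "(A i * Z) $$ (p, q) = (\<Sum>u<n. A i $$ (p, u) * Z $$ (u, q))" if "i < m" for i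
        using A[OF that] Z \<open>p < n\<close> \<open>q < r\<close> by (auto simp: scalar_prod_def atLeast0LessThan)
      moreover have "loss_grad m A b Z $$ (p, q)
          = 1 / real m * (\<Sum>i<m. (mat_tr (Z\<^sup>T * A i * Z) - b i) * (A i * Z) $$ (p, q))"
        using Z that by (simp add: loss_grad_def)
      ultimately have "loss_grad m A b Z $$ (p, q)
          = 1 / real m * (\<Sum>i<m. (?B i Z Z - b i) * (\<Sum>u<n. A i $$ (p, u) * Z $$ (u, q)))"
        by (simp cong: sum.cong_simp)
      then have "loss_grad m A b Z $$ (p, q) * H $$ (p, q)
          = (\<Sum>i<m. 1 / real m * ((?B i Z Z - b i) *
              (H $$ (p, q) * (\<Sum>u<n. A i $$ (p, u) * Z $$ (u, q)))))"
        by (simp only: pull)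
      also have "\<dots> = (\<Sum>i<m. 1 / real m * ((?B i Z Z - b i) *
            (\<Sum>u<n. H $$ (p, q) * A i $$ (p, u) * Z $$ (u, q))))"
        by (simp only: sum_distrib_left[of "H $$ (p, q)"] mult.assoc)
      finally show ?thesis .
    qed
    then have "(\<Sum>p<n. \<Sum>q<r. loss_grad m A b Z $$ (p, q) * H $$ (p, q))
        = (\<Sum>p<n. \<Sum>q<r. \<Sum>i<m. 1 / real m * ((?B i Z Z - b i) *
            (\<Sum>u<n. H $$ (p, q) * A i $$ (p, u) * Z $$ (u, q))))"
      by (intro sum.cong refl) auto
    also have "\<dots> = (\<Sum>q<r. \<Sum>p<n. \<Sum>i<m. 1 / real m * ((?B i Z Z - b i) *
            (\<Sum>u<n. H $$ (p, q) * A i $$ (p, u) * Z $$ (u, q))))"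
      by (rule sum.swap)
    also have "\<dots> = (\<Sum>q<r. \<Sum>i<m. \<Sum>p<n. 1 / real m * ((?B i Z Z - b i) *
            (\<Sum>u<n. H $$ (p, q) * A i $$ (p, u) * Z $$ (u, q))))"
      by (rule sum.cong[OF refl]) (rule sum.swap)
    also have "\<dots> = (\<Sum>i<m. \<Sum>q<r. \<Sum>p<n. 1 / real m * ((?B i Z Z - b i) *
            (\<Sum>u<n. H $$ (p, q) * A i $$ (p, u) * Z $$ (u, q))))"
      by (rule sum.swap)
    also have "\<dots> = 1 / real m * (\<Sum>i<m. (?B i Z Z - b i) * ?B i H Z)"
      by (simp only: sum_distrib_left)
    also have "\<dots> = 1 / real m * (\<Sum>i<m. (?B i Z Z - b i) * ?B i Z H)"
      using sym by (simp cong: sum.cong_simp)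
    finally show ?thesis .
  qed
  have "((\<lambda>t. 1 / (4 * real m) * (\<Sum>i<m. (?B i Z Z + 2 * t * ?B i Z H + t\<^sup>2 * ?B i H H - b i)\<^sup>2))
      has_real_derivative
      1 / (4 * real m) * (\<Sum>i<m. 4 * ((?B i Z Z - b i) * ?B i Z H))) (at 0)"
    by (rule DERIV_cmult, rule DERIV_sum) (auto intro!: derivative_eq_intros)
  moreover have "1 / (4 * real m) * (\<Sum>i<m. 4 * ((?B i Z Z - b i) * ?B i Z H))
      = 1 / real m * (\<Sum>i<m. (?B i Z Z - b i) * ?B i Z H)"
    unfolding sum_distrib_left[symmetric] by simp
  moreover have "loss m A b (Z + t \<cdot>\<^sub>m H)
      = 1 / (4 * real m) * (\<Sum>i<m. (?B i Z Z + 2 * t * ?B i Z H + t\<^sup>2 * ?B i H H - b i)\<^sup>2)" for t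
    unfolding loss_def using quad by (simp cong: sum.cong_simp)
  ultimately show ?thesis using grad by simp
qed

end

theory Submission
  imports Defs
begin

text \<open>For a fixed matrix \<open>M\<close> the numbers \<open>\<langle>A\<^sub>i, M\<rangle>\<close> are independent centred Gaussians, so
  \<open>1/m \<Sum>\<^sub>i \<langle>A\<^sub>i, M\<rangle>\<^sup>2\<close> concentrates around their variance. Because of the factor \<open>log n\<close> in the sample size,
  a union bound over a grid in the unit ball is affordable, and a quadratic form that is small on the
  grid is small on the whole ball.

  Descent needs this for two families only: rank one matrices, which bound every
  \<open>1/m \<Sum>\<^sub>i tr (V\<^sup>T A\<^sub>i W)\<^sup>2\<close> by \<open>3 |V|\<^sup>2 |W|\<^sup>2\<close>, and the tangent space \<open>{U W\<^sup>T + W U\<^sup>T}\<close> at \<open>X\<close>, which gives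
  a lower bound. For \<open>Z = Z\<^sup>* + H\<close>, rotated to optimal alignment, put \<open>a\<^sub>i = 2 tr (H\<^sup>T A\<^sub>i Z\<^sup>*)\<close> and
  \<open>b\<^sub>i = tr (H\<^sup>T A\<^sub>i H)\<close>. Then \<open>\<langle>\<nabla>f Z, H\<rangle> = 1/m \<Sum>\<^sub>i (a\<^sub>i + b\<^sub>i) (a\<^sub>i/2 + b\<^sub>i) \<ge> 1/m \<Sum>\<^sub>i (a\<^sub>i\<^sup>2/8 - b\<^sub>i\<^sup>2/2)\<close>,
  so a gradient step contracts the distance.

  For the initialization, polarization turns the concentration for \<open>X \<plusminus> |X| h h\<^sup>T\<close> into a bound on the operator
  norm of \<open>M/2 - X\<close>, where \<open>M\<close> is the surrogate matrix. Spectral perturbation bounds \<open>|Z\<^sup>0 Z\<^sup>0\<^sup>T - X|\<close> in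
  Frobenius norm, and the distance of two optimally aligned factors is controlled by the distance of
  the products.\<close>

section \<open>Gaussian concentration\<close>

text \<open>The grid families depend only on \<open>n\<close>, \<open>r\<close> and the
  eigendecomposition of \<open>X\<close>. After one union bound the argument is deterministic and
  covers all starting points, step sizes and iteration counts at once, even a starting point
  computed from the same samples. Origin of the sample size: relative tolerance \<open>t\<close>
  fails for one matrix with probability at most \<open>2 * exp (- (m * t\<^sup>2 / 16))\<close>, and
  a grid in dimension \<open>D\<close> has at most \<open>(33 * n) ^ D\<close> points, so
  \<open>m * t\<^sup>2\<close> has to be of order \<open>D * ln n\<close>. Descent uses a constant
  \<open>t\<close> and \<open>D\<close> of order \<open>n * r\<close>. Initialization uses dimension
  \<open>n\<close>, but keeping \<open>r\<close> eigenpairs costs a factor of order \<open>r\<close>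
  over an operator norm error of order \<open>t * f\<close>, where the Frobenius norm
  \<open>f\<close> of \<open>X\<close> may be as large as \<open>sqrt r * \<sigma> 0\<close>.
  Getting below the order of \<open>\<sigma> (r - 1)\<close> forces \<open>t\<close> of order
  \<open>1 / (\<kappa> * r powr (3/2))\<close>, hence the factor
  \<open>\<kappa>\<^sup>2 * r ^ 3\<close>. The obstacle to the lower bound on the tangent space is
  that the variance there contains a cross term of either sign; optimal alignment turns it into a
  sum of squares.\<close>

lemma neg_ln_one_minus_le:
  fixes y :: real
  assumes "\<bar>y\<bar> \<le> 1/2"
  shows "- ln (1 - y) \<le> y + 2 * y\<^sup>2"
  using abs_ln_one_plus_x_minus_x_bound[of "-y"] assms by simp

text \<open>Multiplying a centred normal density by \<open>exp (s * x\<^sup>2)\<close> gives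
  \<open>1 / a\<close> times the centred normal density of deviation \<open>\<sigma> / a\<close>, so
  the integral is read off from total mass 1. Working with the nonnegative integral avoids
  integrability side conditions.\<close>

lemma nn_integral_exp_square_normal:
  fixes \<sigma> s :: real
  assumes \<sigma>: "0 < \<sigma>" and s: "2 * s * \<sigma>\<^sup>2 < 1"
  shows "(\<integral>\<^sup>+x. ennreal (normal_density 0 \<sigma> x) * ennreal (exp (s * x\<^sup>2)) \<partial>lborel)
    = ennreal (1 / sqrt (1 - 2 * s * \<sigma>\<^sup>2))"
proof -
  define a where "a = sqrt (1 - 2 * s * \<sigma>\<^sup>2)"
  have a: "0 < a" "a\<^sup>2 = 1 - 2 * s * \<sigma>\<^sup>2" using s by (auto simp: a_def)
  have eq: "normal_density 0 \<sigma> x * exp (s * x\<^sup>2) = 1 / a * normal_density 0 (\<sigma> / a) x" for x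
  proof -
    have "s * x\<^sup>2 - x\<^sup>2 / (2 * \<sigma>\<^sup>2) = - (x\<^sup>2 * a\<^sup>2) / (2 * \<sigma>\<^sup>2)"
      using \<sigma> by (simp add: a field_simps)
    then show ?thesis
      using a(1) \<sigma> by (simp add: normal_density_def real_sqrt_mult real_sqrt_divide power_divide field_simps flip: exp_add)
  qed
  interpret P: prob_space "density lborel (normal_density 0 (\<sigma> / a))"
    using a \<sigma> by (intro prob_space_normal_density) auto
  have "(\<integral>\<^sup>+x. ennreal (normal_density 0 (\<sigma> / a) x) \<partial>lborel) = 1"
    using P.emeasure_space_1 by (simp add: emeasure_density)
  moreover have "(\<integral>\<^sup>+x. ennreal (normal_density 0 \<sigma> x) * ennreal (exp (s * x\<^sup>2)) \<partial>lborel)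
      = (\<integral>\<^sup>+x. ennreal (1 / a) * ennreal (normal_density 0 (\<sigma> / a) x) \<partial>lborel)"
    using a(1) by (intro nn_integral_cong) (simp add: eq flip: ennreal_mult)
  ultimately show ?thesis by (simp add: nn_integral_cmult a_def)
qed

text \<open>The exponent \<open>v\<close> is signed, so that one statement serves both tails:
  positive \<open>v\<close> bounds the sum from above, negative \<open>v\<close> from below. Each
  factor costs at most \<open>v + 4 * v\<^sup>2\<close> in the exponent, where \<bar>v\<bar> \<le>
  1/4 keeps the logarithm within the range of its quadratic bound. The threshold allows
  \<open>v + 8 * v\<^sup>2\<close>, and the difference is the gain in the exponential.\<close>

lemma (in prob_space) sum_square_normal_chernoff:
  fixes X :: "nat \<Rightarrow> 'a \<Rightarrow> real" and v \<sigma> :: real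
  assumes indep: "indep_vars (\<lambda>_. borel) X {..<m}"
    and normal: "\<And>i. i < m \<Longrightarrow> distributed M lborel (X i) (normal_density 0 \<sigma>)"
    and \<sigma>: "0 < \<sigma>" and v: "\<bar>v\<bar> \<le> 1/4"
  shows "prob {w \<in> space M. v * (\<Sum>i<m. (X i w)\<^sup>2) \<ge> real m * \<sigma>\<^sup>2 * (v + 8 * v\<^sup>2)} \<le> exp (- 4 * real m * v\<^sup>2)"
proof -
  define s where "s = v / \<sigma>\<^sup>2"
  have sv: "s * \<sigma>\<^sup>2 = v" using \<sigma> by (simp add: s_def)
  have rv[measurable]: "random_variable borel (X i)" if "i < m" for i
    using indep that by (auto simp: indep_vars_def)
  have mgf: "(\<integral>\<^sup>+w. ennreal (exp (s * (X i w)\<^sup>2)) \<partial>M) \<le> ennreal (exp (v + 4 * v\<^sup>2))" if "i < m" for i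
  proof -
    have "(\<integral>\<^sup>+w. ennreal (exp (s * (X i w)\<^sup>2)) \<partial>M)
        = (\<integral>\<^sup>+x. ennreal (normal_density 0 \<sigma> x) * ennreal (exp (s * x\<^sup>2)) \<partial>lborel)"
      by (rule distributed_nn_integral[OF normal[OF that], symmetric]) simp
    also have "\<dots> = ennreal (1 / sqrt (1 - 2 * s * \<sigma>\<^sup>2))"
      using v by (intro nn_integral_exp_square_normal \<sigma>) (simp add: mult.assoc sv)
    also have "1 / sqrt (1 - 2 * s * \<sigma>\<^sup>2) = exp (- ln (1 - 2 * v) / 2)"
      using v by (simp add: mult.assoc sv ln_sqrt[symmetric] exp_minus inverse_eq_divide)
    also have "\<dots> \<le> exp (v + 4 * v\<^sup>2)"
    proof -
      have "\<bar>2 * v\<bar> \<le> 1/2" using v by linarith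
      from neg_ln_one_minus_le[OF this] show ?thesis by (simp add: power_mult_distrib)
    qed
    finally show ?thesis by (simp add: ennreal_leI)
  qed
  let ?u = "\<lambda>w. \<Prod>i<m. ennreal (exp (s * (X i w)\<^sup>2))"
  let ?c = "exp (- (real m * (v + 8 * v\<^sup>2)))"
  have "indep_vars (\<lambda>_. borel) (\<lambda>i w. ennreal (exp (s * (X i w)\<^sup>2))) {..<m}"
    by (rule indep_vars_compose2[OF indep]) measurable
  then have "(\<integral>\<^sup>+w. ?u w \<partial>M) = (\<Prod>i<m. \<integral>\<^sup>+w. ennreal (exp (s * (X i w)\<^sup>2)) \<partial>M)"
    by (intro indep_vars_nn_integral) auto
  also have "\<dots> \<le> (\<Prod>i<m. ennreal (exp (v + 4 * v\<^sup>2)))"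
    using mgf by (intro prod_mono_ennreal) auto
  also have "\<dots> = ennreal (exp (real m * (v + 4 * v\<^sup>2)))"
    by (simp add: ennreal_power exp_of_nat_mult)
  finally have int: "(\<integral>\<^sup>+w. ?u w \<partial>M) \<le> ennreal (exp (real m * (v + 4 * v\<^sup>2)))" .
  have u: "?u w = ennreal (exp (s * (\<Sum>i<m. (X i w)\<^sup>2)))" for w
    by (simp add: prod_ennreal exp_sum sum_distrib_left)
  have set_eq: "{w \<in> space M. v * (\<Sum>i<m. (X i w)\<^sup>2) \<ge> real m * \<sigma>\<^sup>2 * (v + 8 * v\<^sup>2)}
      = {w \<in> space M. 1 \<le> ennreal ?c * ?u w}"
  proof -
    have "v * S \<ge> real m * \<sigma>\<^sup>2 * (v + 8 * v\<^sup>2) \<longleftrightarrow> 1 \<le> ennreal ?c * ennreal (exp (s * S))" for S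
    proof -
      have "1 \<le> ennreal ?c * ennreal (exp (s * S)) \<longleftrightarrow> 1 \<le> exp (s * S - real m * (v + 8 * v\<^sup>2))"
        by (simp add: algebra_simps flip: ennreal_mult exp_add)
      also have "\<dots> \<longleftrightarrow> real m * (v + 8 * v\<^sup>2) \<le> s * S" by simp
      also have "\<dots> \<longleftrightarrow> real m * \<sigma>\<^sup>2 * (v + 8 * v\<^sup>2) \<le> v * S"
        using \<sigma> by (simp add: s_def field_simps)
      finally show ?thesis by simp
    qed
    then show ?thesis unfolding u by simp
  qed
  have "emeasure M {w \<in> space M. 1 \<le> ennreal ?c * ?u w} \<le> ennreal ?c * (\<integral>\<^sup>+w. ?u w \<partial>M)"
    using nn_integral_Markov_inequality[of ?u "space M" M "ennreal ?c"]
    by (simp cong: nn_integral_cong)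
  also have "\<dots> \<le> ennreal ?c * ennreal (exp (real m * (v + 4 * v\<^sup>2)))"
    by (intro mult_left_mono int) auto
  also have "\<dots> = ennreal (exp (- 4 * real m * v\<^sup>2))"
    by (simp add: algebra_simps flip: ennreal_mult exp_add)
  finally show ?thesis
    unfolding set_eq by (simp add: emeasure_eq_measure)
qed

text \<open>The Chernoff bound at \<open>v = \<tau> / 8\<close> and \<open>v = - \<tau> / 8\<close>:
  the slack \<open>8 * v\<^sup>2\<close> is then exactly the relative deviation \<tau>, the
  condition \<tau> \<le> 2 becomes \<bar>v\<bar> \<le> 1/4, and \<open>4 * v\<^sup>2\<close> is
  \<open>\<tau>\<^sup>2 / 16\<close>.\<close>

lemma (in prob_space) sum_square_normal_concentration:
  fixes X :: "nat \<Rightarrow> 'a \<Rightarrow> real" and \<tau> \<sigma> :: real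
  assumes indep: "indep_vars (\<lambda>_. borel) X {..<m}"
    and normal: "\<And>i. i < m \<Longrightarrow> distributed M lborel (X i) (normal_density 0 \<sigma>)"
    and \<sigma>: "0 < \<sigma>" and \<tau>: "0 < \<tau>" "\<tau> \<le> 2"
  shows "prob {w \<in> space M. \<bar>(\<Sum>i<m. (X i w)\<^sup>2) - real m * \<sigma>\<^sup>2\<bar> > \<tau> * (real m * \<sigma>\<^sup>2)} \<le> 2 * exp (- (real m * \<tau>\<^sup>2 / 16))"
proof -
  have rv[measurable]: "random_variable borel (X i)" if "i < m" for i
    using indep that by (auto simp: indep_vars_def)
  define B where "B v = {w \<in> space M. v * (\<Sum>i<m. (X i w)\<^sup>2) \<ge> real m * \<sigma>\<^sup>2 * (v + 8 * v\<^sup>2)}" for v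
  have [measurable]: "B v \<in> events" for v unfolding B_def by measurable
  have p: "prob (B v) \<le> exp (- (real m * \<tau>\<^sup>2 / 16))" if "v = \<tau> / 8 \<or> v = - \<tau> / 8" for v
  proof -
    have "\<bar>v\<bar> \<le> 1/4" "v\<^sup>2 = \<tau>\<^sup>2 / 64" using that \<tau> by (auto simp: power_divide)
    moreover from this have "- 4 * real m * v\<^sup>2 = - (real m * \<tau>\<^sup>2 / 16)" by simp
    ultimately show ?thesis
      unfolding B_def using sum_square_normal_chernoff[OF indep normal \<sigma>, of v] by metis
  qed
  have sub: "{w \<in> space M. \<bar>(\<Sum>i<m. (X i w)\<^sup>2) - real m * \<sigma>\<^sup>2\<bar> > \<tau> * (real m * \<sigma>\<^sup>2)} \<subseteq> B (\<tau> / 8) \<union> B (- \<tau> / 8)"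
  proof -
    have "S \<ge> K + \<tau> * K \<or> S \<le> K - \<tau> * K" if "\<bar>S - K\<bar> > \<tau> * K" for S K :: real
      using that by linarith
    moreover have "S \<ge> K + \<tau> * K \<longleftrightarrow> \<tau> / 8 * S \<ge> K * (\<tau> / 8 + 8 * (\<tau> / 8)\<^sup>2)" for S K :: real
    proof -
      have "K * (\<tau> / 8 + 8 * (\<tau> / 8)\<^sup>2) = \<tau> / 8 * (K + \<tau> * K)"
        by (simp add: power2_eq_square field_simps)
      then show ?thesis using \<tau> by (simp only: mult_le_cancel_left_pos[of "\<tau> / 8"])
    qed
    moreover have "S \<le> K - \<tau> * K \<longleftrightarrow> - \<tau> / 8 * S \<ge> K * (- \<tau> / 8 + 8 * (- \<tau> / 8)\<^sup>2)" for S K :: real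
    proof -
      have "K * (- \<tau> / 8 + 8 * (- \<tau> / 8)\<^sup>2) = - \<tau> / 8 * (K - \<tau> * K)"
        by (simp add: power2_eq_square field_simps)
      then show ?thesis using \<tau> by (simp only: mult_le_cancel_left_neg[of "- \<tau> / 8"])
    qed
    ultimately show ?thesis unfolding B_def by blast
  qed
  have "prob {w \<in> space M. \<bar>(\<Sum>i<m. (X i w)\<^sup>2) - real m * \<sigma>\<^sup>2\<bar> > \<tau> * (real m * \<sigma>\<^sup>2)} \<le> prob (B (\<tau> / 8) \<union> B (- \<tau> / 8))"
    by (intro finite_measure_mono sub) simp
  also have "\<dots> \<le> prob (B (\<tau> / 8)) + prob (B (- \<tau> / 8))"
    by (intro measure_Un_le) auto
  finally show ?thesis using p[of "\<tau> / 8"] p[of "- \<tau> / 8"] by simp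
qed


text \<open>\<open>goe_var n M\<close> is the variance of \<open>\<langle>A, M\<rangle>\<close> for a GOE matrix \<open>A\<close>; \<open>M\<close> need not be symmetric.\<close>

definition goe_var :: "nat \<Rightarrow> (nat \<Rightarrow> nat \<Rightarrow> real) \<Rightarrow> real" where
  "goe_var n M = (\<Sum>j<n. \<Sum>k<n. M j k * (M j k + M k j))"

definition goe_form :: "nat \<Rightarrow> (nat \<times> nat \<times> nat \<Rightarrow> real) \<Rightarrow> (nat \<Rightarrow> nat \<Rightarrow> real) \<Rightarrow> nat \<Rightarrow> real" where
  "goe_form n \<omega> M i = (\<Sum>j<n. \<Sum>k<n. \<omega> (i, min j k, max j k) * M j k)"

text \<open>The independent coordinates of a symmetric random matrix are the entries with
  \<open>j \<le> k\<close>, so sums over the full square are folded onto the triangle before any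
  probabilistic statement is applied.\<close>

lemma sum_square_triangle:
  fixes f :: "nat \<Rightarrow> nat \<Rightarrow> 'a::comm_monoid_add"
  shows "(\<Sum>j<n. \<Sum>k<n. f j k) = (\<Sum>k<n. \<Sum>j\<le>k. if j = k then f k k else f j k + f k j)"
proof (induction n)
  case (Suc n)
  have "(\<Sum>j<Suc n. \<Sum>k<Suc n. f j k) = (\<Sum>j<n. \<Sum>k<n. f j k) + ((\<Sum>j<n. f j n + f n j) + f n n)"
    by (simp add: sum.distrib add_ac)
  also have "(\<Sum>j<n. f j n + f n j) + f n n = (\<Sum>j\<le>n. if j = n then f n n else f j n + f n j)"
    by (simp add: lessThan_Suc_atMost[symmetric])
  finally show ?case by (simp add: Suc.IH)
qed simp

lemma finite_goe_index: "finite (goe_index m n)"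
  by (rule finite_subset[of _ "{..<m} \<times> {..<n} \<times> {..<n}"]) (auto simp: goe_index_def)

text \<open>The coordinates of the \<open>i\<close>-th matrix. Slices for different \<open>i\<close>
  are disjoint, and this is what makes forms in different matrices independent.\<close>

definition goe_slice :: "nat \<Rightarrow> nat \<Rightarrow> (nat \<times> nat \<times> nat) set" where
  "goe_slice n i = {(i', j, k). i' = i \<and> j \<le> k \<and> k < n}"

lemma goe_slice_subset: "i < m \<Longrightarrow> goe_slice n i \<subseteq> goe_index m n"
  by (auto simp: goe_slice_def goe_index_def)

lemma sum_goe_slice:
  "(\<Sum>e\<in>goe_slice n i. f e) = (\<Sum>k<n. \<Sum>j\<le>k. f (i, j, k))"
proof -
  have "(\<Sum>k<n. \<Sum>j\<le>k. f (i, j, k)) = (\<Sum>(k, j)\<in>(SIGMA k:{..<n}. {..k}). f (i, j, k))"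
    by (simp add: sum.Sigma)
  also have "\<dots> = (\<Sum>e\<in>goe_slice n i. f e)"
    by (rule sum.reindex_bij_witness[of _ "\<lambda>(i', j, k). (k, j)" "\<lambda>(k, j). (i, j, k)"]) (auto simp: goe_slice_def)
  finally show ?thesis by simp
qed

section \<open>Independence and law of the entries and of the linear forms\<close>

lemma sets_goe_entry_law [measurable_cong]: "sets (goe_entry_law e) = sets borel"
  by (cases e) (simp add: goe_entry_law_def)

lemma goe_coord_measurable [measurable]:
  "e \<in> goe_index m n \<Longrightarrow> (\<lambda>\<omega>. \<omega> e) \<in> borel_measurable (goe_space m n)"
  using measurable_component_singleton[of e "goe_index m n" goe_entry_law]
  by (simp add: goe_space_def measurable_cong_sets[OF refl sets_goe_entry_law])

text \<open>On the product space the joint law of the coordinates is the product measure itself, and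
  each marginal is the law of its entry; equality of the joint law with the product of the marginals
  is independence. That criterion concerns a nonempty index set, hence the separate trivial
  case.\<close>

lemma goe_coord_indep:
  "prob_space.indep_vars (goe_space m n) (\<lambda>_. borel) (\<lambda>e \<omega>. \<omega> e) (goe_index m n)"
proof (cases "goe_index m n = {}")
  case True
  interpret prob_space "goe_space m n" by (rule prob_space_goe_space)
  show ?thesis unfolding True indep_vars_def indep_sets_def by auto
next
  case False
  interpret prob_space "goe_space m n" by (rule prob_space_goe_space)
  have rv: "random_variable (goe_entry_law e) (\<lambda>\<omega>. \<omega> e)" if "e \<in> goe_index m n" for e
    using that by (simp add: goe_space_def)
  have "distr (goe_space m n) (\<Pi>\<^sub>M e\<in>goe_index m n. goe_entry_law e) (\<lambda>\<omega>. \<lambda>e\<in>goe_index m n. \<omega> e)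
      = distr (goe_space m n) (goe_space m n) (\<lambda>\<omega>. \<omega>)"
    by (rule distr_cong) (auto simp: goe_space_def space_PiM PiE_def extensional_restrict)
  also have "\<dots> = (\<Pi>\<^sub>M e\<in>goe_index m n. goe_entry_law e)"
    by (simp add: goe_space_def)
  also have "\<dots> = (\<Pi>\<^sub>M e\<in>goe_index m n. distr (goe_space m n) (goe_entry_law e) (\<lambda>\<omega>. \<omega> e))"
    unfolding goe_space_def by (intro PiM_cong refl) (simp add: distr_PiM_component finite_goe_index prob_space_goe_entry_law)
  finally have "indep_vars goe_entry_law (\<lambda>e \<omega>. \<omega> e) (goe_index m n)"
    by (subst indep_vars_iff_distr_eq_PiM'[OF False rv])
  from indep_vars_compose2[OF this, of "\<lambda>_ x. x" "\<lambda>_. borel"] show ?thesis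
    by (simp add: measurable_cong_sets[OF sets_goe_entry_law refl])
qed

lemma goe_coord_normal:
  assumes "(i, j, k) \<in> goe_index m n"
  shows "distributed (goe_space m n) lborel (\<lambda>\<omega>. \<omega> (i, j, k)) (normal_density 0 (if j = k then sqrt 2 else 1))"
proof -
  have "distr (goe_space m n) lborel (\<lambda>\<omega>. \<omega> (i, j, k)) = distr (goe_space m n) (goe_entry_law (i, j, k)) (\<lambda>\<omega>. \<omega> (i, j, k))"
    by (rule distr_cong) (auto simp: sets_goe_entry_law)
  also have "\<dots> = goe_entry_law (i, j, k)"
    unfolding goe_space_def using assms by (simp add: distr_PiM_component finite_goe_index prob_space_goe_entry_law)
  finally show ?thesis
    using assms by (simp add: distributed_def goe_entry_law_def)
qed

lemma goe_form_triangle: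
  "goe_form n \<omega> M i = (\<Sum>(i', j, k)\<in>goe_slice n i. (if j = k then M j j else M j k + M k j) * \<omega> (i', j, k))"
  unfolding goe_form_def sum_square_triangle sum_goe_slice
  by (intro sum.cong refl) (auto simp: algebra_simps)

text \<open>Both types of entry give a squared coefficient times a variance: the two off-diagonal
  terms of \<open>goe_var\<close> add up to \<open>(M j k + M k j)\<^sup>2\<close>, and the diagonal
  variance 2 gives \<open>2 * (M j j)\<^sup>2\<close>. The representation also shows that
  \<open>goe_var\<close> is nonnegative.\<close>

lemma goe_var_triangle:
  "goe_var n M = (\<Sum>(i', j, k)\<in>goe_slice n i. ((if j = k then M j j else M j k + M k j) * (if j = k then sqrt 2 else 1))\<^sup>2)"
  unfolding goe_var_def sum_square_triangle sum_goe_slice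
  by (intro sum.cong refl) (auto simp: algebra_simps power2_eq_square)

lemma goe_form_measurable [measurable]:
  assumes "i < m"
  shows "(\<lambda>\<omega>. goe_form n \<omega> M i) \<in> borel_measurable (goe_space m n)"
proof -
  have "(\<lambda>\<omega>. \<omega> (i, min j k, max j k)) \<in> borel_measurable (goe_space m n)" if "j < n" "k < n" for j k
    using that assms by (intro goe_coord_measurable) (auto simp: goe_index_def)
  then show ?thesis unfolding goe_form_def by (intro borel_measurable_sum borel_measurable_times) auto
qed

lemma goe_form_indep:
  "prob_space.indep_vars (goe_space m n) (\<lambda>_. borel) (\<lambda>i \<omega>. goe_form n \<omega> M i) {..<m}"
proof -
  interpret prob_space "goe_space m n" by (rule prob_space_goe_space)
  let ?c = "\<lambda>(i, j, k). if j = k then M j j else M j k + M k j"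
  have "indep_vars (\<lambda>i. \<Pi>\<^sub>M e\<in>goe_slice n i. borel) (\<lambda>i \<omega>. restrict (\<lambda>e. \<omega> e) (goe_slice n i)) {..<m}"
    by (rule indep_vars_restrict[OF goe_coord_indep])
       (use goe_slice_subset in \<open>auto simp: disjoint_family_on_def goe_slice_def\<close>)
  from indep_vars_compose2[OF this, of "\<lambda>i x. \<Sum>e\<in>goe_slice n i. ?c e * x e" "\<lambda>_. borel"]
  have "indep_vars (\<lambda>_. borel) (\<lambda>i \<omega>. \<Sum>e\<in>goe_slice n i. ?c e * restrict (\<lambda>e. \<omega> e) (goe_slice n i) e) {..<m}"
    by measurable
  moreover have "(\<Sum>e\<in>goe_slice n i. ?c e * restrict (\<lambda>e. \<omega> e) (goe_slice n i) e) = goe_form n \<omega> M i" for i \<omega>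
    unfolding goe_form_triangle by (intro sum.cong refl) auto
  ultimately show ?thesis by simp
qed

lemma goe_form_normal:
  assumes "i < m" and pos: "0 < goe_var n M"
  shows "distributed (goe_space m n) lborel (\<lambda>\<omega>. goe_form n \<omega> M i) (normal_density 0 (sqrt (goe_var n M)))"
proof -
  interpret prob_space "goe_space m n" by (rule prob_space_goe_space)
  let ?c = "\<lambda>(i, j, k). if j = k then M j j else M j k + M k j"
  let ?d = "\<lambda>(i, j, k). if j = k then sqrt 2 else (1::real)"
  \<comment> \<open>An affine image of a normal variable is normal only for a nonzero coefficient,
    so vanishing coefficients are removed from the sum first. Positive variance guarantees that
    something remains.\<close>
  define J where "J = {e \<in> goe_slice n i. ?c e \<noteq> 0}"
  have fin: "finite (goe_slice n i)"
    using finite_subset[OF goe_slice_subset[OF \<open>i < m\<close>] finite_goe_index] .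
  have J: "J \<subseteq> goe_index m n" "finite J"
    using goe_slice_subset[OF \<open>i < m\<close>, of n] fin by (auto simp: J_def)
  have var: "goe_var n M = (\<Sum>e\<in>J. (\<bar>?c e\<bar> * ?d e)\<^sup>2)"
    unfolding goe_var_triangle[of n M i] J_def
    by (intro sum.mono_neutral_cong_right fin) (auto simp: power_mult_distrib split: if_splits)
  have form: "goe_form n \<omega> M i = (\<Sum>e\<in>J. 0 + ?c e * \<omega> e)" for \<omega>
    unfolding goe_form_triangle J_def
    by (intro sum.mono_neutral_cong_right fin) (auto split: if_splits)
  have "J \<noteq> {}" using pos var by auto
  have ind: "indep_vars (\<lambda>_. borel) (\<lambda>e \<omega>. 0 + ?c e * \<omega> e) J"
    by (rule indep_vars_compose2[OF indep_vars_subset[OF goe_coord_indep J(1)]]) measurable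
  have "distributed (goe_space m n) lborel (\<lambda>\<omega>. 0 + ?c e * \<omega> e) (normal_density (0 + ?c e * 0) (\<bar>?c e\<bar> * ?d e))" if "e \<in> J" for e
  proof (rule normal_density_affine)
    show "distributed (goe_space m n) lborel (\<lambda>\<omega>. \<omega> e) (normal_density 0 (?d e))"
    proof -
      obtain a j k where e: "e = (a, j, k)" by (cases e) auto
      with that J(1) have "(a, j, k) \<in> goe_index m n" by auto
      from goe_coord_normal[OF this] show ?thesis by (simp add: e)
    qed
  qed (use that in \<open>auto simp: J_def split: if_splits prod.splits\<close>)
  then have "distributed (goe_space m n) lborel (\<lambda>\<omega>. \<Sum>e\<in>J. 0 + ?c e * \<omega> e)
      (normal_density (\<Sum>e\<in>J. 0) (sqrt (\<Sum>e\<in>J. (\<bar>?c e\<bar> * ?d e)\<^sup>2)))"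
    by (intro sum_indep_normal[OF J(2) \<open>J \<noteq> {}\<close> ind]) (auto simp: J_def split: if_splits)
  then show ?thesis unfolding form var by simp
qed

lemma goe_form_concentration:
  assumes t: "0 < t" "t \<le> 2"
  shows "measure (goe_space m n) {\<omega> \<in> space (goe_space m n).
    \<bar>(\<Sum>i<m. (goe_form n \<omega> M i)\<^sup>2) - real m * goe_var n M\<bar> > t * (real m * goe_var n M)} \<le> 2 * exp (- (real m * t\<^sup>2 / 16))"
proof -
  interpret prob_space "goe_space m n" by (rule prob_space_goe_space)
  have nonneg: "goe_var n M \<ge> 0"
    unfolding goe_var_triangle[of n M 0] by (intro sum_nonneg) auto
  show ?thesis
  proof (cases "goe_var n M = 0")
    \<comment> \<open>Zero variance forces all folded coefficients to vanish, so the form is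
      identically 0. The deviation event is defined by a strict inequality and is therefore
      empty.\<close>
    case True
    have "(if j = k then M j j else M j k + M k j) = 0" if "j \<le> k" "k < n" for j k
    proof -
      have fin: "finite (goe_slice n i)" for i
        using finite_subset[OF goe_slice_subset[of i "Suc i"] finite_goe_index] by auto
      have "\<forall>e\<in>goe_slice n 0. (case e of (i', j, k) \<Rightarrow> ((if j = k then M j j else M j k + M k j) * (if j = k then sqrt 2 else 1))\<^sup>2) = 0"
        using True unfolding goe_var_triangle[of n M 0]
        by (subst (asm) sum_nonneg_eq_0_iff) (auto simp: fin)
      from bspec[OF this, of "(0, j, k)"] that show ?thesis
        by (auto simp: goe_slice_def split: if_splits)
    qed
    then have "goe_form n \<omega> M i = 0" for \<omega> i
      unfolding goe_form_triangle by (intro sum.neutral) (auto simp: goe_slice_def)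
    then show ?thesis using True by simp
  next
    case False
    then have pos: "goe_var n M > 0" using nonneg by simp
    show ?thesis
      using sum_square_normal_concentration[OF goe_form_indep goe_form_normal[OF _ pos] _ t] pos by simp
  qed
qed

text \<open>Probability enters the later argument only through this union bound. Beyond it,
  statements are about a fixed sample at which all matrices of a finite family behave as
  expected.\<close>

lemma goe_form_uniform_concentration:
  assumes t: "0 < t" "t \<le> 2" and fin: "finite \<M>"
  shows "\<exists>E\<in>sets (goe_space m n). measure (goe_space m n) E \<ge> 1 - real (card \<M>) * (2 * exp (- (real m * t\<^sup>2 / 16))) \<and>
    (\<forall>\<omega>\<in>E. \<forall>M\<in>\<M>. \<bar>(\<Sum>i<m. (goe_form n \<omega> M i)\<^sup>2) - real m * goe_var n M\<bar> \<le> t * (real m * goe_var n M))"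
proof -
  interpret prob_space "goe_space m n" by (rule prob_space_goe_space)
  let ?S = "space (goe_space m n)"
  define B where "B M = {\<omega> \<in> ?S. \<bar>(\<Sum>i<m. (goe_form n \<omega> M i)\<^sup>2) - real m * goe_var n M\<bar> > t * (real m * goe_var n M)}" for M
  have B[measurable]: "B M \<in> events" for M
    unfolding B_def by measurable
  have UB: "(\<Union>M\<in>\<M>. B M) \<in> events" using fin B by (intro sets.finite_UN) auto
  have "prob (\<Union>M\<in>\<M>. B M) \<le> (\<Sum>M\<in>\<M>. prob (B M))"
    using B by (intro finite_measure_subadditive_finite fin) auto
  also have "\<dots> \<le> (\<Sum>M\<in>\<M>. 2 * exp (- (real m * t\<^sup>2 / 16)))"
    unfolding B_def by (intro sum_mono goe_form_concentration t)
  finally have "prob (\<Union>M\<in>\<M>. B M) \<le> real (card \<M>) * (2 * exp (- (real m * t\<^sup>2 / 16)))" by simp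
  moreover have "prob (?S - (\<Union>M\<in>\<M>. B M)) = 1 - prob (\<Union>M\<in>\<M>. B M)"
    by (rule prob_compl[OF UB])
  ultimately show ?thesis
    by (intro bexI[of _ "?S - (\<Union>M\<in>\<M>. B M)"]) (use UB in \<open>auto simp: B_def not_less\<close>)
qed

section \<open>Quadratic forms on a grid\<close>

text \<open>The mesh \<open>1 / (16 * N)\<close> is fine enough for every index set of size at most
  \<open>N\<^sup>2\<close>, because rounding then moves a point by at most 1/16. Taking
  \<open>N = n\<close> serves vectors of length \<open>n\<close> as well as \<open>n\<close> by
  \<open>r\<close> matrices with \<open>r \<le> n\<close>. Extensional functions keep the set
  finite.\<close>

definition ball_grid :: "'i set \<Rightarrow> nat \<Rightarrow> ('i \<Rightarrow> real) set" where
  "ball_grid I N = {g \<in> I \<rightarrow>\<^sub>E (\<lambda>k::int. real_of_int k / (16 * real N)) ` {- 16 * int N..16 * int N}. (\<Sum>a\<in>I. (g a)\<^sup>2) \<le> 1}"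

lemma finite_ball_grid: "finite I \<Longrightarrow> finite (ball_grid I N)"
  unfolding ball_grid_def by (rule finite_subset[OF Collect_restrict]) (intro finite_PiE, auto)

lemma card_ball_grid:
  assumes "finite I" "N \<ge> 1"
  shows "card (ball_grid I N) \<le> (33 * N) ^ card I"
proof -
  let ?K = "(\<lambda>k::int. real_of_int k / (16 * real N)) ` {- 16 * int N..16 * int N}"
  have "card (ball_grid I N) \<le> card (I \<rightarrow>\<^sub>E ?K)"
    unfolding ball_grid_def by (intro card_mono finite_PiE assms) auto
  also have "\<dots> = card ?K ^ card I" using assms by (simp add: card_PiE)
  also have "card ?K \<le> card {- 16 * int N..16 * int N}" by (rule card_image_le) simp
  \<comment> \<open>There are \<open>32 * N + 1\<close> integers in the range, at most
    \<open>33 * N\<close> because \<open>N \<ge> 1\<close>.\<close>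
  also have "card {- 16 * int N..16 * int N} \<le> 33 * N" using assms by simp
  finally show ?thesis by (simp add: power_mono)
qed

text \<open>Rounding each coordinate towards 0 stays inside the unit ball.\<close>

lemma ball_grid_approx:
  assumes I: "finite I" "card I \<le> N\<^sup>2" "N \<ge> 1" and x: "(\<Sum>a\<in>I. (x a)\<^sup>2) \<le> 1"
  obtains g where "g \<in> ball_grid I N" "(\<Sum>a\<in>I. (x a - g a)\<^sup>2) \<le> 1 / 256"
proof -
  define k where "k a = (if x a \<ge> 0 then \<lfloor>16 * real N * x a\<rfloor> else \<lceil>16 * real N * x a\<rceil>)" for a
  define g where "g = (\<lambda>a\<in>I. real_of_int (k a) / (16 * real N))"
  have N: "real N > 0" using I by simp
  have 1: "\<bar>real_of_int (k a)\<bar> \<le> 16 * real N * \<bar>x a\<bar>" "\<bar>16 * real N * x a - real_of_int (k a)\<bar> \<le> 1" for a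
  proof -
    show "\<bar>real_of_int (k a)\<bar> \<le> 16 * real N * \<bar>x a\<bar>"
    proof (cases "x a \<ge> 0")
      case True
      then have "0 \<le> 16 * real N * x a" by simp
      then have "0 \<le> \<lfloor>16 * real N * x a\<rfloor>" by simp
      then have "\<bar>real_of_int \<lfloor>16 * real N * x a\<rfloor>\<bar> = real_of_int \<lfloor>16 * real N * x a\<rfloor>" by simp
      then show ?thesis using True by (simp add: k_def)
    next
      case False
      then have "16 * real N * x a \<le> 0" by (simp add: mult_nonneg_nonpos)
      then have "\<lceil>16 * real N * x a\<rceil> \<le> 0" by (simp add: ceiling_le_zero)
      then have "\<bar>real_of_int \<lceil>16 * real N * x a\<rceil>\<bar> = - real_of_int \<lceil>16 * real N * x a\<rceil>" by simp
      then show ?thesis using False le_of_int_ceiling[of "16 * real N * x a"] by (simp add: k_def)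
    qed
    show "\<bar>16 * real N * x a - real_of_int (k a)\<bar> \<le> 1"
      using floor_correct[of "16 * real N * x a"] ceiling_correct[of "16 * real N * x a"]
      by (cases "x a \<ge> 0") (simp_all only: k_def if_True if_False, linarith+)
  qed
  have g: "\<bar>g a\<bar> \<le> \<bar>x a\<bar>" "\<bar>x a - g a\<bar> \<le> 1 / (16 * real N)" if "a \<in> I" for a
  proof -
    show "\<bar>g a\<bar> \<le> \<bar>x a\<bar>" using 1(1)[of a] that N by (simp add: g_def field_simps)
    have "x a - g a = (16 * real N * x a - real_of_int (k a)) / (16 * real N)"
      using that N by (simp add: g_def field_simps)
    then show "\<bar>x a - g a\<bar> \<le> 1 / (16 * real N)"
      using 1(2)[of a] N by (simp add: divide_right_mono)
  qed
  have "(\<Sum>a\<in>I. (g a)\<^sup>2) \<le> (\<Sum>a\<in>I. (x a)\<^sup>2)"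
    using g(1) by (intro sum_mono) (simp add: abs_le_square_iff)
  moreover have "k a \<in> {- 16 * int N..16 * int N}" if "a \<in> I" for a
  proof -
    have "(x a)\<^sup>2 \<le> (\<Sum>a\<in>I. (x a)\<^sup>2)"
      by (rule member_le_sum[OF that]) (auto simp: I)
    then have "\<bar>x a\<bar> \<le> 1" using x abs_le_square_iff[of "x a" 1] by simp
    then have "16 * real N * \<bar>x a\<bar> \<le> 16 * real N" using N by simp
    then have "\<bar>real_of_int (k a)\<bar> \<le> real_of_int (16 * int N)" using 1(1)[of a] by simp
    then have "\<bar>k a\<bar> \<le> 16 * int N" by linarith
    then show ?thesis by auto
  qed
  ultimately have "g \<in> ball_grid I N"
    using x by (auto simp: ball_grid_def g_def)
  moreover have "(\<Sum>a\<in>I. (x a - g a)\<^sup>2) \<le> (\<Sum>a\<in>I. (1 / (16 * real N))\<^sup>2)"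
  proof (intro sum_mono)
    fix a assume "a \<in> I"
    then have "\<bar>x a - g a\<bar>\<^sup>2 \<le> (1 / (16 * real N))\<^sup>2" using g(2) by (intro power_mono) auto
    then show "(x a - g a)\<^sup>2 \<le> (1 / (16 * real N))\<^sup>2" by simp
  qed
  moreover have "(\<Sum>a\<in>I. (1 / (16 * real N))\<^sup>2) \<le> 1 / 256"
  proof -
    have "real (card I) \<le> (real N)\<^sup>2" using I(2) by (metis of_nat_le_iff of_nat_power)
    then show ?thesis using N by (simp add: power2_eq_square field_simps)
  qed
  ultimately show ?thesis using that by fastforce
qed

text \<open>A self-improving estimate for the supremum \<open>S\<close> of \<bar>q\<bar> on the unit
  ball. For a grid point \<open>g\<close> near \<open>x\<close>, the difference
  \<open>q x - q g\<close> is the bilinear form at \<open>x - g\<close> and \<open>x + g\<close>,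
  which is small against \<open>S\<close>. This gives S \<le> \<tau> + S / 7, and 7/6 is below
  6/5.\<close>

lemma quadratic_form_grid_bound:
  fixes B :: "'i \<Rightarrow> 'i \<Rightarrow> real" and I :: "'i set" and N :: nat
  defines "q \<equiv> \<lambda>x. \<Sum>a\<in>I. \<Sum>b\<in>I. B a b * x a * x b"
  assumes I: "finite I" "card I \<le> N\<^sup>2" "N \<ge> 1"
    and sym: "\<And>a b. a \<in> I \<Longrightarrow> b \<in> I \<Longrightarrow> B a b = B b a"
    and grid: "\<And>g. g \<in> ball_grid I N \<Longrightarrow> \<bar>q g\<bar> \<le> \<tau>"
  shows "\<bar>q x\<bar> \<le> 6 / 5 * \<tau> * (\<Sum>a\<in>I. (x a)\<^sup>2)"
proof -
  let ?n = "\<lambda>x :: 'i \<Rightarrow> real. \<Sum>a\<in>I. (x a)\<^sup>2"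
  define \<beta> where "\<beta> u v = (\<Sum>a\<in>I. \<Sum>b\<in>I. B a b * u a * v b)" for u v
  have q\<beta>: "q x = \<beta> x x" for x by (simp add: q_def \<beta>_def)
  have \<beta>sym: "\<beta> u v = \<beta> v u" for u v
  proof -
    have "\<beta> u v = (\<Sum>b\<in>I. \<Sum>a\<in>I. B a b * u a * v b)" unfolding \<beta>_def by (rule sum.swap)
    also have "\<dots> = \<beta> v u" unfolding \<beta>_def by (intro sum.cong refl) (simp add: sym)
    finally show ?thesis .
  qed
  have \<beta>_add: "\<beta> (\<lambda>a. c * u a + d * v a) w = c * \<beta> u w + d * \<beta> v w" for c d u v w
    unfolding \<beta>_def by (simp add: sum_distrib_left sum.distrib algebra_simps)
  have \<beta>_add': "\<beta> w (\<lambda>a. c * u a + d * v a) = c * \<beta> w u + d * \<beta> w v" for c d u v w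
    using \<beta>_add[of c u d v w] by (simp add: \<beta>sym[of w])
  define S where "S = Sup ((\<lambda>x. \<bar>q x\<bar>) ` {x. ?n x \<le> 1})"
  have coord: "\<bar>x a\<bar> \<le> 1" if "?n x \<le> 1" "a \<in> I" for x :: "'i \<Rightarrow> real" and a
  proof -
    have "(x a)\<^sup>2 \<le> ?n x" using member_le_sum[OF that(2), of "\<lambda>a. (x a)\<^sup>2"] I by simp
    then show ?thesis using that abs_le_square_iff[of "x a" 1] by simp
  qed
  \<comment> \<open>Finiteness of \<open>S\<close> is what later permits absorbing
    \<open>S / 7\<close> into the left-hand side.\<close>
  have bdd: "bdd_above ((\<lambda>x. \<bar>q x\<bar>) ` {x. ?n x \<le> 1})"
  proof (rule bdd_aboveI2)
    fix x assume "x \<in> {x. ?n x \<le> 1}"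
    then have c: "\<bar>x a\<bar> \<le> 1" if "a \<in> I" for a using coord that by blast
    have "\<bar>q x\<bar> \<le> (\<Sum>a\<in>I. \<bar>\<Sum>b\<in>I. B a b * x a * x b\<bar>)" unfolding q_def by (rule sum_abs)
    also have "\<dots> \<le> (\<Sum>a\<in>I. \<Sum>b\<in>I. \<bar>B a b * x a * x b\<bar>)" by (intro sum_mono sum_abs)
    also have "\<dots> \<le> (\<Sum>a\<in>I. \<Sum>b\<in>I. \<bar>B a b\<bar>)"
    proof (intro sum_mono)
      fix a b assume "a \<in> I" "b \<in> I"
      then have "\<bar>x a\<bar> * \<bar>x b\<bar> \<le> 1" using c by (intro mult_le_one) auto
      then have "\<bar>B a b\<bar> * (\<bar>x a\<bar> * \<bar>x b\<bar>) \<le> \<bar>B a b\<bar> * 1" by (intro mult_left_mono) auto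
      then show "\<bar>B a b * x a * x b\<bar> \<le> \<bar>B a b\<bar>" by (simp add: abs_mult mult.assoc)
    qed
    finally show "\<bar>q x\<bar> \<le> (\<Sum>a\<in>I. \<Sum>b\<in>I. \<bar>B a b\<bar>)" .
  qed
  have S0: "S \<ge> 0"
  proof -
    have "\<bar>q (\<lambda>_. 0)\<bar> \<le> S" unfolding S_def by (rule cSUP_upper[OF _ bdd]) simp
    then show ?thesis by linarith
  qed
  have S: "\<bar>q y\<bar> \<le> S * ?n y" for y
  proof (cases "?n y = 0")
    case True
    then have "y a = 0" if "a \<in> I" for a using that I by (simp add: sum_nonneg_eq_0_iff)
    then have "q y = 0" unfolding q_def by (intro sum.neutral ballI) auto
    then show ?thesis using S0 by (simp add: sum_nonneg)
  next
    case False
    then have pos: "?n y > 0" by (simp add: order_less_le sum_nonneg)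
    define c where "c = 1 / sqrt (?n y)"
    have c2: "c\<^sup>2 = 1 / ?n y" using pos by (simp add: c_def power_divide)
    have "?n (\<lambda>a. c * y a) = c\<^sup>2 * ?n y" by (simp add: power_mult_distrib sum_distrib_left)
    then have "?n (\<lambda>a. c * y a) \<le> 1" using pos by (simp add: c2)
    then have "\<bar>q (\<lambda>a. c * y a)\<bar> \<le> S" unfolding S_def by (intro cSUP_upper[OF _ bdd]) simp
    moreover have "q (\<lambda>a. c * y a) = c\<^sup>2 * q y"
      unfolding q_def by (simp add: sum_distrib_left power2_eq_square algebra_simps)
    ultimately have "c\<^sup>2 * \<bar>q y\<bar> \<le> S" by (simp add: abs_mult)
    then show ?thesis using pos by (simp add: c2 field_simps)
  qed
  have \<beta>bd: "\<bar>\<beta> u v\<bar> \<le> S / 2 * (?n u + ?n v)" for u v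
  proof -
    have "q (\<lambda>a. 1 * u a + 1 * v a) - q (\<lambda>a. 1 * u a + (-1) * v a) = 4 * \<beta> u v"
      unfolding q\<beta> \<beta>_add \<beta>_add' by (simp add: \<beta>sym[of v u])
    then have "4 * \<bar>\<beta> u v\<bar> \<le> S * ?n (\<lambda>a. u a + v a) + S * ?n (\<lambda>a. u a - v a)"
      using S[of "\<lambda>a. u a + v a"] S[of "\<lambda>a. u a - v a"] by simp
    also have "\<dots> = S * (?n (\<lambda>a. u a + v a) + ?n (\<lambda>a. u a - v a))" by (simp add: distrib_left)
    also have "?n (\<lambda>a. u a + v a) + ?n (\<lambda>a. u a - v a) = 2 * (?n u + ?n v)"
      by (simp add: sum.distrib sum_subtractf sum_distrib_left power2_eq_square algebra_simps)
    finally show ?thesis by (simp only: distrib_left mult.left_commute[of S 2])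
  qed
  have "\<bar>q x\<bar> \<le> \<tau> + S / 7" if x: "?n x \<le> 1" for x
  proof -
    obtain g where g: "g \<in> ball_grid I N" "?n (\<lambda>a. x a - g a) \<le> 1 / 256"
      using ball_grid_approx[OF I x] by blast
    have ng: "?n g \<le> 1" using g(1) by (simp add: ball_grid_def)
    have "?n (\<lambda>a. x a + g a) \<le> (\<Sum>a\<in>I. 2 * (x a)\<^sup>2 + 2 * (g a)\<^sup>2)"
    proof (intro sum_mono)
      fix a show "(x a + g a)\<^sup>2 \<le> 2 * (x a)\<^sup>2 + 2 * (g a)\<^sup>2"
        using zero_le_power2[of "x a - g a"] by (simp add: power2_eq_square algebra_simps)
    qed
    also have "\<dots> \<le> 4" using x ng by (simp add: sum.distrib sum_distrib_left[symmetric])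
    finally have n4: "?n (\<lambda>a. x a + g a) \<le> 4" .
    have "q x - q g = \<beta> (\<lambda>a. 1 * x a + (-1) * g a) (\<lambda>a. 1 * x a + 1 * g a)"
      unfolding \<beta>_add \<beta>_add' by (simp add: q\<beta> \<beta>sym[of g x])
    \<comment> \<open>Moving a factor 6 between the arguments nearly balances their squared norms,
      at most 36/256 and 4/36. Half of their sum is below 1/7.\<close>
    also have "\<dots> = \<beta> (\<lambda>a. 6 * (x a - g a)) (\<lambda>a. (x a + g a) / 6)"
      unfolding \<beta>_def by (intro sum.cong refl) (simp add: algebra_simps)
    finally have "\<bar>q x - q g\<bar> \<le> S / 2 * (?n (\<lambda>a. 6 * (x a - g a)) + ?n (\<lambda>a. (x a + g a) / 6))"
      using \<beta>bd[of "\<lambda>a. 6 * (x a - g a)" "\<lambda>a. (x a + g a) / 6"] by simp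
    also have "\<dots> = S / 2 * (36 * ?n (\<lambda>a. x a - g a) + ?n (\<lambda>a. x a + g a) / 36)"
    proof -
      have "?n (\<lambda>a. 6 * (x a - g a)) = 36 * ?n (\<lambda>a. x a - g a)"
        unfolding power_mult_distrib sum_distrib_left by simp
      moreover have "?n (\<lambda>a. (x a + g a) / 6) = ?n (\<lambda>a. x a + g a) / 36"
        unfolding power_divide sum_divide_distrib by simp
      ultimately show ?thesis by (simp only:)
    qed
    also have "\<dots> \<le> S / 2 * (36 * (1 / 256) + 4 / 36)"
      using g(2) n4 S0 by (intro mult_left_mono add_mono) auto
    also have "\<dots> \<le> S / 7" using S0 by simp
    finally show ?thesis using grid[OF g(1)] by linarith
  qed
  then have "S \<le> \<tau> + S / 7"
    unfolding S_def by (intro cSUP_least) (auto intro!: exI[of _ "\<lambda>_. 0"])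
  then have "S \<le> 6 / 5 * \<tau>" using S0 by linarith
  then have "S * ?n x \<le> 6 / 5 * \<tau> * ?n x" by (intro mult_right_mono sum_nonneg) auto
  then show ?thesis using S[of x] by linarith
qed

section \<open>One gradient step\<close>

definition sqn :: "nat \<Rightarrow> (nat \<Rightarrow> real) \<Rightarrow> real" where
  "sqn n x = (\<Sum>j<n. (x j)\<^sup>2)"

definition bil :: "nat \<Rightarrow> (nat \<Rightarrow> nat \<Rightarrow> real) \<Rightarrow> (nat \<Rightarrow> real) \<Rightarrow> (nat \<Rightarrow> real) \<Rightarrow> real" where
  "bil n a x y = (\<Sum>j<n. \<Sum>k<n. x j * a j k * y k)"

text \<open>In the following, matrices in \<open>\<real>\<^bsup>n\<times>r\<^esup>\<close> are given by their columns: \<open>V q j\<close> is the entry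
  in row \<open>j\<close> and column \<open>q\<close>.\<close>

definition fsq :: "nat \<Rightarrow> nat \<Rightarrow> (nat \<Rightarrow> nat \<Rightarrow> real) \<Rightarrow> real" where
  "fsq n r V = (\<Sum>q<r. sqn n (V q))"

text \<open>The trace of \<open>V\<^sup>T a W\<close>, summed column by column.\<close>

definition tbil :: "nat \<Rightarrow> nat \<Rightarrow> (nat \<Rightarrow> nat \<Rightarrow> real) \<Rightarrow> (nat \<Rightarrow> nat \<Rightarrow> real) \<Rightarrow> (nat \<Rightarrow> nat \<Rightarrow> real) \<Rightarrow> real" where
  "tbil n r a V W = (\<Sum>q<r. bil n a (V q) (W q))"

lemma sqn_nonneg [simp]: "0 \<le> sqn n x"
  by (simp add: sqn_def sum_nonneg)

lemma fsq_nonneg [simp]: "0 \<le> fsq n r V"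
  by (simp add: fsq_def sum_nonneg)

lemma bil_commute:
  assumes "\<And>j k. j < n \<Longrightarrow> k < n \<Longrightarrow> a j k = a k j"
  shows "bil n a x y = bil n a y x"
proof -
  have "bil n a x y = (\<Sum>k<n. \<Sum>j<n. x j * a j k * y k)" unfolding bil_def by (rule sum.swap)
  also have "\<dots> = bil n a y x" unfolding bil_def using assms by (intro sum.cong refl) simp
  finally show ?thesis .
qed

lemma tbil_commute:
  assumes "\<And>j k. j < n \<Longrightarrow> k < n \<Longrightarrow> a j k = a k j"
  shows "tbil n r a V W = tbil n r a W V"
  unfolding tbil_def using bil_commute[OF assms] by simp

lemma tbil_add_left: "tbil n r a (\<lambda>q j. V q j + V' q j) W = tbil n r a V W + tbil n r a V' W"
  unfolding tbil_def bil_def by (simp add: algebra_simps sum.distrib)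

lemma tbil_add_right: "tbil n r a W (\<lambda>q j. V q j + V' q j) = tbil n r a W V + tbil n r a W V'"
  unfolding tbil_def bil_def by (simp add: algebra_simps sum.distrib)

lemma L2_set_sum_le:
  "L2_set (\<lambda>i. \<Sum>q<(r::nat). f q i) A \<le> (\<Sum>q<r. L2_set (f q) A)"
proof (induction r)
  case (Suc r)
  then show ?case
    using L2_set_triangle_ineq[of "\<lambda>i. \<Sum>q<r. f q i" "f r" A] by simp
qed (simp add: L2_set_def)

text \<open>Minkowski's inequality over the columns followed by Cauchy-Schwarz over the columns: the
  rank one estimate passes to arbitrary rank with the same constant, without a factor
  \<open>r\<close>.\<close>

lemma sum_tbil_square_le:
  assumes R1: "\<And>x y. (\<Sum>i<m. (bil n (a i) x y)\<^sup>2) \<le> C * sqn n x * sqn n y" and C: "C \<ge> 0"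
  shows "(\<Sum>i<m. (tbil n r (a i) V W)\<^sup>2) \<le> C * fsq n r V * fsq n r W"
proof -
  have "L2_set (\<lambda>i. tbil n r (a i) V W) {..<m} \<le> (\<Sum>q<r. L2_set (\<lambda>i. bil n (a i) (V q) (W q)) {..<m})"
    unfolding tbil_def by (rule L2_set_sum_le)
  also have "\<dots> \<le> (\<Sum>q<r. sqrt C * (\<bar>sqrt (sqn n (V q))\<bar> * \<bar>sqrt (sqn n (W q))\<bar>))"
    by (intro sum_mono) (use R1 in \<open>simp add: L2_set_def real_sqrt_mult[symmetric] mult.assoc\<close>)
  also have "\<dots> \<le> sqrt C * (sqrt (fsq n r V) * sqrt (fsq n r W))"
    unfolding sum_distrib_left[symmetric]
    using L2_set_mult_ineq[of "\<lambda>q. sqrt (sqn n (V q))" "\<lambda>q. sqrt (sqn n (W q))" "{..<r}"] C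
    by (intro mult_left_mono) (auto simp: L2_set_def fsq_def)
  finally have "L2_set (\<lambda>i. tbil n r (a i) V W) {..<m} \<le> sqrt (C * fsq n r V * fsq n r W)"
    by (simp add: real_sqrt_mult)
  then show ?thesis by (simp add: L2_set_def)
qed

text \<open>The new squared distance is \<open>?h - 2 * \<eta> * \<langle>G, H\<rangle> +
  \<eta>\<^sup>2 * ?g\<close>. The inner product is at least \<open>3 / 32 * \<sigma> * ?h\<close>,
  and \<open>?g\<close> is at most \<open>192 * ?h * ?z\<^sup>2\<close>. The bound on the step size
  limits the quadratic term to \<open>5 / 48 * \<eta> * \<sigma> * ?h\<close>, and 3/16 - 5/48 =
  1/12.\<close>

lemma gradient_step_contracts:
  fixes a :: "nat \<Rightarrow> nat \<Rightarrow> nat \<Rightarrow> real" and \<sigma> \<eta> :: real and n r m :: nat and Z Zs H G :: "nat \<Rightarrow> nat \<Rightarrow> real"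
  defines "T \<equiv> \<lambda>i. tbil n r (a i)"
  assumes m: "m > 0" and sym: "\<And>i j k. i < m \<Longrightarrow> j < n \<Longrightarrow> k < n \<Longrightarrow> a i j k = a i k j"
    and R1: "\<And>x y. (\<Sum>i<m. (bil n (a i) x y)\<^sup>2) \<le> 3 * real m * sqn n x * sqn n y"
    and R2: "(\<Sum>i<m. (T i H Zs)\<^sup>2) \<ge> 3 / 4 * real m * \<sigma> * fsq n r H"
    and close: "fsq n r H \<le> 3 / 16 * \<sigma>" and \<sigma>: "\<sigma> \<le> fsq n r Zs"
    and Z: "Z = (\<lambda>q j. Zs q j + H q j)"
    and G: "G = (\<lambda>q j. 1 / real m * (\<Sum>i<m. (T i Z Z - T i Zs Zs) * (\<Sum>k<n. a i j k * Z q k)))"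
    and \<eta>: "0 \<le> \<eta>" "192 * \<eta> * (fsq n r Zs)\<^sup>2 \<le> 5 / 48 * \<sigma>"
  shows "fsq n r (\<lambda>q j. H q j - \<eta> * G q j) \<le> (1 - \<eta> * \<sigma> / 12) * fsq n r H"
proof -
  let ?h = "fsq n r H" and ?z = "fsq n r Zs" and ?g = "fsq n r G"
  have comm: "T i V W = T i W V" if "i < m" for i V W
    unfolding T_def using sym[OF that] by (intro tbil_commute) auto
  have up: "(\<Sum>i<m. (T i V W)\<^sup>2) \<le> 3 * real m * fsq n r V * fsq n r W" for V W
    unfolding T_def by (rule sum_tbil_square_le[OF R1]) simp
  define A where "A i = 2 * T i H Zs" for i
  define b where "b i = T i H H" for i
  have c: "T i Z Z - T i Zs Zs = A i + b i" if "i < m" for i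
    using comm[OF that, of Zs H] unfolding Z A_def b_def T_def by (simp add: tbil_add_left tbil_add_right)
  have hz: "T i H Z = A i / 2 + b i" for i
    unfolding Z A_def b_def T_def by (simp add: tbil_add_right)
  have Gip: "(\<Sum>q<r. \<Sum>j<n. G q j * W q j) = 1 / real m * (\<Sum>i<m. (A i + b i) * T i W Z)" for W
  proof -
    have "(\<Sum>q<r. \<Sum>j<n. G q j * W q j) = (\<Sum>q<r. \<Sum>j<n. \<Sum>i<m. 1 / real m * ((T i Z Z - T i Zs Zs) * (\<Sum>k<n. W q j * a i j k * Z q k)))"
      unfolding G by (simp add: sum_distrib_left sum_distrib_right mult_ac)
    also have "\<dots> = (\<Sum>q<r. \<Sum>i<m. \<Sum>j<n. 1 / real m * ((T i Z Z - T i Zs Zs) * (\<Sum>k<n. W q j * a i j k * Z q k)))"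
      by (rule sum.cong[OF refl]) (rule sum.swap)
    also have "\<dots> = (\<Sum>i<m. \<Sum>q<r. \<Sum>j<n. 1 / real m * ((T i Z Z - T i Zs Zs) * (\<Sum>k<n. W q j * a i j k * Z q k)))"
      by (rule sum.swap)
    also have "\<dots> = 1 / real m * (\<Sum>i<m. (T i Z Z - T i Zs Zs) * T i W Z)"
      unfolding T_def tbil_def bil_def by (simp only: sum_distrib_left)
    finally show ?thesis using c by simp
  qed
  have A2: "(\<Sum>i<m. (A i)\<^sup>2) \<ge> 3 * real m * \<sigma> * ?h" "(\<Sum>i<m. (A i)\<^sup>2) \<le> 12 * real m * ?h * ?z"
    using R2 up[of H Zs] by (simp_all add: A_def power_mult_distrib sum_distrib_left[symmetric])
  have h\<sigma>: "?h * ?h \<le> 3 / 16 * \<sigma> * ?h" by (rule mult_right_mono[OF close]) simp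
  have b2: "(\<Sum>i<m. (b i)\<^sup>2) \<le> 3 * real m * (?h * ?h)"
    using up[of H H] by (simp add: b_def mult.assoc)
  have mh: "real m * (?h * ?h) \<le> real m * (3 / 16 * \<sigma> * ?h)"
    by (rule mult_left_mono[OF h\<sigma>]) simp
  have GH: "(\<Sum>q<r. \<Sum>j<n. G q j * H q j) \<ge> 3 / 32 * \<sigma> * ?h"
  proof -
    have "(\<Sum>i<m. (A i)\<^sup>2) / 8 - (\<Sum>i<m. (b i)\<^sup>2) / 2 = (\<Sum>i<m. (A i)\<^sup>2 / 8 - (b i)\<^sup>2 / 2)"
      by (simp add: sum_subtractf sum_divide_distrib)
    also have "\<dots> \<le> (\<Sum>i<m. (A i + b i) * T i H Z)"
    proof (intro sum_mono)
      fix i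
      \<comment> \<open>This square is exactly \<open>(A i + b i) * (A i / 2 + b i) - (A i)\<^sup>2
        / 8 + (b i)\<^sup>2 / 2\<close>.\<close>
      have "0 \<le> 3 / 8 * (A i + 2 * b i)\<^sup>2" by simp
      then show "(A i)\<^sup>2 / 8 - (b i)\<^sup>2 / 2 \<le> (A i + b i) * T i H Z"
        by (simp add: hz power2_eq_square field_simps)
    qed
    \<comment> \<open>The terms \<open>A i\<close> contribute 3/8. The terms \<open>b i\<close>
      remove at most 3/2 times the relative radius 3/16, that is 9/32. This is where the size of the
      basin of attraction enters.\<close>
    finally have "(\<Sum>i<m. (A i + b i) * T i H Z) \<ge> 3 / 32 * (real m * (\<sigma> * ?h))"
      using A2(1) b2 mh by (simp add: mult.assoc)
    then show ?thesis unfolding Gip using m by (simp add: field_simps)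
  qed
  have GG: "?g \<le> 192 * ?h * ?z\<^sup>2"
  proof (cases "?g = 0")
    case True
    then show ?thesis by simp
  next
    case False
    then have g: "?g > 0" by (simp add: order_less_le)
    have hz4: "?h \<le> ?z / 4" using close \<sigma> fsq_nonneg[of n r H] by linarith
    have "?h * ?h \<le> ?h * (?z / 4)" by (rule mult_left_mono[OF hz4]) simp
    then have mhz: "real m * (?h * ?h) \<le> real m * (?h * (?z / 4))" by (rule mult_left_mono) simp
    have "(\<Sum>i<m. (A i + b i)\<^sup>2) \<le> (\<Sum>i<m. 2 * (A i)\<^sup>2 + 2 * (b i)\<^sup>2)"
    proof (intro sum_mono)
      fix i show "(A i + b i)\<^sup>2 \<le> 2 * (A i)\<^sup>2 + 2 * (b i)\<^sup>2"
        using zero_le_power2[of "A i - b i"] by (simp add: power2_eq_square algebra_simps)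
    qed
    also have "\<dots> = 2 * (\<Sum>i<m. (A i)\<^sup>2) + 2 * (\<Sum>i<m. (b i)\<^sup>2)"
      by (simp add: sum.distrib sum_distrib_left)
    also have "\<dots> \<le> 51 / 2 * (real m * (?h * ?z))"
      using A2(2) b2 mhz by (simp add: mult.assoc)
    finally have c2: "(\<Sum>i<m. (A i + b i)\<^sup>2) \<le> 51 / 2 * (real m * (?h * ?z))" .
    have "fsq n r Z \<le> (\<Sum>q<r. \<Sum>j<n. 2 * (Zs q j)\<^sup>2 + 2 * (H q j)\<^sup>2)"
      unfolding fsq_def sqn_def Z
    proof (intro sum_mono)
      fix q j show "(Zs q j + H q j)\<^sup>2 \<le> 2 * (Zs q j)\<^sup>2 + 2 * (H q j)\<^sup>2"
        using zero_le_power2[of "Zs q j - H q j"] by (simp add: power2_eq_square algebra_simps)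
    qed
    also have "\<dots> = 2 * ?z + 2 * ?h"
      by (simp add: fsq_def sqn_def sum.distrib sum_distrib_left)
    finally have Z2: "fsq n r Z \<le> 5 / 2 * ?z" using hz4 by linarith
    \<comment> \<open>Pairing the gradient with itself makes \<open>?g\<close> appear on both sides
      after Cauchy-Schwarz, once squared and once to the first power, so one factor cancels. This is
      why \<open>?g = 0\<close> is split off. The constant is 51/2 * 3 * 5/2 = 765/4, rounded up to
      192.\<close>
    have "?g = (\<Sum>q<r. \<Sum>j<n. G q j * G q j)" by (simp add: fsq_def sqn_def power2_eq_square)
    also have "\<dots> = 1 / real m * (\<Sum>i<m. (A i + b i) * T i G Z)" by (rule Gip)
    finally have "(real m * ?g)\<^sup>2 = (\<Sum>i<m. (A i + b i) * T i G Z)\<^sup>2" using m by simp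
    also have "\<dots> \<le> (\<Sum>i<m. (A i + b i)\<^sup>2) * (\<Sum>i<m. (T i G Z)\<^sup>2)" by (rule Cauchy_Schwarz_ineq_sum)
    also have "\<dots> \<le> (51 / 2 * (real m * (?h * ?z))) * (3 * real m * ?g * (5 / 2 * ?z))"
    proof (rule mult_mono[OF c2])
      have "3 * real m * ?g * fsq n r Z \<le> 3 * real m * ?g * (5 / 2 * ?z)"
        by (rule mult_left_mono[OF Z2]) simp
      then show "(\<Sum>i<m. (T i G Z)\<^sup>2) \<le> 3 * real m * ?g * (5 / 2 * ?z)" using up[of G Z] by linarith
    qed (simp_all add: sum_nonneg)
    also have "\<dots> = (real m)\<^sup>2 * ?g * (765 / 4 * (?h * ?z\<^sup>2))" by (simp add: power2_eq_square)
    finally have "((real m)\<^sup>2 * ?g) * ?g \<le> ((real m)\<^sup>2 * ?g) * (765 / 4 * (?h * ?z\<^sup>2))"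
      by (simp add: power2_eq_square mult_ac)
    then have "?g \<le> 765 / 4 * (?h * ?z\<^sup>2)" using g m by simp
    moreover have "0 \<le> ?h * ?z\<^sup>2" by simp
    ultimately show ?thesis unfolding mult.assoc by linarith
  qed
  have "fsq n r (\<lambda>q j. H q j - \<eta> * G q j) = ?h - 2 * \<eta> * (\<Sum>q<r. \<Sum>j<n. G q j * H q j) + \<eta>\<^sup>2 * ?g"
    by (simp add: fsq_def sqn_def power2_eq_square algebra_simps sum.distrib sum_subtractf sum_distrib_left)
  also have "\<dots> \<le> ?h - 2 * \<eta> * (3 / 32 * \<sigma> * ?h) + \<eta>\<^sup>2 * (192 * ?h * ?z\<^sup>2)"
    using GH GG \<eta>(1) by (intro add_mono diff_mono mult_left_mono) auto
  also have "\<eta>\<^sup>2 * (192 * ?h * ?z\<^sup>2) = (\<eta> * ?h) * (192 * \<eta> * ?z\<^sup>2)" by (simp add: power2_eq_square)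
  also have "\<dots> \<le> (\<eta> * ?h) * (5 / 48 * \<sigma>)" using \<eta> by (intro mult_left_mono) auto
  finally show ?thesis by (simp add: algebra_simps)
qed

section \<open>Bounds uniform in the direction\<close>

definition mat_ip :: "nat \<Rightarrow> (nat \<Rightarrow> nat \<Rightarrow> real) \<Rightarrow> (nat \<Rightarrow> nat \<Rightarrow> real) \<Rightarrow> real" where
  "mat_ip n a M = (\<Sum>j<n. \<Sum>k<n. a j k * M j k)"

text \<open>The concentration event for \<open>M\<close> as a property of fixed matrices
  \<open>a i\<close>. The deterministic lemmas take it as hypothesis for the members of a grid
  family.\<close>

definition concentrated :: "nat \<Rightarrow> nat \<Rightarrow> (nat \<Rightarrow> nat \<Rightarrow> nat \<Rightarrow> real) \<Rightarrow> real \<Rightarrow> (nat \<Rightarrow> nat \<Rightarrow> real) \<Rightarrow> bool" where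
  "concentrated n m a t M \<longleftrightarrow> \<bar>(\<Sum>i<m. (mat_ip n (a i) M)\<^sup>2) - real m * goe_var n M\<bar> \<le> t * (real m * goe_var n M)"

definition ip :: "nat \<Rightarrow> (nat \<Rightarrow> real) \<Rightarrow> (nat \<Rightarrow> real) \<Rightarrow> real" where
  "ip n x y = (\<Sum>j<n. x j * y j)"

lemma goe_var_le: "goe_var n M \<le> 2 * (\<Sum>j<n. \<Sum>k<n. (M j k)\<^sup>2)"
proof -
  have "(\<Sum>j<n. \<Sum>k<n. 2 * (M j k * M k j)) \<le> (\<Sum>j<n. \<Sum>k<n. (M j k)\<^sup>2 + (M k j)\<^sup>2)"
    using sum_squares_bound by (intro sum_mono) (auto simp: mult.assoc)
  also have "\<dots> = 2 * (\<Sum>j<n. \<Sum>k<n. (M j k)\<^sup>2)"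
    using sum.swap[of "\<lambda>j k. (M k j)\<^sup>2" "{..<n}" "{..<n}"] by (simp add: sum.distrib)
  finally show ?thesis
    by (simp add: goe_var_def distrib_left sum.distrib power2_eq_square sum_distrib_left[symmetric])
qed

lemma goe_var_outer_le: "goe_var n (\<lambda>j k. x j * y k) \<le> 2 * (sqn n x * sqn n y)"
  using goe_var_le[of n "\<lambda>j k. x j * y k"] by (simp add: sqn_def sum_product power_mult_distrib)

lemma mat_ip_outer: "mat_ip n a (\<lambda>j k. x j * y k) = bil n a x y"
  unfolding mat_ip_def bil_def by (intro sum.cong refl) simp

lemma sum_square_linear:
  fixes c :: "'j \<Rightarrow> 'i \<Rightarrow> real"
  shows "(\<Sum>i\<in>A. (\<Sum>a\<in>I. c i a * x a)\<^sup>2) = (\<Sum>a\<in>I. \<Sum>b\<in>I. (\<Sum>i\<in>A. c i a * c i b) * x a * x b)"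
proof -
  have "(\<Sum>i\<in>A. (\<Sum>a\<in>I. c i a * x a)\<^sup>2) = (\<Sum>i\<in>A. \<Sum>a\<in>I. \<Sum>b\<in>I. c i a * c i b * x a * x b)"
    by (simp add: power2_eq_square sum_product mult_ac)
  also have "\<dots> = (\<Sum>a\<in>I. \<Sum>i\<in>A. \<Sum>b\<in>I. c i a * c i b * x a * x b)" by (rule sum.swap)
  also have "\<dots> = (\<Sum>a\<in>I. \<Sum>b\<in>I. \<Sum>i\<in>A. c i a * c i b * x a * x b)"
    by (intro sum.cong refl sum.swap)
  finally show ?thesis by (simp add: sum_distrib_right)
qed

text \<open>With \<open>g\<close> fixed, arbitrary and not necessarily on the grid, the sum of
  squares is a quadratic form in \<open>x\<close> with a Gram matrix, so the grid bound applies to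
  \<open>x\<close> alone.\<close>

lemma rank_one_grid_step:
  assumes n: "n \<ge> 1"
    and grid: "\<And>x. x \<in> ball_grid {..<n} n \<Longrightarrow> (\<Sum>i<m. (bil n (a i) g x)\<^sup>2) \<le> \<tau>"
  shows "(\<Sum>i<m. (bil n (a i) g x)\<^sup>2) \<le> 6 / 5 * \<tau> * sqn n x"
proof -
  define c where "c i k = (\<Sum>j<n. g j * a i j k)" for i k
  have bil: "bil n (a i) g x = (\<Sum>k<n. c i k * x k)" for i x
    unfolding bil_def c_def sum_distrib_right by (rule sum.swap)
  have q: "(\<Sum>i<m. (bil n (a i) g x)\<^sup>2) = (\<Sum>k<n. \<Sum>l<n. (\<Sum>i<m. c i k * c i l) * x k * x l)" for x
    unfolding bil by (rule sum_square_linear)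
  have "\<bar>\<Sum>k<n. \<Sum>l<n. (\<Sum>i<m. c i k * c i l) * x k * x l\<bar> \<le> 6 / 5 * \<tau> * (\<Sum>k<n. (x k)\<^sup>2)"
  proof (rule quadratic_form_grid_bound[where N = n])
    show "card {..<n} \<le> n\<^sup>2" by (simp add: power2_eq_square)
    show "(\<Sum>i<m. c i k * c i l) = (\<Sum>i<m. c i l * c i k)" for k l by (simp add: mult.commute)
    fix y :: "nat \<Rightarrow> real" assume "y \<in> ball_grid {..<n} n"
    from grid[OF this] show "\<bar>\<Sum>k<n. \<Sum>l<n. (\<Sum>i<m. c i k * c i l) * y k * y l\<bar> \<le> \<tau>"
      unfolding q[symmetric] by (simp add: sum_nonneg)
  qed (use n in auto)
  then show ?thesis unfolding q sqn_def by linarith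
qed

text \<open>The grid step is used once for each argument; symmetry of the \<open>a i\<close>
  exchanges the arguments in between. On grid points the sum is at most
  \<open>2 * (1 + 1/32) * m\<close>, and two factors 6/5 turn 33/16 into 297/100, below 3.\<close>

lemma rank_one_bound:
  assumes n: "n \<ge> 1" and sym: "\<And>i j k. i < m \<Longrightarrow> j < n \<Longrightarrow> k < n \<Longrightarrow> a i j k = a i k j"
    and t: "0 \<le> t" "t \<le> 1 / 32"
    and conc: "\<And>g x. g \<in> ball_grid {..<n} n \<Longrightarrow> x \<in> ball_grid {..<n} n \<Longrightarrow> concentrated n m a t (\<lambda>j k. g j * x k)"
  shows "(\<Sum>i<m. (bil n (a i) x y)\<^sup>2) \<le> 3 * real m * sqn n x * sqn n y"
proof -
  have 1: "(\<Sum>i<m. (bil n (a i) g x)\<^sup>2) \<le> 33 / 16 * real m" if g: "g \<in> ball_grid {..<n} n" and x: "x \<in> ball_grid {..<n} n" for g x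
  proof -
    let ?v = "goe_var n (\<lambda>j k. g j * x k)"
    have "sqn n g * sqn n x \<le> 1"
      using g x by (intro mult_le_one) (auto simp: sqn_def ball_grid_def sum_nonneg)
    then have "?v \<le> 2" using goe_var_outer_le[of n g x] by linarith
    then have v: "real m * ?v \<le> 2 * real m" using mult_left_mono[of ?v 2 "real m"] by simp
    have "(1 + t) * (real m * ?v) \<le> (1 + t) * (2 * real m)"
      using t v by (intro mult_left_mono) auto
    also have "\<dots> \<le> 33 / 32 * (2 * real m)" using t by (intro mult_right_mono) auto
    finally have "(1 + t) * (real m * ?v) \<le> 33 / 16 * real m" by simp
    then show ?thesis
      using conc[OF g x] by (simp add: concentrated_def mat_ip_outer abs_le_iff algebra_simps)
  qed
  have 2: "(\<Sum>i<m. (bil n (a i) x g)\<^sup>2) \<le> 6 / 5 * (33 / 16 * real m) * sqn n x" if g: "g \<in> ball_grid {..<n} n" for g x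
  proof -
    have "(\<Sum>i<m. (bil n (a i) g x)\<^sup>2) \<le> 6 / 5 * (33 / 16 * real m) * sqn n x"
      by (rule rank_one_grid_step[OF n]) (rule 1[OF g])
    moreover have "bil n (a i) g x = bil n (a i) x g" if "i < m" for i
      using sym[OF that] by (intro bil_commute) auto
    ultimately show ?thesis by simp
  qed
  have "(\<Sum>i<m. (bil n (a i) x y)\<^sup>2) \<le> 6 / 5 * (6 / 5 * (33 / 16 * real m) * sqn n x) * sqn n y"
    by (rule rank_one_grid_step[OF n]) (rule 2)
  also have "\<dots> = 297 / 100 * (real m * sqn n x * sqn n y)" by simp
  also have "\<dots> \<le> 3 * (real m * sqn n x * sqn n y)" by (intro mult_right_mono) auto
  finally show ?thesis by (simp add: mult.assoc)
qed

text \<open>The \<open>n\<close> by \<open>n\<close> matrix \<open>W U\<^sup>T\<close> for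
  \<open>W\<close> and \<open>U\<close> given by their columns.\<close>

definition outer :: "nat \<Rightarrow> (nat \<Rightarrow> nat \<Rightarrow> real) \<Rightarrow> (nat \<Rightarrow> nat \<Rightarrow> real) \<Rightarrow> nat \<Rightarrow> nat \<Rightarrow> real" where
  "outer r W U j k = (\<Sum>s<r. W s j * U s k)"

lemma mat_ip_outer_sum: "mat_ip n a (outer r W U) = tbil n r a W U"
proof -
  have "mat_ip n a (outer r W U) = (\<Sum>j<n. \<Sum>k<n. \<Sum>s<r. W s j * a j k * U s k)"
    unfolding mat_ip_def outer_def by (simp add: sum_distrib_left mult_ac)
  also have "\<dots> = (\<Sum>j<n. \<Sum>s<r. \<Sum>k<n. W s j * a j k * U s k)" by (intro sum.cong refl sum.swap)
  also have "\<dots> = tbil n r a W U" unfolding tbil_def bil_def by (rule sum.swap)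
  finally show ?thesis .
qed

text \<open>Frobenius products of such matrices reduce to entries of \<open>r\<close> by
  \<open>r\<close> Gram matrices, the form in which orthonormality and alignment are known.\<close>

lemma sum_outer_product:
  "(\<Sum>j<n. \<Sum>k<n. outer r W U j k * outer r W' U' j k) = (\<Sum>s<r. \<Sum>t<r. ip n (W s) (W' t) * ip n (U s) (U' t))"
proof -
  have "(\<Sum>j<n. \<Sum>k<n. outer r W U j k * outer r W' U' j k)
      = (\<Sum>j<n. \<Sum>k<n. \<Sum>s<r. \<Sum>t<r. (W s j * W' t j) * (U s k * U' t k))"
    unfolding outer_def by (simp add: sum_product mult_ac)
  also have "\<dots> = (\<Sum>j<n. \<Sum>s<r. \<Sum>k<n. \<Sum>t<r. (W s j * W' t j) * (U s k * U' t k))"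
    by (intro sum.cong refl sum.swap)
  also have "\<dots> = (\<Sum>j<n. \<Sum>s<r. \<Sum>t<r. \<Sum>k<n. (W s j * W' t j) * (U s k * U' t k))"
    by (intro sum.cong refl sum.swap)
  also have "\<dots> = (\<Sum>s<r. \<Sum>j<n. \<Sum>t<r. \<Sum>k<n. (W s j * W' t j) * (U s k * U' t k))"
    by (rule sum.swap)
  also have "\<dots> = (\<Sum>s<r. \<Sum>t<r. \<Sum>j<n. \<Sum>k<n. (W s j * W' t j) * (U s k * U' t k))"
    by (intro sum.cong refl sum.swap)
  finally show ?thesis by (simp add: ip_def sum_product)
qed

lemma outer_swap: "outer r W U k j = outer r U W j k"
  by (simp add: outer_def mult.commute)

lemma ip_commute: "ip n x y = ip n y x"
  by (simp add: ip_def mult.commute)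

lemma ip_self: "ip n x x = sqn n x"
  by (simp add: ip_def sqn_def power2_eq_square)

text \<open>The trace of the square of \<open>U\<^sup>T W\<close>. It is the part of the variance
  that comes from pairing \<open>W U\<^sup>T\<close> with its own transpose, and it can be negative
  for general \<open>W\<close>.\<close>

definition cross :: "nat \<Rightarrow> nat \<Rightarrow> (nat \<Rightarrow> nat \<Rightarrow> real) \<Rightarrow> (nat \<Rightarrow> nat \<Rightarrow> real) \<Rightarrow> real" where
  "cross n r U W = (\<Sum>s<r. \<Sum>t<r. ip n (W s) (U t) * ip n (U s) (W t))"

lemma goe_var_outer:
  assumes orth: "\<And>s t. s < r \<Longrightarrow> t < r \<Longrightarrow> ip n (U s) (U t) = (if s = t then 1 else 0)"
  shows "goe_var n (outer r W U) = fsq n r W + cross n r U W"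
proof -
  have "goe_var n (outer r W U) = (\<Sum>j<n. \<Sum>k<n. outer r W U j k * outer r W U j k)
      + (\<Sum>j<n. \<Sum>k<n. outer r W U j k * outer r U W j k)"
    by (simp add: goe_var_def distrib_left sum.distrib outer_swap[of r W U])
  also have "(\<Sum>j<n. \<Sum>k<n. outer r W U j k * outer r W U j k) = fsq n r W"
    unfolding sum_outer_product fsq_def by (simp add: orth ip_self if_distrib sum.delta cong: if_cong)
  finally show ?thesis by (simp add: sum_outer_product cross_def)
qed

text \<open>The deviation of the sum of squares from its mean is itself a quadratic form in the
  \<open>n * r\<close> entries of \<open>W\<close>, so the grid bound controls it directly. For
  \<open>W\<close> in the unit ball and orthonormal \<open>U\<close> the variance is at most 2,
  which gives \<open>2 * t * m\<close> on the grid and 12/5 after the factor 6/5.\<close>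

lemma tangent_bound:
  assumes n: "n \<ge> 1" "r \<le> n"
    and orth: "\<And>s t. s < r \<Longrightarrow> t < r \<Longrightarrow> ip n (U s) (U t) = (if s = t then 1 else 0)"
    and t: "0 \<le> t"
    and conc: "\<And>x. x \<in> ball_grid ({..<n} \<times> {..<r}) n \<Longrightarrow> concentrated n m a t (outer r (\<lambda>s j. x (j, s)) U)"
  shows "\<bar>(\<Sum>i<m. (tbil n r (a i) W U)\<^sup>2) - real m * (fsq n r W + cross n r U W)\<bar> \<le> 12 / 5 * t * real m * fsq n r W"
proof -
  let ?I = "{..<n} \<times> {..<r}"
  define c where "c i = (\<lambda>(j, s). \<Sum>k<n. a i j k * U s k)" for i
  \<comment> \<open>The coefficient matrix of the mean \<open>fsq + cross\<close> on entry pairs: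
    the identity gives \<open>fsq\<close>, the product of entries of \<open>U\<close> gives
    \<open>cross\<close>.\<close>
  define d where "d = (\<lambda>(j, s) (k, u). (if (j, s) = (k, u) then 1 else 0) + U u j * U s (k::nat) :: real)"
  define B where "B p q = (\<Sum>i<m. c i p * c i q) - real m * d p q" for p q
  have T: "tbil n r (a i) (\<lambda>s j. x (j, s)) U = (\<Sum>p\<in>?I. c i p * x p)" for i x
  proof -
    have "tbil n r (a i) (\<lambda>s j. x (j, s)) U = (\<Sum>s<r. \<Sum>j<n. c i (j, s) * x (j, s))"
      unfolding tbil_def bil_def c_def by (simp add: sum_distrib_left sum_distrib_right mult_ac)
    also have "\<dots> = (\<Sum>j<n. \<Sum>s<r. c i (j, s) * x (j, s))" by (rule sum.swap)
    finally show ?thesis by (simp add: sum.cartesian_product case_prod_unfold)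
  qed
  have F: "fsq n r (\<lambda>s j. x (j, s)) = (\<Sum>p\<in>?I. (x p)\<^sup>2)" for x
    unfolding fsq_def sqn_def by (subst sum.swap) (simp add: sum.cartesian_product case_prod_unfold)
  have X: "cross n r U (\<lambda>s j. x (j, s)) = (\<Sum>p\<in>?I. \<Sum>q\<in>?I. U (snd q) (fst p) * U (snd p) (fst q) * x p * x q)" for x
  proof -
    have pairs: "(\<Sum>j<n. \<Sum>s<r. f (j, s)) = (\<Sum>p\<in>?I. f p)" for f :: "nat \<times> nat \<Rightarrow> real"
      by (simp add: sum.cartesian_product)
    have "cross n r U (\<lambda>s j. x (j, s)) = (\<Sum>s<r. \<Sum>u<r. \<Sum>j<n. \<Sum>k<n. U u j * U s k * x (j, s) * x (k, u))"
      unfolding cross_def ip_def sum_product by (intro sum.cong refl) (simp add: mult_ac)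
    also have "\<dots> = (\<Sum>s<r. \<Sum>j<n. \<Sum>u<r. \<Sum>k<n. U u j * U s k * x (j, s) * x (k, u))"
      by (intro sum.cong refl sum.swap)
    also have "\<dots> = (\<Sum>s<r. \<Sum>j<n. \<Sum>k<n. \<Sum>u<r. U u j * U s k * x (j, s) * x (k, u))"
      by (intro sum.cong refl sum.swap)
    also have "\<dots> = (\<Sum>j<n. \<Sum>s<r. \<Sum>k<n. \<Sum>u<r. U u j * U s k * x (j, s) * x (k, u))"
      by (rule sum.swap)
    also have "\<dots> = (\<Sum>j<n. \<Sum>s<r. \<Sum>q\<in>?I. U (snd q) j * U s (fst q) * x (j, s) * x q)"
      unfolding pairs[symmetric] by simp
    also have "\<dots> = (\<Sum>p\<in>?I. \<Sum>q\<in>?I. U (snd q) (fst p) * U (snd p) (fst q) * x p * x q)"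
      unfolding pairs[symmetric, of "\<lambda>p. \<Sum>q\<in>?I. U (snd q) (fst p) * U (snd p) (fst q) * x p * x q"] by simp
    finally show ?thesis .
  qed
  have q: "(\<Sum>i<m. (tbil n r (a i) (\<lambda>s j. x (j, s)) U)\<^sup>2) - real m * (fsq n r (\<lambda>s j. x (j, s)) + cross n r U (\<lambda>s j. x (j, s)))
      = (\<Sum>p\<in>?I. \<Sum>q\<in>?I. B p q * x p * x q)" for x
  proof -
    have "(\<Sum>p\<in>?I. \<Sum>q\<in>?I. d p q * x p * x q)
        = (\<Sum>p\<in>?I. \<Sum>q\<in>?I. (if p = q then 1 else 0) * x p * x q) + cross n r U (\<lambda>s j. x (j, s))"
      unfolding X by (simp add: d_def case_prod_unfold distrib_right sum.distrib prod_eq_iff)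
    also have "(\<Sum>p\<in>?I. \<Sum>q\<in>?I. (if p = q then 1 else 0) * x p * x q) = fsq n r (\<lambda>s j. x (j, s))"
      unfolding F by (intro sum.cong refl) (simp add: if_distrib[of "\<lambda>c. c * _"] sum.delta power2_eq_square cong: if_cong)
    finally have d: "(\<Sum>p\<in>?I. \<Sum>q\<in>?I. d p q * x p * x q) = fsq n r (\<lambda>s j. x (j, s)) + cross n r U (\<lambda>s j. x (j, s))" .
    have "(\<Sum>p\<in>?I. \<Sum>q\<in>?I. B p q * x p * x q)
        = (\<Sum>p\<in>?I. \<Sum>q\<in>?I. (\<Sum>i<m. c i p * c i q) * x p * x q) - real m * (\<Sum>p\<in>?I. \<Sum>q\<in>?I. d p q * x p * x q)"
      unfolding B_def by (simp only: left_diff_distrib sum_subtractf sum_distrib_left mult.assoc)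
    then show ?thesis unfolding T sum_square_linear d by simp
  qed
  have "\<bar>\<Sum>p\<in>?I. \<Sum>q\<in>?I. B p q * x p * x q\<bar> \<le> 6 / 5 * (2 * t * real m) * (\<Sum>p\<in>?I. (x p)\<^sup>2)" for x
  proof (rule quadratic_form_grid_bound[where N = n])
    show "card ?I \<le> n\<^sup>2" using n by (simp add: power2_eq_square)
    show "B p q = B q p" for p q
      by (auto simp: B_def d_def mult.commute split: prod.splits)
    fix y assume y: "y \<in> ball_grid ?I n"
    let ?W = "\<lambda>s j. y (j, s)"
    have "goe_var n (outer r ?W U) \<le> 2 * (\<Sum>j<n. \<Sum>k<n. outer r ?W U j k * outer r ?W U j k)"
      using goe_var_le[of n "outer r ?W U"] by (simp add: power2_eq_square)
    also have "(\<Sum>j<n. \<Sum>k<n. outer r ?W U j k * outer r ?W U j k) = fsq n r ?W"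
      unfolding sum_outer_product fsq_def by (simp add: orth ip_self if_distrib sum.delta cong: if_cong)
    also have "\<dots> \<le> 1" using y by (simp add: F ball_grid_def)
    finally have v: "goe_var n (outer r ?W U) \<le> 2" by simp
    have "\<bar>(\<Sum>i<m. (tbil n r (a i) ?W U)\<^sup>2) - real m * (fsq n r ?W + cross n r U ?W)\<bar> \<le> t * (real m * goe_var n (outer r ?W U))"
      using conc[OF y] by (simp add: concentrated_def mat_ip_outer_sum goe_var_outer[OF orth])
    also have "\<dots> \<le> t * (real m * 2)" using t v by (intro mult_left_mono) auto
    finally show "\<bar>\<Sum>p\<in>?I. \<Sum>q\<in>?I. B p q * y p * y q\<bar> \<le> 2 * t * real m" by (simp add: q mult_ac)
  qed (use n in auto)
  from this[of "\<lambda>(j, s). W s j"] show ?thesis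
    using q[of "\<lambda>(j, s). W s j"] F[of "\<lambda>(j, s). W s j"] by simp
qed

lemma tangent_lower_bound:
  assumes n: "n \<ge> 1" "r \<le> n"
    and orth: "\<And>s t. s < r \<Longrightarrow> t < r \<Longrightarrow> ip n (U s) (U t) = (if s = t then 1 else 0)"
    and t: "0 \<le> t" "t \<le> 1 / 32"
    and conc: "\<And>x. x \<in> ball_grid ({..<n} \<times> {..<r}) n \<Longrightarrow> concentrated n m a t (outer r (\<lambda>s j. x (j, s)) U)"
    and \<sigma>: "\<And>s. s < r \<Longrightarrow> \<rho> \<le> \<sigma> s" "\<rho> > 0"
    and sym: "\<And>s u. s < r \<Longrightarrow> u < r \<Longrightarrow> ip n (Zs s) (H u) = ip n (Zs u) (H s)"
    and Zs: "\<And>s j. s < r \<Longrightarrow> j < n \<Longrightarrow> Zs s j = sqrt (\<sigma> s) * U s j"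
  shows "(\<Sum>i<m. (tbil n r (a i) H Zs)\<^sup>2) \<ge> 3 / 4 * real m * \<rho> * fsq n r H"
proof -
  define W where "W = (\<lambda>s j. sqrt (\<sigma> s) * H s j)"
  have pos: "\<sigma> s \<ge> 0" if "s < r" for s using \<sigma> that by (meson less_eq_real_def order_trans)
  have TW: "tbil n r (a i) H Zs = tbil n r (a i) W U" for i
    unfolding tbil_def bil_def W_def by (intro sum.cong refl) (simp add: Zs mult_ac)
  have ipZ: "ip n (Zs s) (H u) = sqrt (\<sigma> s) * ip n (U s) (H u)" if "s < r" for s u
    unfolding ip_def sum_distrib_left using that by (intro sum.cong refl) (simp add: Zs mult_ac)
  have ipW: "ip n (W s) (U u) = sqrt (\<sigma> s) * ip n (H s) (U u)" "ip n (U s) (W u) = sqrt (\<sigma> u) * ip n (U s) (H u)" for s u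
    by (simp_all add: ip_def W_def sum_distrib_left mult_ac)
  have "cross n r U W = (\<Sum>s<r. \<Sum>u<r. ip n (Zs s) (H u) * ip n (Zs u) (H s))"
    unfolding cross_def ipW by (intro sum.cong refl) (simp add: ipZ ip_commute[of n "H _"] mult_ac)
  also have "\<dots> = (\<Sum>s<r. \<Sum>u<r. (ip n (Zs s) (H u))\<^sup>2)"
    using sym by (intro sum.cong refl) (simp add: power2_eq_square)
  finally have cross: "cross n r U W \<ge> 0" by (simp add: sum_nonneg)
  have "\<rho> * fsq n r H \<le> fsq n r W"
    unfolding fsq_def sum_distrib_left
  proof (intro sum_mono)
    fix s assume s: "s \<in> {..<r}"
    have "sqn n (W s) = \<sigma> s * sqn n (H s)"
      using pos s by (simp add: sqn_def W_def power_mult_distrib sum_distrib_left)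
    then show "\<rho> * sqn n (H s) \<le> sqn n (W s)"
      using \<sigma> s by (simp add: mult_right_mono)
  qed
  then have "3 / 4 * real m * (\<rho> * fsq n r H) \<le> 3 / 4 * real m * fsq n r W"
    by (intro mult_left_mono) auto
  also have "\<dots> \<le> real m * (fsq n r W + cross n r U W) - 12 / 5 * t * real m * fsq n r W"
  proof -
    have "12 / 5 * t * (real m * fsq n r W) \<le> 1 / 4 * (real m * fsq n r W)"
      using t by (intro mult_right_mono) auto
    moreover have "0 \<le> real m * cross n r U W" using cross by simp
    ultimately show ?thesis by (simp add: algebra_simps)
  qed
  also have "\<dots> \<le> (\<Sum>i<m. (tbil n r (a i) H Zs)\<^sup>2)"
    using tangent_bound[OF n orth t(1) conc, of W] unfolding TW by linarith
  finally show ?thesis by (simp add: mult.assoc)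
qed

section \<open>Optimal alignment of two factors\<close>

definition ortho :: "nat \<Rightarrow> real mat set" where
  "ortho r = {Q \<in> carrier_mat r r. Q * Q\<^sup>T = 1\<^sub>m r \<and> Q\<^sup>T * Q = 1\<^sub>m r}"

definition colfun :: "real mat \<Rightarrow> nat \<Rightarrow> nat \<Rightarrow> real" where
  "colfun A q j = A $$ (j, q)"

lemma frob_norm_colfun:
  assumes "A \<in> carrier_mat n r"
  shows "frob_norm A = sqrt (fsq n r (colfun A))"
  using assms unfolding frob_norm_def fsq_def sqn_def colfun_def
  by (subst sum.swap) (simp add: carrier_matD)

lemma ortho_iff:
  assumes "Q \<in> carrier_mat r r"
  shows "Q \<in> ortho r \<longleftrightarrow> (\<forall>s<r. \<forall>t<r. (\<Sum>u<r. Q $$ (s, u) * Q $$ (t, u)) = (if s = t then 1 else 0))"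
proof -
  have "Q * Q\<^sup>T = 1\<^sub>m r \<longleftrightarrow> (\<forall>s<r. \<forall>t<r. (\<Sum>u<r. Q $$ (s, u) * Q $$ (t, u)) = (if s = t then 1 else 0))"
    using assms by (auto simp: mat_eq_iff scalar_prod_def atLeast0LessThan)
  moreover have "Q\<^sup>T * Q = 1\<^sub>m r" if "Q * Q\<^sup>T = 1\<^sub>m r"
    using that assms by (intro mat_mult_left_right_inverse[of Q r]) auto
  ultimately show ?thesis using assms by (auto simp: ortho_def)
qed

lemma ortho_mult:
  assumes "Q \<in> ortho r" "R \<in> ortho r"
  shows "Q * R \<in> ortho r"
proof -
  have c[simp]: "Q \<in> carrier_mat r r" "R \<in> carrier_mat r r" "Q\<^sup>T \<in> carrier_mat r r" "R\<^sup>T \<in> carrier_mat r r"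
    and i: "Q * Q\<^sup>T = 1\<^sub>m r" "R * R\<^sup>T = 1\<^sub>m r" "Q\<^sup>T * Q = 1\<^sub>m r" "R\<^sup>T * R = 1\<^sub>m r"
    using assms by (auto simp: ortho_def)
  have "Q * R * (R\<^sup>T * Q\<^sup>T) = Q * (R * R\<^sup>T) * Q\<^sup>T"
    by (simp add: assoc_mult_mat[of _ r r _ r _ r] mult_carrier_mat[of _ r r])
  moreover have "R\<^sup>T * Q\<^sup>T * (Q * R) = R\<^sup>T * (Q\<^sup>T * Q) * R"
    by (simp add: assoc_mult_mat[of _ r r _ r _ r] mult_carrier_mat[of _ r r])
  ultimately show ?thesis
    by (simp add: ortho_def transpose_mult[of Q r r R r] i mult_carrier_mat[of _ r r] right_mult_one_mat[of _ r r])
qed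

text \<open>Orthogonal matrices are represented by functions on index pairs, where the product
  topology is at hand. Confining entries to [-1, 1] inside the square and to 0 outside gives a
  product of compact sets, and the orthogonality equations cut out a closed subset.\<close>

lemma compact_ortho_coords:
  "compact {f :: nat \<times> nat \<Rightarrow> real. (\<forall>p. f p \<in> (if p \<in> {..<r} \<times> {..<r} then {-1..1} else {0})) \<and>
    (\<forall>s\<in>{..<r}. \<forall>t\<in>{..<r}. (\<Sum>u<r. f (s, u) * f (t, u)) = (if s = t then 1 else 0))}"
proof -
  let ?S = "PiE UNIV (\<lambda>p. if p \<in> {..<r} \<times> {..<r} then {-1..1} else {0}) :: (nat \<times> nat \<Rightarrow> real) set"
  have "compactin (product_topology (\<lambda>_. euclidean) UNIV) ?S"
    by (subst compactin_PiE) auto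
  then have S: "compact ?S" by (simp add: euclidean_product_topology)
  have cont: "continuous_on UNIV (\<lambda>f :: nat \<times> nat \<Rightarrow> real. f p)" for p by simp
  have "closed {f :: nat \<times> nat \<Rightarrow> real. \<forall>s\<in>{..<r}. \<forall>t\<in>{..<r}. (\<Sum>u<r. f (s, u) * f (t, u)) = (if s = t then 1 else 0)}"
  proof -
    have "closed {f :: nat \<times> nat \<Rightarrow> real. (\<Sum>u<r. f (s, u) * f (t, u)) = c}" for s t c
      by (intro closed_Collect_eq continuous_on_sum continuous_on_mult cont continuous_on_const)
    then show ?thesis by (simp only: Ball_def, intro closed_Collect_all closed_Collect_imp) auto
  qed
  from compact_Int_closed[OF S this] show ?thesis
    by (rule back_subst[of compact]) (auto simp: PiE_def Pi_def extensional_def)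
qed

lemma proc_dist_attained:
  assumes Z: "Z \<in> carrier_mat n r" and W: "W \<in> carrier_mat n r"
  obtains Q where "Q \<in> ortho r" "proc_dist r Z W = frob_norm (Z - W * Q)"
    "\<And>R. R \<in> ortho r \<Longrightarrow> frob_norm (Z - W * Q) \<le> frob_norm (Z - W * R)"
proof -
  let ?K = "{f :: nat \<times> nat \<Rightarrow> real. (\<forall>p. f p \<in> (if p \<in> {..<r} \<times> {..<r} then {-1..1} else {0})) \<and>
    (\<forall>s\<in>{..<r}. \<forall>t\<in>{..<r}. (\<Sum>u<r. f (s, u) * f (t, u)) = (if s = t then 1 else 0))}"
  define F where "F f = (\<Sum>j<n. \<Sum>q<r. (Z $$ (j, q) - (\<Sum>u<r. W $$ (j, u) * f (u, q)))\<^sup>2)" for f :: "nat \<times> nat \<Rightarrow> real"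
  have "continuous_on UNIV F"
    unfolding F_def by (intro continuous_intros) simp_all
  then have contF: "continuous_on ?K F" by (rule continuous_on_subset) simp
  have F: "frob_norm (Z - W * mat r r f) = sqrt (F f)" for f
    using Z W by (simp add: frob_norm_def F_def scalar_prod_def atLeast0LessThan)
  define \<phi> where "\<phi> Q = (\<lambda>(s, t). if s < r \<and> t < r then Q $$ (s, t) else 0 :: real)" for Q :: "real mat"
  have \<phi>: "mat r r (\<phi> Q) = Q" if "Q \<in> ortho r" for Q
    using that by (auto simp: ortho_def \<phi>_def mat_eq_iff)
  have \<phi>K: "\<phi> Q \<in> ?K" if Q: "Q \<in> ortho r" for Q
  proof -
    have c: "Q \<in> carrier_mat r r" using Q by (simp add: ortho_def)
    have o: "(\<Sum>u<r. Q $$ (s, u) * Q $$ (t, u)) = (if s = t then 1 else 0)" if "s < r" "t < r" for s t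
      using Q ortho_iff[OF c] that by blast
    have "\<bar>Q $$ (s, t)\<bar> \<le> 1" if "s < r" "t < r" for s t
    proof -
      have "(Q $$ (s, t))\<^sup>2 \<le> (\<Sum>u<r. (Q $$ (s, u))\<^sup>2)"
        using that by (intro member_le_sum[of t _ "\<lambda>u. (Q $$ (s, u))\<^sup>2"]) auto
      also have "\<dots> = 1" using o[of s s] that by (simp add: power2_eq_square)
      finally show ?thesis using abs_le_square_iff[of "Q $$ (s, t)" 1] by simp
    qed
    then show ?thesis using o by (auto simp: \<phi>_def abs_le_iff minus_le_iff)
  qed
  have Kortho: "mat r r f \<in> ortho r" if "f \<in> ?K" for f
    using that by (subst ortho_iff) auto
  have "1\<^sub>m r \<in> ortho r" by (simp add: ortho_def)
  then have "?K \<noteq> {}" using \<phi>K by blast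
  from continuous_attains_inf[OF compact_ortho_coords this contF]
  obtain f where f: "f \<in> ?K" "\<And>g. g \<in> ?K \<Longrightarrow> F f \<le> F g" by blast
  have min: "frob_norm (Z - W * mat r r f) \<le> frob_norm (Z - W * R)" if "R \<in> ortho r" for R
    using f(2)[OF \<phi>K[OF that]] F[of f] F[of "\<phi> R"] \<phi>[OF that] by simp
  have "proc_dist r Z W = frob_norm (Z - W * mat r r f)"
    unfolding proc_dist_def ortho_def[symmetric]
    using Kortho[OF f(1)] min by (intro cInf_eq_minimum) auto
  with Kortho[OF f(1)] min show ?thesis using that by blast
qed

lemma mat_tr_mult_commute:
  assumes "A \<in> carrier_mat n r" "B \<in> carrier_mat r n"
  shows "mat_tr (A * B) = mat_tr (B * A)"
proof -
  have "mat_tr (A * B) = (\<Sum>i<n. \<Sum>j<r. A $$ (i, j) * B $$ (j, i))"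
    using assms by (simp add: mat_tr_def scalar_prod_def atLeast0LessThan)
  also have "\<dots> = (\<Sum>j<r. \<Sum>i<n. A $$ (i, j) * B $$ (j, i))" by (rule sum.swap)
  also have "\<dots> = mat_tr (B * A)"
    using assms by (simp add: mat_tr_def scalar_prod_def atLeast0LessThan mult.commute)
  finally show ?thesis .
qed

lemma frob_norm_square:
  assumes "A \<in> carrier_mat n r"
  shows "(frob_norm A)\<^sup>2 = mat_tr (A\<^sup>T * A)"
  using assms unfolding frob_norm_def mat_tr_def
  by (subst sum.swap) (simp add: scalar_prod_def atLeast0LessThan sum_nonneg power2_eq_square)

lemma frob_norm_mult_ortho:
  assumes A: "A \<in> carrier_mat n r" and Q: "Q \<in> ortho r"
  shows "frob_norm (A * Q) = frob_norm A"
proof -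
  have c: "Q \<in> carrier_mat r r" "Q * Q\<^sup>T = 1\<^sub>m r" using Q by (auto simp: ortho_def)
  have "(frob_norm (A * Q))\<^sup>2 = mat_tr (Q\<^sup>T * (A\<^sup>T * A * Q))"
    using A c by (simp add: frob_norm_square[of _ n r] transpose_mult[of A n r Q r] assoc_mult_mat[of _ r n _ r _ r] assoc_mult_mat[of _ r r _ n _ r])
  also have "\<dots> = mat_tr (A\<^sup>T * A * Q * Q\<^sup>T)"
    using A c by (intro mat_tr_mult_commute) auto
  also have "A\<^sup>T * A * Q * Q\<^sup>T = A\<^sup>T * A * (Q * Q\<^sup>T)"
    using A c by (intro assoc_mult_mat) auto
  also have "mat_tr \<dots> = (frob_norm A)\<^sup>2"
    using A c by (simp add: frob_norm_square)
  finally show ?thesis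
    by (simp add: frob_norm_def sum_nonneg power2_eq_iff_nonneg)
qed


section \<open>Trace maximization over orthogonal matrices\<close>

lemma mat_tr_mult_mat:
  assumes "K \<in> carrier_mat r r"
  shows "mat_tr (K * mat r r (\<lambda>(s, q). f s q)) = (\<Sum>s<r. \<Sum>q<r. K $$ (s, q) * f q s)"
  using assms by (simp add: mat_tr_def scalar_prod_def atLeast0LessThan)

definition reflection :: "nat \<Rightarrow> (nat \<Rightarrow> real) \<Rightarrow> real mat" where
  "reflection r v = mat r r (\<lambda>(s, q). (if s = q then 1 else 0) - 2 * v s * v q)"

lemma reflection_ortho:
  assumes "ip r v v = 1"
  shows "reflection r v \<in> ortho r"
proof -
  have "(\<Sum>u<r. ((if s = u then 1 else 0) - 2 * v s * v u) * ((if t = u then 1 else 0) - 2 * v t * v u)) = (if s = t then 1 else 0)"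
    if "s < r" "t < r" for s t
  proof -
    have "(\<Sum>u<r. ((if s = u then 1 else 0) - 2 * v s * v u) * ((if t = u then 1 else 0) - 2 * v t * v u))
        = (\<Sum>u<r. (if s = u then (if t = u then 1 else 0) else 0) - (if s = u then 2 * v t * v u else 0) - (if t = u then 2 * v s * v u else 0)
            + 4 * v s * v t * (v u * v u))"
      by (intro sum.cong refl) (auto simp: algebra_simps)
    also have "\<dots> = (if s = t then 1 else 0) - 2 * v t * v s - 2 * v s * v t + 4 * v s * v t * ip r v v"
      using that by (simp add: sum.distrib sum_subtractf sum_distrib_left[symmetric] ip_def)
    finally show ?thesis using assms by simp
  qed
  then show ?thesis by (subst ortho_iff[of _ r]) (auto simp: reflection_def)
qed

lemma reflection_mult:
  "reflection r v * reflection r w = mat r r (\<lambda>(s, q). (if s = q then 1 else 0) - 2 * v s * v q - 2 * w s * w q + 4 * ip r v w * v s * w q)"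
proof -
  have "(\<Sum>u<r. ((if s = u then 1 else 0) - 2 * v s * v u) * ((if u = q then 1 else 0) - 2 * w u * w q))
      = (if s = q then 1 else 0) - 2 * v s * v q - 2 * w s * w q + 4 * ip r v w * v s * w q"
    if "s < r" "q < r" for s q
  proof -
    have "(\<Sum>u<r. ((if s = u then 1 else 0) - 2 * v s * v u) * ((if u = q then 1 else 0) - 2 * w u * w q))
        = (\<Sum>u<r. (if s = u then (if u = q then 1 else 0) else 0) - (if s = u then 2 * w u * w q else 0) - (if u = q then 2 * v s * v u else 0)
            + 4 * v s * w q * (v u * w u))"
      by (intro sum.cong refl) (auto simp: algebra_simps)
    also have "\<dots> = (if s = q then 1 else 0) - 2 * w s * w q - 2 * v s * v q + 4 * v s * w q * ip r v w"
      using that by (simp add: sum.distrib sum_subtractf sum_distrib_left[symmetric] ip_def)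
    finally show ?thesis by simp
  qed
  then show ?thesis by (auto simp: reflection_def mat_eq_iff scalar_prod_def atLeast0LessThan)
qed

text \<open>Only products of reflections are used as competitors: one reflection gives positivity, and two
  reflections in nearly equal directions, i.e. an infinitesimal rotation, give symmetry.\<close>

lemma trace_maximal_sym_psd:
  assumes K: "K \<in> carrier_mat r r"
    and max: "\<And>R. R \<in> ortho r \<Longrightarrow> mat_tr (K * R) \<le> mat_tr K"
  defines "\<beta> \<equiv> \<lambda>v w. \<Sum>s<r. \<Sum>q<r. K $$ (s, q) * v s * w q"
  shows "\<And>v. 0 \<le> \<beta> v v" and "\<And>s q. s < r \<Longrightarrow> q < r \<Longrightarrow> K $$ (s, q) = K $$ (q, s)"
proof -
  have tr: "mat_tr K = (\<Sum>s<r. \<Sum>q<r. K $$ (s, q) * (if q = s then 1 else 0))"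
    using K by (simp add: mat_tr_def if_distrib sum.delta cong: if_cong)
  have one: "0 \<le> \<beta> v v" if v: "ip r v v = 1" for v
  proof -
    have "mat_tr (K * reflection r v) = (\<Sum>s<r. \<Sum>q<r. K $$ (s, q) * (if q = s then 1 else 0) - 2 * (K $$ (s, q) * v s * v q))"
      unfolding reflection_def mat_tr_mult_mat[OF K] by (intro sum.cong refl) (simp add: algebra_simps)
    also have "\<dots> = mat_tr K - 2 * \<beta> v v"
      by (simp only: sum_subtractf sum_distrib_left[symmetric] tr \<beta>_def)
    finally show ?thesis using max[OF reflection_ortho[OF v]] by simp
  qed
  have scale: "\<beta> (\<lambda>s. c * v s) (\<lambda>s. d * w s) = c * d * \<beta> v w" for c d v w
    by (simp add: \<beta>_def sum_distrib_left mult_ac)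
  show "0 \<le> \<beta> v v" for v
  proof (cases "ip r v v = 0")
    case True
    then have "v s = 0" if "s < r" for s
      using that by (simp add: ip_def sum_nonneg_eq_0_iff)
    then show ?thesis by (simp add: \<beta>_def)
  next
    case False
    then have pos: "ip r v v > 0" by (simp add: ip_self order_less_le)
    define c where "c = 1 / sqrt (ip r v v)"
    have c: "c * c = 1 / ip r v v" "c > 0" using pos by (simp_all add: c_def)
    have "ip r (\<lambda>s. c * v s) (\<lambda>s. c * v s) = c * c * ip r v v"
      by (simp add: ip_def sum_distrib_left mult_ac)
    then have "0 \<le> \<beta> (\<lambda>s. c * v s) (\<lambda>s. c * v s)" using c pos by (intro one) simp
    then show ?thesis unfolding scale using mult_pos_pos[OF c(2) c(2)] by (auto simp: zero_le_mult_iff)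
  qed
  have two: "2 * ip r v w * \<beta> w v \<le> \<beta> v v + \<beta> w w" if v: "ip r v v = 1" and w: "ip r w w = 1" for v w
  proof -
    have "mat_tr (K * (reflection r v * reflection r w)) = (\<Sum>s<r. \<Sum>q<r. K $$ (s, q) * (if q = s then 1 else 0)
        - 2 * (K $$ (s, q) * v s * v q) - 2 * (K $$ (s, q) * w s * w q) + 4 * ip r v w * (K $$ (s, q) * w s * v q))"
      unfolding reflection_mult mat_tr_mult_mat[OF K] by (intro sum.cong refl) (simp add: algebra_simps)
    also have "\<dots> = mat_tr K - 2 * \<beta> v v - 2 * \<beta> w w + 4 * ip r v w * \<beta> w v"
      by (simp only: sum.distrib sum_subtractf sum_distrib_left[symmetric] tr \<beta>_def)
    finally show ?thesis using max[OF ortho_mult[OF reflection_ortho[OF v] reflection_ortho[OF w]]] by simp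
  qed
  have le: "K $$ (s, q) \<le> K $$ (q, s)" if sq: "s < r" "q < r" "s \<noteq> q" for s q
  proof -
    define e where "e = (\<lambda>(p::nat) (u::nat). if u = p then 1 else (0::real))"
    have ipe: "ip r (e p) (e p') = (if p = p' then 1 else 0)" if "p < r" for p p'
      using that by (simp add: ip_def e_def if_distrib sum.delta cong: if_cong)
    have \<beta>e: "\<beta> (e p) (e p') = K $$ (p, p')" if "p < r" "p' < r" for p p'
    proof -
      have "\<beta> (e p) (e p') = (\<Sum>s<r. \<Sum>q<r. if s = p then if q = p' then K $$ (s, q) else 0 else 0)"
        unfolding \<beta>_def e_def by (intro sum.cong refl) auto
      also have "\<dots> = (\<Sum>s<r. if s = p then K $$ (s, p') else 0)"
        using that by (intro sum.cong refl) auto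
      finally show ?thesis using that by simp
    qed
    have ip_lin: "ip r x (\<lambda>u. c * y u + d * z u) = c * ip r x y + d * ip r x z" for c d x y z
      by (simp add: ip_def sum.distrib sum_distrib_left algebra_simps)
    have ip_lin': "ip r (\<lambda>u. c * y u + d * z u) x = c * ip r y x + d * ip r z x" for c d x y z
      by (simp add: ip_def sum.distrib sum_distrib_left algebra_simps)
    have \<beta>_lin: "\<beta> x (\<lambda>u. c * y u + d * z u) = c * \<beta> x y + d * \<beta> x z" for c d x y z
      by (simp add: \<beta>_def sum.distrib sum_distrib_left algebra_simps)
    have \<beta>_lin': "\<beta> (\<lambda>u. c * y u + d * z u) x = c * \<beta> y x + d * \<beta> z x" for c d x y z
      by (simp add: \<beta>_def sum.distrib sum_distrib_left algebra_simps)
    \<comment> \<open>The inequality \<open>two\<close> is applied to the unit vector at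
      \<open>q\<close> and to that vector tilted slightly towards \<open>s\<close>. The terms of
      order zero in \<epsilon> cancel, the first order yields the antisymmetric part of
      \<open>K\<close>, and only second order terms remain.\<close>
    have "K $$ (s, q) - K $$ (q, s) \<le> \<epsilon> * (K $$ (s, s) + K $$ (q, q))" if \<epsilon>: "\<epsilon> > 0" for \<epsilon>
    proof -
      define c where "c = 1 / sqrt (1 + \<epsilon>\<^sup>2)"
      have pos: "1 + \<epsilon>\<^sup>2 > 0" by (simp add: add_pos_nonneg)
      have c: "c > 0" "c * c * (1 + \<epsilon>\<^sup>2) = 1" using pos by (simp_all add: c_def)
      define w where "w = (\<lambda>u. c * e q u + (c * \<epsilon>) * e s u)"
      have w1: "ip r w w = 1"
        unfolding w_def ip_lin ip_lin' using sq c(2) by (simp add: ipe power2_eq_square algebra_simps)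
      have ipw: "ip r (e q) w = c" unfolding w_def ip_lin using sq by (simp add: ipe)
      have "\<beta> w (e q) = c * (K $$ (q, q) + \<epsilon> * K $$ (s, q))"
        unfolding w_def \<beta>_lin' using sq by (simp add: \<beta>e algebra_simps)
      moreover have "\<beta> w w = c * c * (K $$ (q, q) + \<epsilon> * K $$ (s, q) + \<epsilon> * K $$ (q, s) + \<epsilon>\<^sup>2 * K $$ (s, s))"
        unfolding w_def \<beta>_lin \<beta>_lin' using sq by (simp add: \<beta>e power2_eq_square algebra_simps)
      moreover have "2 * c * \<beta> w (e q) \<le> K $$ (q, q) + \<beta> w w"
        using two[OF _ w1, of "e q"] ipe[of q q] sq by (simp add: ipw \<beta>e)
      moreover have "K $$ (q, q) = c * c * (1 + \<epsilon>\<^sup>2) * K $$ (q, q)" using c by simp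
      ultimately have "(c * c) * (2 * (K $$ (q, q) + \<epsilon> * K $$ (s, q))) \<le> (c * c) * ((1 + \<epsilon>\<^sup>2) * K $$ (q, q)
          + (K $$ (q, q) + \<epsilon> * K $$ (s, q) + \<epsilon> * K $$ (q, s) + \<epsilon>\<^sup>2 * K $$ (s, s)))"
        by (simp add: algebra_simps)
      then have "2 * (K $$ (q, q) + \<epsilon> * K $$ (s, q)) \<le> (1 + \<epsilon>\<^sup>2) * K $$ (q, q)
          + (K $$ (q, q) + \<epsilon> * K $$ (s, q) + \<epsilon> * K $$ (q, s) + \<epsilon>\<^sup>2 * K $$ (s, s))"
        using c(1) by (simp only: mult_le_cancel_left_pos[OF mult_pos_pos[OF c(1) c(1)]])
      then have "\<epsilon> * (K $$ (s, q) - K $$ (q, s)) \<le> \<epsilon> * (\<epsilon> * (K $$ (s, s) + K $$ (q, q)))"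
        by (simp add: power2_eq_square algebra_simps)
      then show ?thesis using \<epsilon> by simp
    qed
    note eps = this
    show ?thesis
    proof (rule ccontr)
      assume "\<not> ?thesis"
      then have d: "K $$ (s, q) - K $$ (q, s) > 0" by simp
      let ?D = "K $$ (s, q) - K $$ (q, s)" and ?S = "\<bar>K $$ (s, s) + K $$ (q, q)\<bar> + 1"
      \<comment> \<open>The choice \<epsilon> = ?D / (2 * ?S) bounds ?D by its own half; the added 1
        in ?S keeps the denominator positive.\<close>
      have "?D \<le> ?D / (2 * ?S) * (K $$ (s, s) + K $$ (q, q))"
        using d by (intro eps) (simp add: add_nonneg_pos)
      also have "\<dots> \<le> ?D / (2 * ?S) * ?S" using d by (intro mult_left_mono) auto
      also have "\<dots> = ?D / 2"
      proof -
        have half: "x / (2 * S) * S = x / 2" if "S > 0" for x S :: real using that by simp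
        show ?thesis by (rule half) (simp add: add_nonneg_pos)
      qed
      finally show False using d by simp
    qed
  qed
  show "K $$ (s, q) = K $$ (q, s)" if "s < r" "q < r" for s q
    using le[OF that] le[OF that(2) that(1)] by (cases "s = q") auto
qed


lemma frob_norm_nonneg [simp]: "0 \<le> frob_norm A"
  by (simp add: frob_norm_def sum_nonneg)

lemma index_transpose_mult:
  assumes "A \<in> carrier_mat n r" "B \<in> carrier_mat n r'" "s < r" "q < r'"
  shows "(A\<^sup>T * B) $$ (s, q) = ip n (colfun A s) (colfun B q)"
  using assms unfolding ip_def colfun_def by (simp add: scalar_prod_def atLeast0LessThan)

text \<open>Only the trace term depends on \<open>R\<close>, so minimizing the distance over
  rotations is maximizing a trace.\<close>

lemma frob_norm_minus_mult_ortho: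
  assumes Z: "Z \<in> carrier_mat n r" and W: "W \<in> carrier_mat n r" and R: "R \<in> ortho r"
  shows "(frob_norm (Z - W * R))\<^sup>2 = (frob_norm Z)\<^sup>2 + (frob_norm W)\<^sup>2 - 2 * mat_tr (Z\<^sup>T * W * R)"
proof -
  have Rc: "R \<in> carrier_mat r r" using R by (simp add: ortho_def)
  have WR: "W * R \<in> carrier_mat n r" using W Rc by simp
  have fr: "(frob_norm A)\<^sup>2 = (\<Sum>i<n. \<Sum>j<r. (A $$ (i, j))\<^sup>2)" if "A \<in> carrier_mat n r" for A
    using that by (simp add: frob_norm_def sum_nonneg)
  have "mat_tr (Z\<^sup>T * W * R) = mat_tr (Z\<^sup>T * (W * R))"
    using Z W Rc by (simp add: assoc_mult_mat[of _ r n _ r _ r])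
  also have "\<dots> = (\<Sum>j<r. \<Sum>i<n. Z $$ (i, j) * (W * R) $$ (i, j))"
    using Z WR W Rc by (simp add: mat_tr_def scalar_prod_def atLeast0LessThan)
  also have "\<dots> = (\<Sum>i<n. \<Sum>j<r. Z $$ (i, j) * (W * R) $$ (i, j))" by (rule sum.swap)
  finally have t: "mat_tr (Z\<^sup>T * W * R) = (\<Sum>i<n. \<Sum>j<r. Z $$ (i, j) * (W * R) $$ (i, j))" .
  have "Z - W * R \<in> carrier_mat n r" by (rule minus_carrier_mat[OF WR])
  then have "(frob_norm (Z - W * R))\<^sup>2 = (\<Sum>i<n. \<Sum>j<r. (Z $$ (i, j) - (W * R) $$ (i, j))\<^sup>2)"
    using Z W Rc by (subst fr) (auto intro!: sum.cong)
  also have "\<dots> = (\<Sum>i<n. \<Sum>j<r. (Z $$ (i, j))\<^sup>2 + ((W * R) $$ (i, j))\<^sup>2 - 2 * (Z $$ (i, j) * (W * R) $$ (i, j)))"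
    by (intro sum.cong refl) (simp add: power2_eq_square algebra_simps)
  also have "\<dots> = (frob_norm Z)\<^sup>2 + (frob_norm (W * R))\<^sup>2 - 2 * mat_tr (Z\<^sup>T * W * R)"
    using Z WR by (simp only: fr t sum.distrib sum_subtractf sum_distrib_left)
  finally show ?thesis by (simp add: frob_norm_mult_ortho[OF W R])
qed

text \<open>The optimal rotation is moved from \<open>W\<close> to \<open>Z\<close>. For the rotated
  \<open>Z\<close> the identity is then an optimal rotation, so the trace of \<open>K * R\<close> is
  largest at the identity, where \<open>K\<close> is the cross Gram matrix; this makes
  \<open>K\<close> symmetric and positive semidefinite.\<close>

lemma proc_dist_aligned:
  assumes Z: "Z \<in> carrier_mat n r" and W: "W \<in> carrier_mat n r"
  obtains Q where "Q \<in> ortho r" "proc_dist r Z W = frob_norm (Z - W * Q)"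
    "proc_dist r Z W = frob_norm (Z * Q\<^sup>T - W)"
    "\<And>s q. s < r \<Longrightarrow> q < r \<Longrightarrow> ip n (colfun (Z * Q\<^sup>T) s) (colfun W q) = ip n (colfun (Z * Q\<^sup>T) q) (colfun W s)"
    "\<And>v. 0 \<le> (\<Sum>s<r. \<Sum>q<r. ip n (colfun (Z * Q\<^sup>T) s) (colfun W q) * v s * v q)"
proof -
  obtain Q where Q: "Q \<in> ortho r" "proc_dist r Z W = frob_norm (Z - W * Q)"
    and min: "\<And>R. R \<in> ortho r \<Longrightarrow> frob_norm (Z - W * Q) \<le> frob_norm (Z - W * R)"
    using proc_dist_attained[OF Z W] by blast
  have c: "Q \<in> carrier_mat r r" "Q\<^sup>T \<in> carrier_mat r r" "Q * Q\<^sup>T = 1\<^sub>m r" "Q\<^sup>T * Q = 1\<^sub>m r"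
    using Q(1) by (auto simp: ortho_def)
  have QT: "Q\<^sup>T \<in> ortho r" using c by (simp add: ortho_def)
  define K where "K = (Z * Q\<^sup>T)\<^sup>T * W"
  have "Z * Q\<^sup>T \<in> carrier_mat n r" using Z c by simp
  then have K: "K \<in> carrier_mat r r" using W by (simp add: K_def mult_carrier_mat[of _ r n])
  have KQ: "K = Q * (Z\<^sup>T * W)"
    unfolding K_def using Z W c by (simp add: transpose_mult[of Z n r "Q\<^sup>T" r] assoc_mult_mat[of Q r r _ n _ r])
  \<comment> \<open>Competitors are written as \<open>R * Q\<close>, so that the optimality of
    \<open>Q\<close> becomes a statement about \<open>R\<close> near the identity as well as far
    from it.\<close>
  have tr: "mat_tr (Z\<^sup>T * W * (R * Q)) = mat_tr (K * R)" if R: "R \<in> carrier_mat r r" for R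
  proof -
    have ZW: "Z\<^sup>T * W \<in> carrier_mat r r" using Z W by simp
    have "Z\<^sup>T * W * (R * Q) = Z\<^sup>T * W * R * Q"
      by (rule assoc_mult_mat[OF ZW R c(1), symmetric])
    also have "mat_tr \<dots> = mat_tr (Q * (Z\<^sup>T * W * R))"
      using ZW R c by (intro mat_tr_mult_commute) auto
    also have "Q * (Z\<^sup>T * W * R) = K * R"
      unfolding KQ by (rule assoc_mult_mat[OF c(1) ZW R, symmetric])
    finally show ?thesis .
  qed
  have max: "mat_tr (K * R) \<le> mat_tr K" if R: "R \<in> ortho r" for R
  proof -
    have Rc: "R \<in> carrier_mat r r" using R by (simp add: ortho_def)
    have "(frob_norm (Z - W * Q))\<^sup>2 \<le> (frob_norm (Z - W * (R * Q)))\<^sup>2"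
      by (intro power_mono min ortho_mult R Q) simp
    then have "mat_tr (Z\<^sup>T * W * (R * Q)) \<le> mat_tr (Z\<^sup>T * W * Q)"
      by (simp add: frob_norm_minus_mult_ortho[OF Z W] ortho_mult R Q)
    moreover have "mat_tr (Z\<^sup>T * W * Q) = mat_tr K"
      using tr[of "1\<^sub>m r"] c K by simp
    ultimately show ?thesis using tr[OF Rc] by simp
  qed
  have Kip: "K $$ (s, q) = ip n (colfun (Z * Q\<^sup>T) s) (colfun W q)" if "s < r" "q < r" for s q
  proof -
    have "Z * Q\<^sup>T \<in> carrier_mat n r" using Z c by simp
    then show ?thesis unfolding K_def by (rule index_transpose_mult[OF _ W that])
  qed
  have "Z - W * Q = (Z * Q\<^sup>T - W) * Q"
  proof -
    have ZQ: "Z * Q\<^sup>T \<in> carrier_mat n r" using Z c by simp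
    have "(Z * Q\<^sup>T - W) * Q = Z * Q\<^sup>T * Q - W * Q"
      by (rule minus_mult_distrib_mat[OF ZQ W c(1)])
    also have "Z * Q\<^sup>T * Q = Z" using Z c by (simp add: assoc_mult_mat[of _ n r _ r _ r])
    finally show ?thesis by simp
  qed
  then have "proc_dist r Z W = frob_norm (Z * Q\<^sup>T - W)"
    unfolding Q(2) by (simp add: frob_norm_mult_ortho[OF minus_carrier_mat[OF W] Q(1)])
  moreover note trace_maximal_sym_psd[OF K max]
  ultimately show ?thesis
    using Q by (intro that[of Q]) (simp_all add: Kip)
qed

text \<open>With \<open>G = H\<^sup>T H\<close>, \<open>S = H\<^sup>T W\<close> and \<open>C = W\<^sup>T W\<close> the squared norm on the right equals
  \<open>tr (G\<^sup>2 + 4 G S + 2 S\<^sup>2 + 2 G C)\<close>, which is at least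
  \<open>tr ((G + 7/5 S)\<^sup>2) + 6/5 tr (G (S + C)) + 4/5 tr (G C)\<close>; here \<open>S + C\<close> is positive semidefinite.\<close>

lemma factor_distance_bound:
  assumes W: "\<And>s q. s < r \<Longrightarrow> q < r \<Longrightarrow> ip n (W s) (W q) = (if s = q then \<sigma> s else 0)"
    and \<sigma>: "\<And>s. s < r \<Longrightarrow> \<rho> \<le> \<sigma> s"
    and sym: "\<And>s q. s < r \<Longrightarrow> q < r \<Longrightarrow> ip n (Z s) (W q) = ip n (Z q) (W s)"
    and psd: "\<And>v. 0 \<le> (\<Sum>s<r. \<Sum>q<r. ip n (Z s) (W q) * v s * v q)"
  shows "4 / 5 * \<rho> * fsq n r (\<lambda>q j. Z q j - W q j) \<le> (\<Sum>j<n. \<Sum>k<n. (outer r Z Z j k - outer r W W j k)\<^sup>2)"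
proof -
  define H where "H = (\<lambda>q j. Z q j - W q j)"
  have Z: "Z q j = W q j + H q j" for q j by (simp add: H_def)
  have ipZ: "ip n (Z s) x = ip n (W s) x + ip n (H s) x" for s x
    by (simp add: ip_def Z distrib_right sum.distrib)
  let ?G = "\<lambda>s t. ip n (H s) (H t)" and ?S = "\<lambda>s t. ip n (H s) (W t)" and ?C = "\<lambda>s t. ip n (W s) (W t)"
  have Ssym: "?S s t = ?S t s" if "s < r" "t < r" for s t
    using sym[OF that] by (simp add: ipZ ip_commute[of n "W s"])
  have "(outer r Z Z j k - outer r W W j k)\<^sup>2 = (outer r H W j k + outer r W H j k + outer r H H j k)\<^sup>2" for j k
    by (simp add: outer_def Z algebra_simps sum.distrib)
  also have "(outer r H W j k + outer r W H j k + outer r H H j k)\<^sup>2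
      = outer r H W j k * outer r H W j k + outer r W H j k * outer r W H j k + outer r H H j k * outer r H H j k
      + 2 * (outer r H W j k * outer r W H j k) + 2 * (outer r H W j k * outer r H H j k) + 2 * (outer r W H j k * outer r H H j k)" for j k
    by (simp add: power2_eq_square algebra_simps)
  finally have expand: "(outer r Z Z j k - outer r W W j k)\<^sup>2
      = outer r H W j k * outer r H W j k + outer r W H j k * outer r W H j k + outer r H H j k * outer r H H j k
      + 2 * (outer r H W j k * outer r W H j k) + 2 * (outer r H W j k * outer r H H j k) + 2 * (outer r W H j k * outer r H H j k)" for j k .
  have "(\<Sum>j<n. \<Sum>k<n. (outer r Z Z j k - outer r W W j k)\<^sup>2)
      = (\<Sum>s<r. \<Sum>t<r. ?G s t * ?C s t + ?C s t * ?G s t + ?G s t * ?G s t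
        + 2 * (?S s t * ?S t s) + 2 * (?G s t * ?S t s) + 2 * (?S t s * ?G s t))"
    unfolding expand by (simp only: sum.distrib sum_distrib_left[symmetric] sum_outer_product ip_commute[of n "W _" "H _"])
  \<comment> \<open>The coefficients split as 4 = 14/5 + 6/5 for \<open>G S\<close>, 2 = 49/25 +
    1/25 for \<open>S\<^sup>2\<close> and 2 = 6/5 + 4/5 for \<open>G C\<close>.\<close>
  also have "\<dots> = (\<Sum>s<r. \<Sum>t<r. (?G s t + 7 / 5 * ?S s t)\<^sup>2 + 1 / 25 * (?S s t)\<^sup>2 + 6 / 5 * (?G s t * (?C s t + ?S s t)) + 4 / 5 * (?G s t * ?C s t))"
    using Ssym by (intro sum.cong refl) (simp add: power2_eq_square algebra_simps)
  also have "\<dots> \<ge> (\<Sum>s<r. \<Sum>t<r. 6 / 5 * (?G s t * (?C s t + ?S s t)) + 4 / 5 * (?G s t * ?C s t))"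
    by (intro sum_mono) simp
  also have "(\<Sum>s<r. \<Sum>t<r. 6 / 5 * (?G s t * (?C s t + ?S s t)) + 4 / 5 * (?G s t * ?C s t))
      = 6 / 5 * (\<Sum>s<r. \<Sum>t<r. ?G s t * (?C s t + ?S s t)) + 4 / 5 * (\<Sum>s<r. \<Sum>t<r. ?G s t * ?C s t)"
    by (simp only: sum.distrib sum_distrib_left)
  finally have main: "6 / 5 * (\<Sum>s<r. \<Sum>t<r. ?G s t * (?C s t + ?S s t)) + 4 / 5 * (\<Sum>s<r. \<Sum>t<r. ?G s t * ?C s t)
      \<le> (\<Sum>j<n. \<Sum>k<n. (outer r Z Z j k - outer r W W j k)\<^sup>2)" .
  \<comment> \<open>The matrix \<open>C + S\<close> is \<open>Z\<^sup>T W\<close>; the sum evaluates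
    this positive semidefinite form at each row of \<open>H\<close>.\<close>
  have "(\<Sum>s<r. \<Sum>t<r. ?G s t * (?C s t + ?S s t)) = (\<Sum>s<r. \<Sum>t<r. \<Sum>j<n. ip n (Z s) (W t) * H s j * H t j)"
    unfolding ipZ ip_def[of n "H _" "H _"] by (simp add: sum_distrib_right mult_ac)
  also have "\<dots> = (\<Sum>s<r. \<Sum>j<n. \<Sum>t<r. ip n (Z s) (W t) * H s j * H t j)"
    by (intro sum.cong refl sum.swap)
  also have "\<dots> = (\<Sum>j<n. \<Sum>s<r. \<Sum>t<r. ip n (Z s) (W t) * H s j * H t j)" by (rule sum.swap)
  also have "\<dots> \<ge> 0" by (intro sum_nonneg psd)
  finally have 1: "(\<Sum>s<r. \<Sum>t<r. ?G s t * (?C s t + ?S s t)) \<ge> 0" .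
  have "\<rho> * fsq n r H \<le> (\<Sum>s<r. \<sigma> s * sqn n (H s))"
    unfolding fsq_def sum_distrib_left using \<sigma> by (intro sum_mono mult_right_mono) auto
  also have "\<dots> = (\<Sum>s<r. \<Sum>t<r. ?G s t * ?C s t)"
  proof (intro sum.cong refl)
    fix s assume s: "s \<in> {..<r}"
    have "(\<Sum>t<r. ?G s t * ?C s t) = (\<Sum>t<r. if s = t then ?G s t * \<sigma> s else 0)"
      using W s by (intro sum.cong) auto
    then show "\<sigma> s * sqn n (H s) = (\<Sum>t<r. ?G s t * ?C s t)" using s by (simp add: ip_self mult.commute)
  qed
  finally show ?thesis using main 1 unfolding H_def[symmetric] by linarith
qed

section \<open>Convergence of gradient descent\<close>

lemma fsq_cong:
  assumes "\<And>q j. q < r \<Longrightarrow> j < n \<Longrightarrow> V q j = V' q j"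
  shows "fsq n r V = fsq n r V'"
  unfolding fsq_def sqn_def using assms by (intro sum.cong) auto

lemma orthonormal_residual:
  fixes r :: nat
  assumes "\<And>s t. s < r \<Longrightarrow> t < r \<Longrightarrow> ip n (u s) (u t) = (if s = t then 1 else 0)"
  shows "sqn n (\<lambda>j. x j - (\<Sum>s<r. ip n (u s) x * u s j)) = sqn n x - (\<Sum>s<r. (ip n (u s) x)\<^sup>2)"
proof -
  let ?c = "\<lambda>s. ip n (u s) x"
  let ?y = "\<lambda>j. \<Sum>s<r. ?c s * u s j"
  have ip_y: "ip n z ?y = (\<Sum>s<r. ?c s * ip n z (u s))" for z
  proof -
    have "ip n z ?y = (\<Sum>j<n. \<Sum>s<r. ?c s * (z j * u s j))"
      unfolding ip_def[of n z] by (simp add: sum_distrib_left mult_ac)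
    also have "\<dots> = (\<Sum>s<r. \<Sum>j<n. ?c s * (z j * u s j))" by (rule sum.swap)
    finally show ?thesis by (simp add: ip_def[of n z] sum_distrib_left)
  qed
  have "ip n ?y (u t) = ?c t" if "t < r" for t
  proof -
    have "ip n ?y (u t) = (\<Sum>s<r. ?c s * ip n (u t) (u s))" by (simp add: ip_commute[of n ?y] ip_y)
    also have "\<dots> = (\<Sum>s<r. if s = t then ?c s else 0)" using assms that by (intro sum.cong) auto
    finally show ?thesis using that by simp
  qed
  then have yy: "ip n ?y ?y = (\<Sum>s<r. (?c s)\<^sup>2)"
    unfolding ip_y[of ?y] by (simp add: power2_eq_square)
  have xy: "ip n x ?y = (\<Sum>s<r. (?c s)\<^sup>2)"
    unfolding ip_y[of x] by (simp add: power2_eq_square ip_commute[of n x])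
  have "sqn n (\<lambda>j. x j - ?y j) = sqn n x - 2 * ip n x ?y + ip n ?y ?y"
    by (simp add: sqn_def ip_def power2_eq_square algebra_simps sum.distrib sum_subtractf sum_distrib_left[of 2])
  then show ?thesis by (simp add: xy yy)
qed

lemma bessel:
  fixes r :: nat
  assumes "\<And>s t. s < r \<Longrightarrow> t < r \<Longrightarrow> ip n (u s) (u t) = (if s = t then 1 else 0)"
  shows "(\<Sum>s<r. (ip n (u s) x)\<^sup>2) \<le> sqn n x"
proof -
  have "0 \<le> sqn n x - (\<Sum>s<r. (ip n (u s) x)\<^sup>2)"
    using orthonormal_residual[of r n u x, OF assms] sqn_nonneg[of n "\<lambda>j. x j - (\<Sum>s<r. ip n (u s) x * u s j)"]
    by (simp only:)
  then show ?thesis by simp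
qed

lemma proc_dist_le:
  assumes "Q \<in> ortho r"
  shows "proc_dist r Z W \<le> frob_norm (Z - W * Q)"
  unfolding proc_dist_def ortho_def[symmetric]
  by (rule cINF_lower[OF _ assms]) (auto intro!: bdd_belowI[of _ 0])

section \<open>The target matrix and its factor\<close>

locale low_rank =
  fixes n r :: nat and X U :: "real mat" and \<sigma> :: "nat \<Rightarrow> real"
  assumes r: "r \<ge> 1" and eig: "eigendecomposition n r X U \<sigma>"
begin

definition "Zs = factor r U \<sigma>"

lemma U_carrier: "U \<in> carrier_mat n r"
  using eig by (simp add: eigendecomposition_def)

lemma U_orthonormal: "s < r \<Longrightarrow> t < r \<Longrightarrow> ip n (colfun U s) (colfun U t) = (if s = t then 1 else 0)"
  using index_transpose_mult[OF U_carrier U_carrier, of s t] eig by (simp add: eigendecomposition_def)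

lemma \<sigma>_pos: "s < r \<Longrightarrow> 0 < \<sigma> s" and \<sigma>_mono: "s \<le> t \<Longrightarrow> t < r \<Longrightarrow> \<sigma> t \<le> \<sigma> s"
  using eig by (auto simp: eigendecomposition_def)

lemma \<sigma>_bounds: "s < r \<Longrightarrow> \<sigma> (r - 1) \<le> \<sigma> s" "s < r \<Longrightarrow> \<sigma> s \<le> \<sigma> 0" "0 < \<sigma> (r - 1)" "0 < \<sigma> 0"
  using \<sigma>_mono[of s "r - 1"] \<sigma>_mono[of 0 s] \<sigma>_pos r by auto

text \<open>The sum of all squared entries of \<open>U\<close> is \<open>r\<close> when taken by
  columns. Taken by rows it is at most \<open>n\<close>, by Bessel's inequality for the standard
  basis vectors.\<close>

lemma r_le_n: "r \<le> n"
proof -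
  have "real r = (\<Sum>s<r. sqn n (colfun U s))"
    using U_orthonormal by (simp add: ip_self[symmetric])
  also have "\<dots> = (\<Sum>j<n. \<Sum>s<r. (colfun U s j)\<^sup>2)" unfolding sqn_def by (rule sum.swap)
  also have "\<dots> \<le> (\<Sum>j<n. 1)"
  proof (intro sum_mono)
    fix j assume j: "j \<in> {..<n}"
    let ?e = "\<lambda>k. if k = j then 1 else (0::real)"
    have "ip n (colfun U s) ?e = colfun U s j" for s
      using j by (simp add: ip_def if_distrib sum.delta cong: if_cong)
    moreover have "sqn n ?e = 1"
      using j by (simp add: sqn_def if_distrib[of "\<lambda>x. x\<^sup>2"] sum.delta cong: if_cong)
    ultimately show "(\<Sum>s<r. (colfun U s j)\<^sup>2) \<le> 1"
      using bessel[OF U_orthonormal, of r "?e"] by simp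
  qed
  finally show ?thesis by simp
qed

lemma Zs_carrier: "Zs \<in> carrier_mat n r"
  using U_carrier by (simp add: Zs_def factor_def mat_diag_def)

lemma Zs_entry: "s < r \<Longrightarrow> j < n \<Longrightarrow> colfun Zs s j = sqrt (\<sigma> s) * colfun U s j"
  by (simp add: Zs_def factor_def mat_diag_mult_right[OF U_carrier] colfun_def)

lemma X_carrier: "X \<in> carrier_mat n n"
  using eig U_carrier by (auto simp: eigendecomposition_def mat_diag_def mult_carrier_mat[of _ n r])

lemma X_entry:
  assumes "j < n" "k < n"
  shows "X $$ (j, k) = outer r (colfun Zs) (colfun Zs) j k"
proof -
  have "X = mat n r (\<lambda>(i, j). U $$ (i, j) * \<sigma> j) * U\<^sup>T"
    using eig mat_diag_mult_right[OF U_carrier] by (simp add: eigendecomposition_def)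
  then have "X $$ (j, k) = (\<Sum>s<r. U $$ (j, s) * \<sigma> s * U $$ (k, s))"
    using assms U_carrier by (simp add: scalar_prod_def atLeast0LessThan)
  also have "\<dots> = outer r (colfun Zs) (colfun Zs) j k"
    unfolding outer_def
  proof (intro sum.cong refl)
    fix s assume s: "s \<in> {..<r}"
    then have "sqrt (\<sigma> s) * sqrt (\<sigma> s) = \<sigma> s" using \<sigma>_pos[of s] by simp
    then show "U $$ (j, s) * \<sigma> s * U $$ (k, s) = colfun Zs s j * colfun Zs s k"
      using assms s by (simp add: Zs_entry colfun_def[of U] algebra_simps)
  qed
  finally show ?thesis .
qed

lemma Zs_ip:
  assumes "s < r" "t < r"
  shows "ip n (colfun Zs s) (colfun Zs t) = (if s = t then \<sigma> s else 0)"
proof -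
  have "ip n (colfun Zs s) (colfun Zs t) = sqrt (\<sigma> s) * sqrt (\<sigma> t) * ip n (colfun U s) (colfun U t)"
    unfolding ip_def sum_distrib_left by (intro sum.cong refl) (simp add: Zs_entry assms)
  then show ?thesis using less_imp_le[OF \<sigma>_pos[OF assms(1)]] by (auto simp: U_orthonormal assms)
qed

lemma Zs_fsq: "fsq n r (colfun Zs) = (\<Sum>s<r. \<sigma> s)"
  unfolding fsq_def by (intro sum.cong refl) (simp add: ip_self[symmetric] Zs_ip)

lemma Zs_fsq_bounds: "\<sigma> (r - 1) \<le> fsq n r (colfun Zs)" "fsq n r (colfun Zs) \<le> real r * \<sigma> 0"
proof -
  have "\<sigma> (r - 1) \<le> (\<Sum>s<r. \<sigma> s)"
    using r \<sigma>_pos by (intro member_le_sum) (auto intro: less_imp_le)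
  then show "\<sigma> (r - 1) \<le> fsq n r (colfun Zs)" by (simp add: Zs_fsq)
  have "(\<Sum>s<r. \<sigma> s) \<le> (\<Sum>s<r. \<sigma> 0)" using \<sigma>_bounds(2) by (intro sum_mono) auto
  then show "fsq n r (colfun Zs) \<le> real r * \<sigma> 0" by (simp add: Zs_fsq)
qed

lemma measurement_tbil:
  assumes "A i \<in> carrier_mat n n"
  shows "measurement A X i = tbil n r (\<lambda>j k. A i $$ (j, k)) (colfun Zs) (colfun Zs)"
proof -
  have "measurement A X i = (\<Sum>j<n. \<Sum>k<n. A i $$ (j, k) * X $$ (k, j))"
    using assms X_carrier by (simp add: measurement_def mat_tr_def scalar_prod_def atLeast0LessThan)
  also have "\<dots> = mat_ip n (\<lambda>j k. A i $$ (j, k)) (outer r (colfun Zs) (colfun Zs))"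
    unfolding mat_ip_def by (intro sum.cong refl) (simp add: X_entry outer_swap)
  finally show ?thesis by (simp add: mat_ip_outer_sum)
qed

end

section \<open>The gradient under rotations and in column form\<close>

lemma mat_tr_tbil:
  assumes "A \<in> carrier_mat n n" "Z \<in> carrier_mat n r"
  shows "mat_tr (Z\<^sup>T * A * Z) = tbil n r (\<lambda>j k. A $$ (j, k)) (colfun Z) (colfun Z)"
  using mat_tr_quadratic[OF assms assms(2)] by (simp add: tbil_def bil_def colfun_def)

lemma mat_tr_rotate:
  assumes A: "A \<in> carrier_mat n n" and Z: "Z \<in> carrier_mat n r" and Q: "Q \<in> ortho r"
  shows "mat_tr ((Z * Q\<^sup>T)\<^sup>T * A * (Z * Q\<^sup>T)) = mat_tr (Z\<^sup>T * A * Z)"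
proof -
  have c: "Q \<in> carrier_mat r r" "Q\<^sup>T \<in> carrier_mat r r" "Q\<^sup>T * Q = 1\<^sub>m r" using Q by (auto simp: ortho_def)
  have AZ: "Z\<^sup>T * A \<in> carrier_mat r n" "Z\<^sup>T * A * Z \<in> carrier_mat r r" using A Z by auto
  have "(Z * Q\<^sup>T)\<^sup>T * A * (Z * Q\<^sup>T) = Q * (Z\<^sup>T * A) * (Z * Q\<^sup>T)"
    using A Z c by (simp add: transpose_mult[of Z n r "Q\<^sup>T" r] assoc_mult_mat[of Q r r _ n _ n])
  also have "\<dots> = Q * (Z\<^sup>T * A * (Z * Q\<^sup>T))"
    using c AZ Z by (intro assoc_mult_mat[of _ r r _ n _ r]) auto
  also have "Z\<^sup>T * A * (Z * Q\<^sup>T) = Z\<^sup>T * A * Z * Q\<^sup>T"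
    using c AZ Z by (intro assoc_mult_mat[symmetric]) auto
  also have "mat_tr (Q * (Z\<^sup>T * A * Z * Q\<^sup>T)) = mat_tr (Z\<^sup>T * A * Z * Q\<^sup>T * Q)"
    using c AZ by (intro mat_tr_mult_commute[of _ r r]) auto
  also have "Z\<^sup>T * A * Z * Q\<^sup>T * Q = Z\<^sup>T * A * Z * (Q\<^sup>T * Q)"
    using c AZ by (intro assoc_mult_mat) auto
  finally show ?thesis using c by (simp add: right_mult_one_mat[OF AZ(2)])
qed

lemma loss_grad_carrier [simp]: "Z \<in> carrier_mat n r \<Longrightarrow> loss_grad m A b Z \<in> carrier_mat n r"
  by (simp add: loss_grad_def)

lemma index_mult_transpose:
  assumes "B \<in> carrier_mat n r" "Q \<in> carrier_mat r r" "p < n" "q < r"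
  shows "(B * Q\<^sup>T) $$ (p, q) = (\<Sum>u<r. B $$ (p, u) * Q $$ (q, u))"
  using assms by (simp add: scalar_prod_def atLeast0LessThan)

text \<open>The residuals are invariant under orthogonal multiplication from the right and the
  remaining factor is linear, so the gradient is equivariant. A descent step may therefore be
  analysed in aligned coordinates and rotated back.\<close>

lemma loss_grad_rotate:
  assumes A: "\<And>i. i < m \<Longrightarrow> A i \<in> carrier_mat n n" and Z: "Z \<in> carrier_mat n r" and Q: "Q \<in> ortho r"
  shows "loss_grad m A b (Z * Q\<^sup>T) = loss_grad m A b Z * Q\<^sup>T"
proof (rule eq_matI)
  have c: "Q \<in> carrier_mat r r" "Q\<^sup>T \<in> carrier_mat r r" using Q by (auto simp: ortho_def)
  have ZQ: "Z * Q\<^sup>T \<in> carrier_mat n r" using Z c by simp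
  show "dim_row (loss_grad m A b (Z * Q\<^sup>T)) = dim_row (loss_grad m A b Z * Q\<^sup>T)"
    "dim_col (loss_grad m A b (Z * Q\<^sup>T)) = dim_col (loss_grad m A b Z * Q\<^sup>T)"
    using Z c by (auto simp: loss_grad_def)
  fix p q assume "p < dim_row (loss_grad m A b Z * Q\<^sup>T)" "q < dim_col (loss_grad m A b Z * Q\<^sup>T)"
  then have pq: "p < n" "q < r" using Z c by (auto simp: loss_grad_def)
  let ?e = "\<lambda>i. mat_tr (Z\<^sup>T * A i * Z) - b i"
  have AZ: "(A i * (Z * Q\<^sup>T)) $$ (p, q) = (\<Sum>u<r. (A i * Z) $$ (p, u) * Q $$ (q, u))" if "i < m" for i
  proof -
    have "A i * (Z * Q\<^sup>T) = A i * Z * Q\<^sup>T"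
      using A[OF that] Z c by (intro assoc_mult_mat[symmetric]) auto
    moreover have "A i * Z \<in> carrier_mat n r" using A[OF that] Z by simp
    ultimately show ?thesis by (simp only: index_mult_transpose[OF _ c(1) pq])
  qed
  have "loss_grad m A b (Z * Q\<^sup>T) $$ (p, q) = 1 / real m * (\<Sum>i<m. ?e i * (\<Sum>u<r. (A i * Z) $$ (p, u) * Q $$ (q, u)))"
    using ZQ Z c pq AZ mat_tr_rotate[OF A Z Q] by (simp add: loss_grad_def)
  also have "\<dots> = (\<Sum>i<m. \<Sum>u<r. 1 / real m * (?e i * (A i * Z) $$ (p, u)) * Q $$ (q, u))"
    by (simp add: sum_distrib_left mult_ac)
  also have "\<dots> = (\<Sum>u<r. \<Sum>i<m. 1 / real m * (?e i * (A i * Z) $$ (p, u)) * Q $$ (q, u))"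
    by (rule sum.swap)
  also have "\<dots> = (\<Sum>u<r. loss_grad m A b Z $$ (p, u) * Q $$ (q, u))"
    using Z pq by (intro sum.cong refl) (simp add: loss_grad_def sum_distrib_left sum_distrib_right)
  also have "\<dots> = (loss_grad m A b Z * Q\<^sup>T) $$ (p, q)"
    by (simp only: index_mult_transpose[OF loss_grad_carrier[OF Z] c(1) pq])
  finally show "loss_grad m A b (Z * Q\<^sup>T) $$ (p, q) = (loss_grad m A b Z * Q\<^sup>T) $$ (p, q)" .
qed

lemma (in low_rank) loss_grad_colfun:
  assumes A: "\<And>i. i < m \<Longrightarrow> A i \<in> carrier_mat n n" and Z: "Z \<in> carrier_mat n r" and "q < r" "j < n"
  shows "colfun (loss_grad m A (measurement A X) Z) q j = 1 / real m * (\<Sum>i<m.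
    (tbil n r (\<lambda>j k. A i $$ (j, k)) (colfun Z) (colfun Z) - tbil n r (\<lambda>j k. A i $$ (j, k)) (colfun Zs) (colfun Zs))
      * (\<Sum>k<n. A i $$ (j, k) * colfun Z q k))"
proof -
  have "(A i * Z) $$ (j, q) = (\<Sum>k<n. A i $$ (j, k) * colfun Z q k)" if "i < m" for i
    using A[OF that] Z assms(3,4) by (simp add: colfun_def scalar_prod_def atLeast0LessThan)
  moreover have "measurement A X i = tbil n r (\<lambda>j k. A i $$ (j, k)) (colfun Zs) (colfun Zs)" if "i < m" for i
    by (rule measurement_tbil[of A i, OF A[OF that]])
  moreover have "colfun (loss_grad m A (measurement A X) Z) q j = loss_grad m A (measurement A X) Z $$ (j, q)"
    by (simp add: colfun_def)
  ultimately show ?thesis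
    using Z assms(3,4) mat_tr_tbil[OF A Z] by (simp add: loss_grad_def)
qed

lemma (in low_rank) gradient_descent_step:
  assumes m: "m > 0" and A: "\<And>i. i < m \<Longrightarrow> A i \<in> carrier_mat n n \<and> (A i)\<^sup>T = A i"
    and conc1: "\<And>g x. g \<in> ball_grid {..<n} n \<Longrightarrow> x \<in> ball_grid {..<n} n \<Longrightarrow>
      concentrated n m (\<lambda>i j k. A i $$ (j, k)) (1 / 32) (\<lambda>j k. g j * x k)"
    and conc2: "\<And>x. x \<in> ball_grid ({..<n} \<times> {..<r}) n \<Longrightarrow>
      concentrated n m (\<lambda>i j k. A i $$ (j, k)) (1 / 32) (outer r (\<lambda>s j. x (j, s)) (colfun U))"
    and Z: "Z \<in> carrier_mat n r" and close: "proc_dist r Z Zs \<le> sqrt (3 / 16 * \<sigma> (r - 1))"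
    and \<kappa>: "\<kappa> = \<sigma> 0 / \<sigma> (r - 1)" and \<mu>: "0 < \<mu>" "\<mu> \<le> 1 / 2000 / (\<kappa> * real n)"
  shows "proc_dist r (Z - (\<mu> / (frob_norm Zs)\<^sup>2) \<cdot>\<^sub>m loss_grad m A (measurement A X) Z) Zs
    \<le> sqrt (1 - \<mu> / (12 * \<kappa> * real r)) * proc_dist r Z Zs"
proof -
  define a where "a = (\<lambda>i j k. A i $$ (j, k))"
  define \<eta> where "\<eta> = \<mu> / (frob_norm Zs)\<^sup>2"
  let ?b = "measurement A X"
  have n: "n \<ge> 1" using r r_le_n by simp
  have sym: "a i j k = a i k j" if "i < m" "j < n" "k < n" for i j k
    using A[OF that(1)] that unfolding a_def by (metis carrier_matD index_transpose_mat(1))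
  obtain Q where Q: "Q \<in> ortho r" "proc_dist r Z Zs = frob_norm (Z - Zs * Q)"
    and dQ: "proc_dist r Z Zs = frob_norm (Z * Q\<^sup>T - Zs)"
    and Qsym: "\<And>s q. s < r \<Longrightarrow> q < r \<Longrightarrow> ip n (colfun (Z * Q\<^sup>T) s) (colfun Zs q) = ip n (colfun (Z * Q\<^sup>T) q) (colfun Zs s)"
    and "\<And>v. 0 \<le> (\<Sum>s<r. \<Sum>q<r. ip n (colfun (Z * Q\<^sup>T) s) (colfun Zs q) * v s * v q)"
    by (rule proc_dist_aligned[OF Z Zs_carrier]) (rule that)
  note Q = Q(1)
  have c: "Q \<in> carrier_mat r r" "Q\<^sup>T \<in> carrier_mat r r" "Q\<^sup>T * Q = 1\<^sub>m r" using Q by (auto simp: ortho_def)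
  define Y where "Y = Z * Q\<^sup>T"
  have Y: "Y \<in> carrier_mat n r" using Z c by (simp add: Y_def)
  define H where "H = (\<lambda>q j. colfun Y q j - colfun Zs q j)"
  define G where "G = (\<lambda>q j. 1 / real m * (\<Sum>i<m. (tbil n r (a i) (colfun Y) (colfun Y) - tbil n r (a i) (colfun Zs) (colfun Zs)) * (\<Sum>k<n. a i j k * colfun Y q k)))"
  have YH: "colfun Y = (\<lambda>q j. colfun Zs q j + H q j)" by (simp add: H_def)
  have norm_cols: "frob_norm (V - Zs) = sqrt (fsq n r (\<lambda>q j. colfun V q j - colfun Zs q j))" if "V \<in> carrier_mat n r" for V
  proof -
    have "fsq n r (colfun (V - Zs)) = fsq n r (\<lambda>q j. colfun V q j - colfun Zs q j)"
      using that Zs_carrier by (intro fsq_cong) (auto simp: colfun_def)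
    then show ?thesis using frob_norm_colfun[OF minus_carrier_mat[OF Zs_carrier, of V]] by simp
  qed
  have dH: "proc_dist r Z Zs = sqrt (fsq n r H)"
    using norm_cols[OF Y] dQ by (simp add: H_def Y_def)
  have closeH: "fsq n r H \<le> 3 / 16 * \<sigma> (r - 1)"
    using close unfolding dH by simp
  have Zpos: "fsq n r (colfun Zs) > 0" using Zs_fsq_bounds(1) \<sigma>_bounds(3) by linarith
  have \<eta>: "\<eta> = \<mu> / fsq n r (colfun Zs)"
    using frob_norm_colfun[OF Zs_carrier] by (simp add: \<eta>_def)
  have \<kappa>_pos: "\<kappa> > 0" using \<sigma>_bounds \<kappa> by simp
  have step: "fsq n r (\<lambda>q j. H q j - \<eta> * G q j) \<le> (1 - \<eta> * \<sigma> (r - 1) / 12) * fsq n r H"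
  proof (rule gradient_step_contracts[where a = a and m = m and Zs = "colfun Zs" and Z = "colfun Y"])
    show "(\<Sum>i<m. (bil n (a i) x y)\<^sup>2) \<le> 3 * real m * sqn n x * sqn n y" for x y
      by (rule rank_one_bound[OF n, where t = "1 / 32"]) (use conc1 sym in \<open>simp_all add: a_def\<close>)
    show "3 / 4 * real m * \<sigma> (r - 1) * fsq n r H \<le> (\<Sum>i<m. (tbil n r (a i) H (colfun Zs))\<^sup>2)"
    proof (rule tangent_lower_bound[OF n r_le_n U_orthonormal, where t = "1 / 32" and \<sigma> = \<sigma>])
      show "concentrated n m a (1 / 32) (outer r (\<lambda>s j. x (j, s)) (colfun U))" if "x \<in> ball_grid ({..<n} \<times> {..<r}) n" for x
        using conc2[OF that] by (simp add: a_def)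
      show "ip n (colfun Zs s) (H u) = ip n (colfun Zs u) (H s)" if "s < r" "u < r" for s u
      proof -
        have "ip n (colfun Zs s) (H u) = ip n (colfun Y u) (colfun Zs s) - ip n (colfun Zs s) (colfun Zs u)" for s u
          by (simp add: ip_def H_def right_diff_distrib sum_subtractf mult.commute)
        then show ?thesis using Qsym[OF that] by (simp add: Y_def ip_commute[of n "colfun Zs s"])
      qed
    qed (use \<sigma>_bounds Zs_entry in auto)
    \<comment> \<open>Here the step size meets the dimension: the squared norm of the factor is at
      most \<open>n * \<sigma> 0\<close>, which is \<open>\<kappa> * n * \<sigma> (r - 1)\<close>.
      The value 1/2000 suffices because 192/2000 is below 5/48.\<close>
    have "\<mu> * (\<kappa> * real n) \<le> 1 / 2000"
      using \<mu>(2) \<kappa>_pos n by (simp add: field_simps)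
    then have "\<mu> * (\<kappa> * real n) * \<sigma> (r - 1) \<le> 1 / 2000 * \<sigma> (r - 1)"
      using \<sigma>_bounds(3) by (intro mult_right_mono) auto
    moreover have "\<mu> * fsq n r (colfun Zs) \<le> \<mu> * (real n * \<sigma> 0)"
    proof (rule mult_left_mono)
      have "real r * \<sigma> 0 \<le> real n * \<sigma> 0" using r_le_n \<sigma>_bounds(4) by (intro mult_right_mono) auto
      then show "fsq n r (colfun Zs) \<le> real n * \<sigma> 0" using Zs_fsq_bounds(2) by linarith
    qed (use \<mu> in simp)
    moreover have "\<mu> * (real n * \<sigma> 0) = \<mu> * (\<kappa> * real n) * \<sigma> (r - 1)" using \<kappa> \<sigma>_bounds(3) by simp
    ultimately have "\<mu> * fsq n r (colfun Zs) \<le> 1 / 2000 * \<sigma> (r - 1)" by linarith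
    moreover have "192 * \<eta> * (fsq n r (colfun Zs))\<^sup>2 = 192 * (\<mu> * fsq n r (colfun Zs))"
      using Zpos by (simp add: \<eta> power2_eq_square)
    ultimately show "192 * \<eta> * (fsq n r (colfun Zs))\<^sup>2 \<le> 5 / 48 * \<sigma> (r - 1)"
      using \<sigma>_bounds(3) by linarith
  qed (use m sym closeH Zs_fsq_bounds \<mu> Zpos in \<open>simp_all add: YH G_def \<eta>\<close>)
  \<comment> \<open>For the rate the sharper bound \<open>r * \<sigma> 0\<close> on the squared norm
    of the factor is used, which puts \<open>r\<close> instead of \<open>n\<close> into the
    contraction factor.\<close>
  have rate: "\<mu> / (12 * \<kappa> * real r) \<le> \<eta> * \<sigma> (r - 1) / 12"
  proof -
    have "1 / (real r * \<sigma> 0) \<le> 1 / fsq n r (colfun Zs)"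
      using Zs_fsq_bounds(2) Zpos by (intro divide_left_mono) auto
    then have "\<mu> * \<sigma> (r - 1) / 12 * (1 / (real r * \<sigma> 0)) \<le> \<mu> * \<sigma> (r - 1) / 12 * (1 / fsq n r (colfun Zs))"
      using \<mu> \<sigma>_bounds(3) by (intro mult_left_mono) auto
    then show ?thesis by (simp add: \<eta> \<kappa> mult_ac)
  qed
  define Z' where "Z' = Z - \<eta> \<cdot>\<^sub>m loss_grad m A ?b Z"
  have L: "loss_grad m A ?b Z \<in> carrier_mat n r" using Z by simp
  have Z': "Z' \<in> carrier_mat n r" using L by (auto simp: Z'_def intro!: minus_carrier_mat)
  have rot: "Z' * Q\<^sup>T = Y - \<eta> \<cdot>\<^sub>m loss_grad m A ?b Y"
  proof -
    have "Z' * Q\<^sup>T = Z * Q\<^sup>T - \<eta> \<cdot>\<^sub>m loss_grad m A ?b Z * Q\<^sup>T"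
      unfolding Z'_def using Z L c by (intro minus_mult_distrib_mat) auto
    also have "\<eta> \<cdot>\<^sub>m loss_grad m A ?b Z * Q\<^sup>T = \<eta> \<cdot>\<^sub>m (loss_grad m A ?b Z * Q\<^sup>T)"
      using L c by (intro mult_smult_assoc_mat) auto
    finally show ?thesis using loss_grad_rotate[of m A n Z r Q ?b] A Z Q by (simp add: Y_def)
  qed
  \<comment> \<open>The old rotation \<open>Q\<close> need not be optimal for the new iterate, but
    it is admissible and so bounds the new distance from above.\<close>
  have "Z' - Zs * Q = (Z' * Q\<^sup>T - Zs) * Q"
  proof -
    have ZQ: "Z' * Q\<^sup>T \<in> carrier_mat n r" using Z' c by simp
    have "(Z' * Q\<^sup>T - Zs) * Q = Z' * Q\<^sup>T * Q - Zs * Q"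
      by (rule minus_mult_distrib_mat[OF ZQ Zs_carrier c(1)])
    also have "Z' * Q\<^sup>T * Q = Z'" using Z' c by (simp add: assoc_mult_mat[of _ n r _ r _ r])
    finally show ?thesis by simp
  qed
  then have "frob_norm (Z' - Zs * Q) = frob_norm (Z' * Q\<^sup>T - Zs)"
    by (simp add: frob_norm_mult_ortho[OF minus_carrier_mat[OF Zs_carrier] Q])
  also have "\<dots> = sqrt (fsq n r (\<lambda>q j. colfun (Z' * Q\<^sup>T) q j - colfun Zs q j))"
    using Z' c by (intro norm_cols) auto
  also have "fsq n r (\<lambda>q j. colfun (Z' * Q\<^sup>T) q j - colfun Zs q j) = fsq n r (\<lambda>q j. H q j - \<eta> * G q j)"
  proof (rule fsq_cong)
    fix q j assume qj: "q < r" "j < n"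
    have "colfun (Z' * Q\<^sup>T) q j = colfun Y q j - \<eta> * colfun (loss_grad m A ?b Y) q j"
      unfolding rot colfun_def using qj Y by (simp add: carrier_matD[OF loss_grad_carrier[OF Y]])
    then show "colfun (Z' * Q\<^sup>T) q j - colfun Zs q j = H q j - \<eta> * G q j"
      using loss_grad_colfun[of m A Y q j] A Y qj by (simp add: H_def G_def a_def)
  qed
  also have "sqrt (fsq n r (\<lambda>q j. H q j - \<eta> * G q j)) \<le> sqrt ((1 - \<mu> / (12 * \<kappa> * real r)) * fsq n r H)"
  proof (rule real_sqrt_le_mono)
    have "(1 - \<eta> * \<sigma> (r - 1) / 12) * fsq n r H \<le> (1 - \<mu> / (12 * \<kappa> * real r)) * fsq n r H"
      using rate by (intro mult_right_mono) auto
    then show "fsq n r (\<lambda>q j. H q j - \<eta> * G q j) \<le> (1 - \<mu> / (12 * \<kappa> * real r)) * fsq n r H"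
      using step by linarith
  qed
  finally have "frob_norm (Z' - Zs * Q) \<le> sqrt (1 - \<mu> / (12 * \<kappa> * real r)) * proc_dist r Z Zs"
    by (simp add: dH real_sqrt_mult)
  then show ?thesis
    using proc_dist_le[OF Q, of Z' Zs] by (simp add: Z'_def \<eta>_def)
qed

text \<open>As the rate is at most 1, the induction hypothesis keeps each iterate within the initial
  radius, so the one-step contraction applies again.\<close>

lemma (in low_rank) gradient_descent_converges:
  assumes m: "m > 0" and A: "\<And>i. i < m \<Longrightarrow> A i \<in> carrier_mat n n \<and> (A i)\<^sup>T = A i"
    and conc1: "\<And>g x. g \<in> ball_grid {..<n} n \<Longrightarrow> x \<in> ball_grid {..<n} n \<Longrightarrow>
      concentrated n m (\<lambda>i j k. A i $$ (j, k)) (1 / 32) (\<lambda>j k. g j * x k)"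
    and conc2: "\<And>x. x \<in> ball_grid ({..<n} \<times> {..<r}) n \<Longrightarrow>
      concentrated n m (\<lambda>i j k. A i $$ (j, k)) (1 / 32) (outer r (\<lambda>s j. x (j, s)) (colfun U))"
    and Z: "Z0 \<in> carrier_mat n r" and close: "proc_dist r Z0 Zs \<le> sqrt (3 / 16 * \<sigma> (r - 1))"
    and \<kappa>: "\<kappa> = \<sigma> 0 / \<sigma> (r - 1)" and \<mu>: "0 < \<mu>" "\<mu> \<le> 1 / 2000 / (\<kappa> * real n)"
  shows "proc_dist r (grad_descent m A (measurement A X) (\<mu> / (frob_norm Zs)\<^sup>2) Z0 k) Zs
    \<le> sqrt (3 / 16 * \<sigma> (r - 1)) * (1 - \<mu> / (12 * \<kappa> * real r)) powr (real k / 2)"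
proof -
  define \<rho> where "\<rho> = 1 - \<mu> / (12 * \<kappa> * real r)"
  let ?D = "sqrt (3 / 16 * \<sigma> (r - 1))"
  let ?Z = "grad_descent m A (measurement A X) (\<mu> / (frob_norm Zs)\<^sup>2) Z0"
  have n: "n \<ge> 1" using r r_le_n by simp
  have \<kappa>1: "\<kappa> \<ge> 1" using \<sigma>_bounds \<sigma>_mono[of 0 "r - 1"] r by (simp add: \<kappa>)
  \<comment> \<open>The base of \<open>powr\<close> has to be strictly positive: for base 0 the
    value at exponent 0 would be 0, and the start of the induction would fail.\<close>
  have "\<mu> / (12 * \<kappa> * real r) \<le> 1 / 2"
  proof -
    have "1 \<le> \<kappa> * real n" "1 \<le> \<kappa> * real r" using \<kappa>1 n r mult_mono[of 1 \<kappa> 1] by auto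
    then have "1 / 2000 / (\<kappa> * real n) \<le> 1 / 2000 / 1" by (intro divide_left_mono) auto
    then have "\<mu> \<le> 1 / 2000" using \<mu> by linarith
    then have "\<mu> \<le> 1 / 2 * (12 * (\<kappa> * real r))" using \<open>1 \<le> \<kappa> * real r\<close> by linarith
    then show ?thesis using \<open>1 \<le> \<kappa> * real r\<close> by (simp add: divide_le_eq mult.assoc)
  qed
  then have \<rho>: "0 < \<rho>" "\<rho> \<le> 1" using \<mu> \<kappa>1 r by (auto simp: \<rho>_def)
  have D0: "?D \<ge> 0" using \<sigma>_bounds(3) by simp
  have "?Z k \<in> carrier_mat n r \<and> proc_dist r (?Z k) Zs \<le> ?D * \<rho> powr (real k / 2)"
  proof (induction k)
    case 0
    then show ?case using Z close \<rho>(1) by simp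
  next
    case (Suc k)
    have "?D * \<rho> powr (real k / 2) \<le> ?D * 1"
      using \<rho> D0 by (intro mult_left_mono powr_le1) auto
    then have cl: "proc_dist r (?Z k) Zs \<le> ?D" using Suc by linarith
    have "proc_dist r (?Z (Suc k)) Zs \<le> sqrt \<rho> * proc_dist r (?Z k) Zs"
      unfolding \<rho>_def grad_descent.simps
      by (rule gradient_descent_step[OF m A conc1 conc2 conjunct1[OF Suc] cl \<kappa> \<mu>])
    also have "\<dots> \<le> sqrt \<rho> * (?D * \<rho> powr (real k / 2))"
      using Suc \<rho> by (intro mult_left_mono) auto
    also have "\<dots> = ?D * \<rho> powr (real (Suc k) / 2)"
      using \<rho> by (simp add: powr_half_sqrt[symmetric] powr_add[symmetric] add_divide_distrib)
    finally show ?case using Suc by (auto intro!: minus_carrier_mat)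
  qed
  then show ?thesis by (simp add: \<rho>_def)
qed

section \<open>Spectral initialization\<close>

definition mv :: "nat \<Rightarrow> (nat \<Rightarrow> nat \<Rightarrow> real) \<Rightarrow> (nat \<Rightarrow> real) \<Rightarrow> nat \<Rightarrow> real" where
  "mv n C x j = (\<Sum>k<n. C j k * x k)"

lemma bil_mv: "bil n C x y = ip n x (mv n C y)"
  by (simp add: bil_def ip_def mv_def sum_distrib_left mult_ac)

lemma ip_square_le: "(ip n x y)\<^sup>2 \<le> sqn n x * sqn n y"
  unfolding ip_def sqn_def by (rule Cauchy_Schwarz_ineq_sum)

lemma sqn_orthonormal_comb:
  fixes r :: nat
  assumes "\<And>s t. s < r \<Longrightarrow> t < r \<Longrightarrow> ip n (u s) (u t) = (if s = t then 1 else 0)"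
  shows "sqn n (\<lambda>j. \<Sum>s<r. c s * u s j) = (\<Sum>s<r. (c s)\<^sup>2)"
proof -
  have "sqn n (\<lambda>j. \<Sum>s<r. c s * u s j) = (\<Sum>j<n. \<Sum>s<r. \<Sum>t<r. c s * c t * (u s j * u t j))"
    by (simp add: sqn_def power2_eq_square sum_product mult_ac)
  also have "\<dots> = (\<Sum>s<r. \<Sum>j<n. \<Sum>t<r. c s * c t * (u s j * u t j))" by (rule sum.swap)
  also have "\<dots> = (\<Sum>s<r. \<Sum>t<r. \<Sum>j<n. c s * c t * (u s j * u t j))" by (intro sum.cong refl sum.swap)
  also have "\<dots> = (\<Sum>s<r. \<Sum>t<r. c s * c t * ip n (u s) (u t))" by (simp add: ip_def sum_distrib_left)
  also have "\<dots> = (\<Sum>s<r. \<Sum>t<r. if t = s then c s * c t else 0)"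
    using assms by (intro sum.cong refl) auto
  finally show ?thesis by (simp add: power2_eq_square)
qed

lemma ip_mv_commute:
  assumes "\<And>j k. j < n \<Longrightarrow> k < n \<Longrightarrow> C j k = C k j"
  shows "ip n x (mv n C y) = ip n y (mv n C x)"
  using bil_commute[of n C, OF assms] by (simp add: bil_mv)

text \<open>For a symmetric matrix a bound on the quadratic form is a bound on the operator norm.
  Polarization between \<open>x\<close> and \<open>B x / \<tau>\<close>, with the parallelogram law,
  bounds the norm of the second vector by that of the first.\<close>

lemma sqn_mv_le:
  assumes sym: "\<And>j k. j < n \<Longrightarrow> k < n \<Longrightarrow> B j k = B k j" and \<tau>: "\<tau> > 0"
    and q: "\<And>x. \<bar>bil n B x x\<bar> \<le> \<tau> * sqn n x"
  shows "sqn n (mv n B x) \<le> \<tau>\<^sup>2 * sqn n x"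
proof -
  define y where "y j = mv n B x j / \<tau>" for j
  have y: "mv n B x = (\<lambda>j. \<tau> * y j)" using \<tau> by (auto simp: y_def)
  have "bil n B (\<lambda>j. x j + y j) (\<lambda>j. x j + y j) - bil n B (\<lambda>j. x j - y j) (\<lambda>j. x j - y j) = 2 * (bil n B x y + bil n B y x)"
    by (simp add: bil_def algebra_simps sum.distrib sum_subtractf)
  moreover have "bil n B x y = bil n B y x" by (rule bil_commute) (rule sym)
  ultimately have "4 * bil n B y x = bil n B (\<lambda>j. x j + y j) (\<lambda>j. x j + y j) - bil n B (\<lambda>j. x j - y j) (\<lambda>j. x j - y j)"
    by simp
  also have "\<dots> \<le> \<tau> * sqn n (\<lambda>j. x j + y j) - - (\<tau> * sqn n (\<lambda>j. x j - y j))"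
    using abs_le_D1[OF q[of "\<lambda>j. x j + y j"]] abs_le_D2[OF q[of "\<lambda>j. x j - y j"]]
    by (simp only: diff_minus_eq_add)
  also have "\<dots> = \<tau> * sqn n (\<lambda>j. x j + y j) + \<tau> * sqn n (\<lambda>j. x j - y j)" by simp
  also have "\<dots> = \<tau> * (sqn n (\<lambda>j. x j + y j) + sqn n (\<lambda>j. x j - y j))" by (simp add: distrib_left)
  also have "sqn n (\<lambda>j. x j + y j) + sqn n (\<lambda>j. x j - y j) = 2 * sqn n x + 2 * sqn n y"
    by (simp add: sqn_def power2_eq_square algebra_simps sum.distrib sum_subtractf)
  also have "bil n B y x = \<tau> * sqn n y"
    by (simp add: bil_mv y ip_def sqn_def sum_distrib_left power2_eq_square mult_ac)
  finally have "\<tau> * (4 * sqn n y) \<le> \<tau> * (2 * sqn n x + 2 * sqn n y)" by (simp add: mult_ac)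
  then have "sqn n y \<le> sqn n x" using \<tau> by simp
  moreover have "sqn n (mv n B x) = \<tau>\<^sup>2 * sqn n y"
    by (simp add: y sqn_def power_mult_distrib sum_distrib_left)
  ultimately show ?thesis by (simp add: mult_left_mono)
qed

lemma orthonormal_basis_complete:
  fixes v :: "nat \<Rightarrow> nat \<Rightarrow> real"
  assumes orth: "\<And>s t. s < n \<Longrightarrow> t < n \<Longrightarrow> ip n (v s) (v t) = (if s = t then 1 else 0)"
    and "j < n" "k < n"
  shows "(\<Sum>s<n. v s j * v s k) = (if j = k then 1 else 0)"
proof -
  define V where "V = mat n n (\<lambda>(j, s). v s j)"
  have V: "V \<in> carrier_mat n n" "V\<^sup>T \<in> carrier_mat n n" by (auto simp: V_def)
  have "V\<^sup>T * V = 1\<^sub>m n"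
    using orth by (auto simp: V_def mat_eq_iff scalar_prod_def atLeast0LessThan ip_def)
  then have "V * V\<^sup>T = 1\<^sub>m n" using V by (intro mat_mult_left_right_inverse[of "V\<^sup>T" n]) auto
  then have "(V * V\<^sup>T) $$ (j, k) = (if j = k then 1 else 0)" using assms by simp
  then show ?thesis using assms by (simp add: V_def scalar_prod_def atLeast0LessThan)
qed

text \<open>The Frobenius norm of the error is computed in the eigenbasis \<open>v\<close>, where
  the two matrices separate. The leading \<open>r\<close> vectors contribute at most
  \<open>10 * \<tau>\<^sup>2\<close> each and the others
  \<open>r * (2 * r + 4) * \<tau>\<^sup>2\<close> together; the total
  \<open>14 * r + 2 * r\<^sup>2\<close> is at most \<open>16 * r\<^sup>2\<close>.\<close>

lemma spectral_truncation_error: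
  fixes u v B :: "nat \<Rightarrow> nat \<Rightarrow> real" and \<sigma> l :: "nat \<Rightarrow> real" and n r :: nat
  defines "X \<equiv> \<lambda>j k. \<Sum>s<r. \<sigma> s * u s j * u s k"
  assumes u: "\<And>s t. s < r \<Longrightarrow> t < r \<Longrightarrow> ip n (u s) (u t) = (if s = t then 1 else 0)"
    and v: "\<And>s t. s < n \<Longrightarrow> t < n \<Longrightarrow> ip n (v s) (v t) = (if s = t then 1 else 0)"
    and r: "r \<ge> 1" "r \<le> n" and \<sigma>: "\<And>s. s < r \<Longrightarrow> 0 \<le> \<sigma> s" and \<tau>: "\<tau> > 0"
    and sym: "\<And>j k. j < n \<Longrightarrow> k < n \<Longrightarrow> B j k = B k j"
    and op: "\<And>x. sqn n (mv n B x) \<le> \<tau>\<^sup>2 * sqn n x"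
    and eig: "\<And>s j. s < n \<Longrightarrow> j < n \<Longrightarrow> mv n X (v s) j + mv n B (v s) j = l s * v s j"
    and mono: "\<And>s t. s \<le> t \<Longrightarrow> t < n \<Longrightarrow> \<bar>l t\<bar> \<le> \<bar>l s\<bar>"
  shows "(\<Sum>j<n. \<Sum>k<n. ((\<Sum>s<r. \<bar>l s\<bar> * v s j * v s k) - X j k)\<^sup>2) \<le> 16 * (real r)\<^sup>2 * \<tau>\<^sup>2"
proof -
  have Xv: "mv n X x j = (\<Sum>s<r. \<sigma> s * ip n (u s) x * u s j)" for x j
  proof -
    have "mv n X x j = (\<Sum>k<n. \<Sum>s<r. \<sigma> s * u s j * (u s k * x k))"
      by (simp add: mv_def X_def sum_distrib_left sum_distrib_right mult_ac)
    also have "\<dots> = (\<Sum>s<r. \<Sum>k<n. \<sigma> s * u s j * (u s k * x k))" by (rule sum.swap)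
    finally show ?thesis by (simp add: ip_def sum_distrib_left mult_ac)
  qed
  have uX: "ip n y (mv n X x) = (\<Sum>s<r. \<sigma> s * ip n (u s) x * ip n (u s) y)" for x y
  proof -
    have "ip n y (mv n X x) = (\<Sum>j<n. \<Sum>s<r. \<sigma> s * ip n (u s) x * (u s j * y j))"
      unfolding ip_def[of n y] Xv by (simp add: sum_distrib_left mult_ac)
    also have "\<dots> = (\<Sum>s<r. \<Sum>j<n. \<sigma> s * ip n (u s) x * (u s j * y j))" by (rule sum.swap)
    finally show ?thesis by (simp add: ip_def[of n "u _" y] sum_distrib_left)
  qed
  have v1: "sqn n (v s) = 1" if "s < n" for s using v[OF that that] by (simp add: ip_self)
  have u1: "sqn n (u s) = 1" if "s < r" for s using u[OF that that] by (simp add: ip_self)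
  have ip_eig: "ip n y (mv n X (v s)) + ip n y (mv n B (v s)) = l s * ip n y (v s)" if "s < n" for s y
  proof -
    have "ip n y (mv n X (v s)) + ip n y (mv n B (v s)) = (\<Sum>j<n. y j * (mv n X (v s) j + mv n B (v s) j))"
      by (simp add: ip_def sum.distrib distrib_left)
    also have "\<dots> = (\<Sum>j<n. l s * (y j * v s j))" using eig[OF that] by (intro sum.cong) auto
    finally show ?thesis by (simp add: ip_def sum_distrib_left)
  qed
  have u_eig: "\<sigma> t * ip n (u t) (v s) + ip n (u t) (mv n B (v s)) = l s * ip n (u t) (v s)" if "t < r" "s < n" for s t
  proof -
    have "ip n (u t) (mv n X (v s)) = (\<Sum>w<r. if w = t then \<sigma> w * ip n (u w) (v s) else 0)"
      unfolding uX using u that by (intro sum.cong refl) auto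
    then show ?thesis using ip_eig[OF that(2), of "u t"] that(1) by simp
  qed
  \<comment> \<open>\<open>X\<close> is positive semidefinite, so an eigenvalue can be negative only
    through \<open>B\<close>. Replacing \<open>l s\<close> by its absolute value thus changes it by
    at most \<open>2 * \<tau>\<close>.\<close>
  have l_lower: "- \<tau> \<le> l s" if s: "s < n" for s
  proof -
    have "0 \<le> ip n (v s) (mv n X (v s))"
      unfolding uX by (intro sum_nonneg) (use \<sigma> in \<open>simp add: mult.assoc\<close>)
    moreover have "\<bar>ip n (v s) (mv n B (v s))\<bar> \<le> \<tau>"
    proof -
      have "(ip n (v s) (mv n B (v s)))\<^sup>2 \<le> \<tau>\<^sup>2"
        using ip_square_le[of n "v s" "mv n B (v s)"] op[of "v s"] by (simp add: v1 s)
      then show ?thesis using \<tau> abs_le_square_iff[of "ip n (v s) (mv n B (v s))" \<tau>] by simp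
    qed
    ultimately show ?thesis using ip_eig[OF s, of "v s"] v[OF s s] by simp
  qed
  \<comment> \<open>Among \<open>r + 1\<close> orthonormal vectors \<open>v s\<close> the squared distances \<open>g s\<close> to the range of \<open>X\<close> sum to at least 1,
    and off that range the matrix acts as \<open>B\<close>.\<close>
  have l_tail: "(l t)\<^sup>2 \<le> (real r + 1) * \<tau>\<^sup>2" if t: "r \<le> t" "t < n" for t
  proof -
    define g where "g s = 1 - (\<Sum>w<r. (ip n (u w) (v s))\<^sup>2)" for s
    have g0: "0 \<le> g s" if "s < n" for s using bessel[OF u, of r "v s"] v1[OF that] by (simp add: g_def)
    have ls: "(l s)\<^sup>2 * g s \<le> \<tau>\<^sup>2" if s: "s < n" for s
    proof -
      let ?R = "\<lambda>x j. x j - (\<Sum>w<r. ip n (u w) x * u w j)"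
      have "?R (mv n B (v s)) j = l s * ?R (v s) j" if j: "j < n" for j
      proof -
        have "(\<Sum>w<r. ip n (u w) (mv n B (v s)) * u w j) = (\<Sum>w<r. l s * (ip n (u w) (v s) * u w j) - \<sigma> w * ip n (u w) (v s) * u w j)"
        proof (intro sum.cong refl)
          fix w assume "w \<in> {..<r}"
          then have "ip n (u w) (mv n B (v s)) = l s * ip n (u w) (v s) - \<sigma> w * ip n (u w) (v s)"
            using u_eig[OF _ s, of w] by simp
          then show "ip n (u w) (mv n B (v s)) * u w j = l s * (ip n (u w) (v s) * u w j) - \<sigma> w * ip n (u w) (v s) * u w j"
            by (simp only: left_diff_distrib mult.assoc)
        qed
        also have "\<dots> = l s * (\<Sum>w<r. ip n (u w) (v s) * u w j) - mv n X (v s) j"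
          by (simp add: sum_subtractf sum_distrib_left Xv)
        finally show ?thesis using eig[OF s j] by (simp add: right_diff_distrib)
      qed
      then have "sqn n (?R (mv n B (v s))) = (l s)\<^sup>2 * sqn n (?R (v s))"
        unfolding sqn_def sum_distrib_left by (intro sum.cong) (simp_all add: power_mult_distrib)
      also have "sqn n (?R (v s)) = g s"
        using orthonormal_residual[of r n u "v s", OF u] v1[OF s] by (simp add: g_def)
      finally have "(l s)\<^sup>2 * g s \<le> sqn n (mv n B (v s))"
        using orthonormal_residual[of r n u "mv n B (v s)", OF u] sum_nonneg[of "{..<r}" "\<lambda>w. (ip n (u w) (mv n B (v s)))\<^sup>2"] by simp
      also have "\<dots> \<le> \<tau>\<^sup>2" using op[of "v s"] v1[OF s] by simp
      finally show ?thesis .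
    qed
    have total: "(\<Sum>s<Suc r. g s) = real (Suc r) - (\<Sum>s<Suc r. \<Sum>w<r. (ip n (u w) (v s))\<^sup>2)"
      by (simp only: g_def sum_subtractf) simp
    have "(\<Sum>s<Suc r. \<Sum>w<r. (ip n (u w) (v s))\<^sup>2) = (\<Sum>w<r. \<Sum>s<Suc r. (ip n (u w) (v s))\<^sup>2)" by (rule sum.swap)
    also have "\<dots> \<le> (\<Sum>w<r. 1)"
    proof (intro sum_mono)
      fix w assume w: "w \<in> {..<r}"
      have "(\<Sum>s<Suc r. (ip n (v s) (u w))\<^sup>2) \<le> sqn n (u w)" using t v by (intro bessel) auto
      then show "(\<Sum>s<Suc r. (ip n (u w) (v s))\<^sup>2) \<le> 1" using w u1 by (simp only: ip_commute[of n "u w"]) simp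
    qed
    finally have "1 \<le> (\<Sum>s<Suc r. g s)" unfolding total by simp
    then have "(l t)\<^sup>2 \<le> (l t)\<^sup>2 * (\<Sum>s<Suc r. g s)" using mult_left_mono[of 1 _ "(l t)\<^sup>2"] by simp
    also have "\<dots> = (\<Sum>s<Suc r. (l t)\<^sup>2 * g s)" by (rule sum_distrib_left)
    also have "\<dots> \<le> (\<Sum>s<Suc r. \<tau>\<^sup>2)"
    proof (intro sum_mono)
      fix s assume "s \<in> {..<Suc r}"
      then have s: "s \<le> t" "s < n" using t by auto
      have "(l t)\<^sup>2 \<le> (l s)\<^sup>2" using mono[OF s(1) t(2)] by (simp add: abs_le_square_iff)
      then have "(l t)\<^sup>2 * g s \<le> (l s)\<^sup>2 * g s" using g0[OF s(2)] by (rule mult_right_mono)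
      then show "(l t)\<^sup>2 * g s \<le> \<tau>\<^sup>2" using ls[OF s(2)] by linarith
    qed
    finally show ?thesis by (simp add: algebra_simps)
  qed
  define D where "D j k = (\<Sum>s<r. \<bar>l s\<bar> * v s j * v s k) - X j k" for j k
  have Dv: "mv n D (v s) j = (if s < r then \<bar>l s\<bar> * v s j else 0) - mv n X (v s) j" if "s < n" for s j
  proof -
    have "mv n D (v s) j = (\<Sum>k<n. (\<Sum>t<r. \<bar>l t\<bar> * v t j * v t k) * v s k) - mv n X (v s) j"
      by (simp only: mv_def D_def left_diff_distrib sum_subtractf)
    also have "(\<Sum>k<n. (\<Sum>t<r. \<bar>l t\<bar> * v t j * v t k) * v s k) = (\<Sum>k<n. \<Sum>t<r. \<bar>l t\<bar> * v t j * (v t k * v s k))"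
      by (simp add: sum_distrib_right mult.assoc)
    also have "(\<Sum>k<n. \<Sum>t<r. \<bar>l t\<bar> * v t j * (v t k * v s k)) = (\<Sum>t<r. \<Sum>k<n. \<bar>l t\<bar> * v t j * (v t k * v s k))"
      by (rule sum.swap)
    also have "\<dots> = (\<Sum>t<r. if t = s then \<bar>l t\<bar> * v t j else 0)"
    proof (intro sum.cong refl)
      fix t assume "t \<in> {..<r}"
      then have "ip n (v t) (v s) = (if t = s then 1 else 0)" using v r that by simp
      then show "(\<Sum>k<n. \<bar>l t\<bar> * v t j * (v t k * v s k)) = (if t = s then \<bar>l t\<bar> * v t j else 0)"
        by (simp add: ip_def sum_distrib_left[symmetric])
    qed
    finally show ?thesis by simp
  qed
  \<comment> \<open>On a leading eigenvector \<open>D\<close> acts as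
    \<open>\<bar>l s\<bar> - l s\<close> plus \<open>B\<close>.\<close>
  have head: "sqn n (mv n D (v s)) \<le> 10 * \<tau>\<^sup>2" if s: "s < r" for s
  proof -
    have sn: "s < n" using s r by simp
    have "sqn n (mv n D (v s)) \<le> (\<Sum>j<n. 2 * ((\<bar>l s\<bar> - l s)\<^sup>2 * (v s j)\<^sup>2) + 2 * (mv n B (v s) j)\<^sup>2)"
      unfolding sqn_def
    proof (intro sum_mono)
      fix j assume j: "j \<in> {..<n}"
      have e: "mv n D (v s) j = (\<bar>l s\<bar> - l s) * v s j + mv n B (v s) j"
        using Dv[OF sn, of j] eig[OF sn, of j] s j by (simp add: left_diff_distrib)
      have "(mv n D (v s) j)\<^sup>2 \<le> 2 * ((\<bar>l s\<bar> - l s) * v s j)\<^sup>2 + 2 * (mv n B (v s) j)\<^sup>2"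
        unfolding e
        using zero_le_power2[of "(\<bar>l s\<bar> - l s) * v s j - mv n B (v s) j"] by (simp add: power2_eq_square algebra_simps)
      then show "(mv n D (v s) j)\<^sup>2 \<le> 2 * ((\<bar>l s\<bar> - l s)\<^sup>2 * (v s j)\<^sup>2) + 2 * (mv n B (v s) j)\<^sup>2"
        by (simp add: power_mult_distrib)
    qed
    also have "\<dots> = 2 * (\<bar>l s\<bar> - l s)\<^sup>2 * sqn n (v s) + 2 * sqn n (mv n B (v s))"
      by (simp add: sqn_def sum.distrib sum_distrib_left mult_ac)
    also have "\<dots> \<le> 2 * (2 * \<tau>)\<^sup>2 * 1 + 2 * \<tau>\<^sup>2"
    proof -
      have "\<bar>\<bar>l s\<bar> - l s\<bar> \<le> \<bar>2 * \<tau>\<bar>" using l_lower[OF sn] \<tau> by linarith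
      then have "(\<bar>l s\<bar> - l s)\<^sup>2 \<le> (2 * \<tau>)\<^sup>2" by (simp only: abs_le_square_iff)
      then show ?thesis using op[of "v s"] v1[OF sn] by simp
    qed
    finally show ?thesis by simp
  qed
  \<comment> \<open>On the other eigenvectors \<open>D\<close> is \<open>- X\<close>. Its components
    along \<open>u t\<close> are expressed through \<open>l s\<close> and \<open>B (u t)\<close>;
    the former is small by \<open>l_tail\<close>, and Bessel's inequality over \<open>v\<close> sums
    both at the cost of a single vector for each \<open>t\<close>.\<close>
  have tail: "(\<Sum>s\<in>{r..<n}. sqn n (mv n D (v s))) \<le> real r * ((2 * real r + 4) * \<tau>\<^sup>2)"
  proof -
    have "(\<Sum>s\<in>{r..<n}. sqn n (mv n D (v s))) = (\<Sum>s\<in>{r..<n}. \<Sum>t<r. (\<sigma> t * ip n (u t) (v s))\<^sup>2)"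
    proof (intro sum.cong refl)
      fix s assume s: "s \<in> {r..<n}"
      have "sqn n (mv n D (v s)) = sqn n (mv n X (v s))"
        using Dv[of s] s by (simp add: sqn_def)
      also have "mv n X (v s) = (\<lambda>j. \<Sum>t<r. \<sigma> t * ip n (u t) (v s) * u t j)" by (rule ext) (rule Xv)
      finally show "sqn n (mv n D (v s)) = (\<Sum>t<r. (\<sigma> t * ip n (u t) (v s))\<^sup>2)"
        by (simp only: sqn_orthonormal_comb[OF u])
    qed
    also have "\<dots> = (\<Sum>t<r. \<Sum>s\<in>{r..<n}. (\<sigma> t * ip n (u t) (v s))\<^sup>2)" by (rule sum.swap)
    also have "\<dots> \<le> (\<Sum>t<r. (2 * real r + 4) * \<tau>\<^sup>2)"
    proof (intro sum_mono)
      fix t assume "t \<in> {..<r}"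
      then have t: "t < r" by simp
      have "(\<Sum>s\<in>{r..<n}. (\<sigma> t * ip n (u t) (v s))\<^sup>2)
          \<le> (\<Sum>s\<in>{r..<n}. 2 * ((real r + 1) * \<tau>\<^sup>2) * (ip n (v s) (u t))\<^sup>2 + 2 * (ip n (v s) (mv n B (u t)))\<^sup>2)"
      proof (intro sum_mono)
        fix s assume s: "s \<in> {r..<n}"
        have e: "\<sigma> t * ip n (u t) (v s) = l s * ip n (v s) (u t) - ip n (v s) (mv n B (u t))"
        proof -
          have "ip n (u t) (mv n B (v s)) = ip n (v s) (mv n B (u t))" by (rule ip_mv_commute) (rule sym)
          then show ?thesis using u_eig[OF t, of s] s by (simp add: ip_commute[of n "u t" "v s"])
        qed
        have "(\<sigma> t * ip n (u t) (v s))\<^sup>2 \<le> 2 * (l s * ip n (v s) (u t))\<^sup>2 + 2 * (ip n (v s) (mv n B (u t)))\<^sup>2"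
          unfolding e
          using zero_le_power2[of "l s * ip n (v s) (u t) + ip n (v s) (mv n B (u t))"]
          by (simp add: power2_eq_square algebra_simps)
        moreover have "(l s * ip n (v s) (u t))\<^sup>2 \<le> ((real r + 1) * \<tau>\<^sup>2) * (ip n (v s) (u t))\<^sup>2"
          unfolding power_mult_distrib using l_tail[of s] s by (intro mult_right_mono) auto
        ultimately show "(\<sigma> t * ip n (u t) (v s))\<^sup>2 \<le> 2 * ((real r + 1) * \<tau>\<^sup>2) * (ip n (v s) (u t))\<^sup>2 + 2 * (ip n (v s) (mv n B (u t)))\<^sup>2"
          by linarith
      qed
      also have "\<dots> \<le> (\<Sum>s<n. 2 * ((real r + 1) * \<tau>\<^sup>2) * (ip n (v s) (u t))\<^sup>2 + 2 * (ip n (v s) (mv n B (u t)))\<^sup>2)"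
        by (rule sum_mono2) auto
      also have "\<dots> = 2 * ((real r + 1) * \<tau>\<^sup>2) * (\<Sum>s<n. (ip n (v s) (u t))\<^sup>2) + 2 * (\<Sum>s<n. (ip n (v s) (mv n B (u t)))\<^sup>2)"
        by (simp add: sum.distrib sum_distrib_left)
      also have "\<dots> \<le> 2 * ((real r + 1) * \<tau>\<^sup>2) * 1 + 2 * \<tau>\<^sup>2"
        using bessel[OF v, of n "u t"] bessel[OF v, of n "mv n B (u t)"] op[of "u t"] u1[OF t]
        by (intro add_mono mult_left_mono) auto
      finally show "(\<Sum>s\<in>{r..<n}. (\<sigma> t * ip n (u t) (v s))\<^sup>2) \<le> (2 * real r + 4) * \<tau>\<^sup>2"
        by (simp add: algebra_simps)
    qed
    finally show ?thesis by simp
  qed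
  have "(\<Sum>j<n. \<Sum>k<n. (D j k)\<^sup>2) = (\<Sum>s<n. sqn n (mv n D (v s)))"
  proof -
    have "(\<Sum>k<n. (D j k)\<^sup>2) = (\<Sum>s<n. (mv n D (v s) j)\<^sup>2)" for j
    proof -
      have "(\<Sum>s<n. (mv n D (v s) j)\<^sup>2) = (\<Sum>k<n. \<Sum>k'<n. (\<Sum>s<n. v s k * v s k') * D j k * D j k')"
        unfolding mv_def using sum_square_linear[of v "D j" "{..<n}" "{..<n}"] by (simp add: mult.commute)
      also have "\<dots> = (\<Sum>k<n. \<Sum>k'<n. if k' = k then D j k * D j k' else 0)"
        using orthonormal_basis_complete[of n v, OF v] by (intro sum.cong refl) auto
      finally show ?thesis by (simp add: power2_eq_square)
    qed
    then have "(\<Sum>j<n. \<Sum>k<n. (D j k)\<^sup>2) = (\<Sum>j<n. \<Sum>s<n. (mv n D (v s) j)\<^sup>2)" by simp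
    also have "\<dots> = (\<Sum>s<n. sqn n (mv n D (v s)))" unfolding sqn_def by (rule sum.swap)
    finally show ?thesis .
  qed
  also have "\<dots> = (\<Sum>s<r. sqn n (mv n D (v s))) + (\<Sum>s\<in>{r..<n}. sqn n (mv n D (v s)))"
    using r sum.atLeastLessThan_concat[of 0 r n "\<lambda>s. sqn n (mv n D (v s))"] by (simp add: atLeast0LessThan)
  also have "\<dots> \<le> (\<Sum>s<r. 10 * \<tau>\<^sup>2) + real r * ((2 * real r + 4) * \<tau>\<^sup>2)"
    using head tail by (intro add_mono sum_mono) auto
  also have "\<dots> = (14 * real r + 2 * (real r)\<^sup>2) * \<tau>\<^sup>2" by (simp add: algebra_simps power2_eq_square)
  also have "\<dots> \<le> 16 * (real r)\<^sup>2 * \<tau>\<^sup>2"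
  proof (rule mult_right_mono)
    have "real r * 1 \<le> real r * real r" using r by (intro mult_left_mono) auto
    then show "14 * real r + 2 * (real r)\<^sup>2 \<le> 16 * (real r)\<^sup>2" by (simp add: power2_eq_square)
  qed simp
  finally show ?thesis by (simp add: D_def)
qed

section \<open>Concentration of the surrogate matrix and closeness of the initial value\<close>

lemma goe_var_symmetric:
  assumes "\<And>j k. j < n \<Longrightarrow> k < n \<Longrightarrow> M j k = M k j"
  shows "goe_var n M = 2 * (\<Sum>j<n. \<Sum>k<n. (M j k)\<^sup>2)"
proof -
  have "goe_var n M = (\<Sum>j<n. \<Sum>k<n. 2 * (M j k)\<^sup>2)"
    unfolding goe_var_def using assms by (intro sum.cong refl) (simp add: power2_eq_square)
  then show ?thesis by (simp add: sum_distrib_left)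
qed

text \<open>The sums of squares for \<open>X + f h h\<^sup>T\<close> and
  \<open>X - f h h\<^sup>T\<close> differ by 4 f times the mixed sum, and their expectations by
  \<open>8 * f * m * bil n X h h\<close>. The weight \<open>f\<close>, the Frobenius norm of
  \<open>X\<close>, gives both parts the same size: the variances add up to at most
  \<open>8 * f\<^sup>2\<close>, and division by \<open>8 * f * m\<close> leaves
  \<open>t * f\<close>.\<close>

lemma surrogate_form_bound:
  fixes X :: "nat \<Rightarrow> nat \<Rightarrow> real" and f t :: real
  assumes m: "m > 0" and f: "f > 0" "f\<^sup>2 = (\<Sum>j<n. \<Sum>k<n. (X j k)\<^sup>2)" and t: "t > 0"
    and sym: "\<And>j k. X j k = X k j" and h: "sqn n h \<le> 1"
    and conc: "concentrated n m a t (\<lambda>j k. X j k + f * (h j * h k))" "concentrated n m a t (\<lambda>j k. X j k - f * (h j * h k))"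
  shows "\<bar>(\<Sum>i<m. mat_ip n (a i) X * bil n (a i) h h) / (2 * real m) - bil n X h h\<bar> \<le> t * f"
proof -
  define b where "b i = mat_ip n (a i) X" for i
  define q where "q i = bil n (a i) h h" for i
  let ?gp = "goe_var n (\<lambda>j k. X j k + f * (h j * h k))" and ?gm = "goe_var n (\<lambda>j k. X j k - f * (h j * h k))"
  let ?x = "bil n X h h"
  have hh: "(\<Sum>j<n. \<Sum>k<n. (h j * h k)\<^sup>2) = (sqn n h)\<^sup>2"
    by (simp add: sqn_def power2_eq_square sum_product mult_ac)
  have Xh: "(\<Sum>j<n. \<Sum>k<n. X j k * (h j * h k)) = ?x"
    by (simp add: bil_def mult_ac)
  have sq: "(\<Sum>j<n. \<Sum>k<n. (X j k + c * (h j * h k))\<^sup>2) = f\<^sup>2 + 2 * c * ?x + c\<^sup>2 * (sqn n h)\<^sup>2" for c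
  proof -
    have "(\<Sum>j<n. \<Sum>k<n. (X j k + c * (h j * h k))\<^sup>2)
        = (\<Sum>j<n. \<Sum>k<n. (X j k)\<^sup>2 + 2 * c * (X j k * (h j * h k)) + c\<^sup>2 * (h j * h k)\<^sup>2)"
      by (intro sum.cong refl) (simp add: power2_eq_square algebra_simps)
    then show ?thesis by (simp only: sum.distrib sum_distrib_left[symmetric] hh Xh f(2))
  qed
  have gp: "?gp = 2 * (f\<^sup>2 + 2 * f * ?x + f\<^sup>2 * (sqn n h)\<^sup>2)"
  proof -
    have "?gp = 2 * (\<Sum>j<n. \<Sum>k<n. (X j k + f * (h j * h k))\<^sup>2)"
    proof (rule goe_var_symmetric)
      fix j k show "X j k + f * (h j * h k) = X k j + f * (h k * h j)" using sym[of j k] by simp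
    qed
    then show ?thesis using sq[of f] by simp
  qed
  have gm: "?gm = 2 * (f\<^sup>2 - 2 * f * ?x + f\<^sup>2 * (sqn n h)\<^sup>2)"
  proof -
    have "?gm = 2 * (\<Sum>j<n. \<Sum>k<n. (X j k - f * (h j * h k))\<^sup>2)"
    proof (rule goe_var_symmetric)
      fix j k show "X j k - f * (h j * h k) = X k j - f * (h k * h j)" using sym[of j k] by simp
    qed
    then show ?thesis using sq[of "- f"] by simp
  qed
  have "(sqn n h)\<^sup>2 \<le> 1" using h by (simp add: power_le_one)
  then have "f\<^sup>2 * (sqn n h)\<^sup>2 \<le> f\<^sup>2 * 1" by (rule mult_left_mono) simp
  then have g_sum: "?gp + ?gm \<le> 8 * f\<^sup>2" unfolding gp gm by simp
  have lp: "mat_ip n (a i) (\<lambda>j k. X j k + c * (h j * h k)) = b i + c * q i" for i c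
  proof -
    have "mat_ip n (a i) (\<lambda>j k. X j k + c * (h j * h k)) = b i + (\<Sum>j<n. \<Sum>k<n. c * (h j * a i j k * h k))"
      by (simp add: mat_ip_def b_def distrib_left sum.distrib mult_ac)
    then show ?thesis by (simp add: q_def bil_def sum_distrib_left)
  qed
  have lm: "mat_ip n (a i) (\<lambda>j k. X j k - f * (h j * h k)) = b i - f * q i" for i
    using lp[of i "- f"] by simp
  let ?P = "\<Sum>i<m. (b i + f * q i)\<^sup>2" and ?M = "\<Sum>i<m. (b i - f * q i)\<^sup>2"
  have c1: "\<bar>?P - real m * ?gp\<bar> \<le> t * (real m * ?gp)" and c2: "\<bar>?M - real m * ?gm\<bar> \<le> t * (real m * ?gm)"
    using conc unfolding concentrated_def lp lm by simp_all
  have PM: "?P - ?M = 4 * f * (\<Sum>i<m. b i * q i)"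
    unfolding sum_subtractf[symmetric] sum_distrib_left
    by (intro sum.cong refl) (simp add: power2_eq_square algebra_simps)
  have gd: "real m * ?gp - real m * ?gm = 8 * f * real m * ?x" unfolding gp gm by (simp add: algebra_simps)
  have "t * (real m * ?gp) + t * (real m * ?gm) = t * real m * (?gp + ?gm)" by (simp add: algebra_simps)
  also have "\<dots> \<le> t * real m * (8 * f\<^sup>2)" using g_sum t by (intro mult_left_mono) auto
  finally have "\<bar>(?P - ?M) - (real m * ?gp - real m * ?gm)\<bar> \<le> t * real m * (8 * f\<^sup>2)"
    using c1 c2 by linarith
  then have "\<bar>4 * f * (\<Sum>i<m. b i * q i) - 8 * f * real m * ?x\<bar> \<le> t * real m * (8 * f\<^sup>2)"
    by (simp only: PM gd)
  also have "4 * f * (\<Sum>i<m. b i * q i) - 8 * f * real m * ?x = 8 * f * real m * ((\<Sum>i<m. b i * q i) / (2 * real m) - ?x)"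
    using m by (simp add: field_simps)
  also have "\<bar>\<dots>\<bar> = 8 * f * real m * \<bar>(\<Sum>i<m. b i * q i) / (2 * real m) - ?x\<bar>"
    using f by (simp add: abs_mult)
  also have "t * real m * (8 * f\<^sup>2) = 8 * f * real m * (t * f)" by (simp add: power2_eq_square)
  finally show ?thesis using f m by (simp add: b_def q_def)
qed

context low_rank
begin

text \<open>The entries of \<open>X\<close> as a function of indices. The formula is symmetric at
  all indices, also beyond the matrix, as the polarization lemma requires.\<close>

definition "Xf = (\<lambda>j k. \<Sum>s<r. \<sigma> s * colfun U s j * colfun U s k)"

lemma outer_Zs: "j < n \<Longrightarrow> k < n \<Longrightarrow> outer r (colfun Zs) (colfun Zs) j k = Xf j k"
  unfolding outer_def Xf_def using \<sigma>_pos
  by (intro sum.cong refl) (simp add: Zs_entry less_imp_le)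

lemma Xf_commute: "Xf j k = Xf k j"
  by (simp add: Xf_def mult_ac)

lemma Xf_square: "(\<Sum>j<n. \<Sum>k<n. (Xf j k)\<^sup>2) = (\<Sum>s<r. (\<sigma> s)\<^sup>2)"
proof -
  have "(\<Sum>j<n. \<Sum>k<n. (Xf j k)\<^sup>2) = (\<Sum>j<n. \<Sum>k<n. outer r (colfun Zs) (colfun Zs) j k * outer r (colfun Zs) (colfun Zs) j k)"
    by (intro sum.cong refl) (simp add: outer_Zs power2_eq_square)
  also have "\<dots> = (\<Sum>s<r. \<Sum>t<r. if t = s then (\<sigma> s)\<^sup>2 else 0)"
    unfolding sum_outer_product by (intro sum.cong refl) (simp add: Zs_ip power2_eq_square)
  finally show ?thesis by simp
qed

lemma measurement_mat_ip:
  assumes "A i \<in> carrier_mat n n"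
  shows "measurement A X i = mat_ip n (\<lambda>j k. A i $$ (j, k)) Xf"
proof -
  have "measurement A X i = mat_ip n (\<lambda>j k. A i $$ (j, k)) (outer r (colfun Zs) (colfun Zs))"
    by (simp add: measurement_tbil[of A i, OF assms] mat_ip_outer_sum)
  also have "\<dots> = mat_ip n (\<lambda>j k. A i $$ (j, k)) Xf"
    unfolding mat_ip_def by (intro sum.cong refl) (simp add: outer_Zs)
  finally show ?thesis .
qed

text \<open>The value of \<open>t\<close> is chosen for the truncation error: with
  \<open>\<tau> = 6/5 * t * f\<close> and \<open>f\<^sup>2 \<le> r * (\<sigma> 0)\<^sup>2\<close>
  the error \<open>16 * r\<^sup>2 * \<tau>\<^sup>2\<close> is at most
  \<open>9/100 * (\<sigma> (r - 1))\<^sup>2\<close>. The factor distance bound turns this into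
  \<open>9/80 * \<sigma> (r - 1)\<close>, within the required 3/16.\<close>

lemma spectral_init_close:
  assumes m: "m > 0" and A: "\<And>i. i < m \<Longrightarrow> A i \<in> carrier_mat n n \<and> (A i)\<^sup>T = A i"
    and \<kappa>: "\<kappa> = \<sigma> 0 / \<sigma> (r - 1)"
    and f: "f = sqrt (\<Sum>s<r. (\<sigma> s)\<^sup>2)" and t: "t = 1 / (16 * \<kappa> * sqrt (real r ^ 3))"
    and conc: "\<And>h. h \<in> ball_grid {..<n} n \<Longrightarrow> concentrated n m (\<lambda>i j k. A i $$ (j, k)) t (\<lambda>j k. Xf j k + f * (h j * h k))"
      "\<And>h. h \<in> ball_grid {..<n} n \<Longrightarrow> concentrated n m (\<lambda>i j k. A i $$ (j, k)) t (\<lambda>j k. Xf j k - f * (h j * h k))"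
    and init: "spectral_init n r m A (measurement A X) Z0"
  shows "proc_dist r Z0 Zs \<le> sqrt (3 / 16 * \<sigma> (r - 1))"
proof -
  define a where "a = (\<lambda>i j k. A i $$ (j, k))"
  \<comment> \<open>Half of the surrogate matrix, since the mean of \<langle>A, X\<rangle> A is 2 X
    for a GOE matrix. This is also why eigenvalues are halved in the initial value.\<close>
  define N where "N j k = (\<Sum>i<m. mat_ip n (a i) Xf * a i j k) / (2 * real m)" for j k
  define B where "B j k = N j k - Xf j k" for j k
  have n: "n \<ge> 1" using r r_le_n by simp
  have sym: "a i j k = a i k j" if "i < m" "j < n" "k < n" for i j k
    using A[OF that(1)] that unfolding a_def by (metis carrier_matD index_transpose_mat(1))
  have Bsym: "B j k = B k j" if "j < n" "k < n" for j k
    unfolding B_def N_def using sym that by (simp add: Xf_commute[of j k])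
  have b: "measurement A X i = mat_ip n (a i) Xf" if "i < m" for i
    unfolding a_def by (rule measurement_mat_ip[of A i]) (use A that in blast)
  have s2: "(\<Sum>s<r. (\<sigma> s)\<^sup>2) > 0"
    using r \<sigma>_pos by (intro sum_pos) (auto simp: less_imp_neq[symmetric] Suc_le_eq)
  then have fpos: "f > 0" and f2: "f\<^sup>2 = (\<Sum>s<r. (\<sigma> s)\<^sup>2)" by (simp_all add: f)
  have \<kappa>pos: "\<kappa> > 0" using \<sigma>_bounds \<kappa> by simp
  have tpos: "t > 0" using \<kappa>pos r by (simp add: t)
  define \<tau> where "\<tau> = 6 / 5 * (t * f)"
  have \<tau>: "\<tau> > 0" using tpos fpos by (simp add: \<tau>_def)
  have bilB: "bil n B h h = (\<Sum>i<m. mat_ip n (a i) Xf * bil n (a i) h h) / (2 * real m) - bil n Xf h h" for h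
  proof -
    have "bil n N h h = (\<Sum>j<n. \<Sum>k<n. \<Sum>i<m. mat_ip n (a i) Xf * (h j * a i j k * h k) / (2 * real m))"
      unfolding bil_def N_def by (simp add: sum_distrib_left sum_distrib_right sum_divide_distrib mult_ac)
    also have "\<dots> = (\<Sum>j<n. \<Sum>i<m. \<Sum>k<n. mat_ip n (a i) Xf * (h j * a i j k * h k) / (2 * real m))"
      by (intro sum.cong refl sum.swap)
    also have "\<dots> = (\<Sum>i<m. \<Sum>j<n. \<Sum>k<n. mat_ip n (a i) Xf * (h j * a i j k * h k) / (2 * real m))"
      by (rule sum.swap)
    also have "\<dots> = (\<Sum>i<m. mat_ip n (a i) Xf * bil n (a i) h h) / (2 * real m)"
      by (simp add: bil_def sum_distrib_left sum_divide_distrib)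
    finally show ?thesis unfolding B_def bil_def[of n "\<lambda>j k. N j k - Xf j k"]
      by (simp add: bil_def[of n N] bil_def[of n Xf] right_diff_distrib left_diff_distrib sum_subtractf)
  qed
  have form: "\<bar>bil n B x x\<bar> \<le> \<tau> * sqn n x" for x
  proof -
    have "\<bar>\<Sum>j<n. \<Sum>k<n. B j k * x j * x k\<bar> \<le> 6 / 5 * (t * f) * (\<Sum>j<n. (x j)\<^sup>2)"
    proof (rule quadratic_form_grid_bound[where N = n])
      show "card {..<n} \<le> n\<^sup>2" by (simp add: power2_eq_square)
      fix h :: "nat \<Rightarrow> real" assume h: "h \<in> ball_grid {..<n} n"
      then have "sqn n h \<le> 1" by (simp add: ball_grid_def sqn_def)
      then have "\<bar>bil n B h h\<bar> \<le> t * f"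
        unfolding bilB using conc[OF h]
        by (intro surrogate_form_bound m fpos tpos Xf_commute) (simp_all add: f2 Xf_square a_def)
      then show "\<bar>\<Sum>j<n. \<Sum>k<n. B j k * h j * h k\<bar> \<le> t * f"
        by (simp add: bil_def mult_ac)
    qed (use n Bsym in auto)
    then show ?thesis by (simp add: \<tau>_def sqn_def bil_def mult_ac)
  qed
  have op: "sqn n (mv n B x) \<le> \<tau>\<^sup>2 * sqn n x" for x
    by (rule sqn_mv_le[OF Bsym \<tau> form])
  obtain v l where vl: "\<forall>s<n. eigenvector (surrogate n m A (measurement A X)) (v s) (l s)"
    "\<forall>s<n. \<forall>t<n. scalar_prod (v s) (v t) = (if s = t then 1 else 0)"
    "\<forall>s t. s \<le> t \<and> t < n \<longrightarrow> \<bar>l t\<bar> \<le> \<bar>l s\<bar>"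
    and Z0: "Z0 = mat_of_cols n (map (\<lambda>s. sqrt (\<bar>l s\<bar> / 2) \<cdot>\<^sub>v v s) [0..<r])"
    using init unfolding spectral_init_def by (elim exE conjE) (rule that)
  have eig: "eigenvector (surrogate n m A (measurement A X)) (v s) (l s)" if "s < n" for s
    using vl(1) that by simp
  have orth: "scalar_prod (v s) (v t) = (if s = t then 1 else 0)" if "s < n" "t < n" for s t
    using vl(2) that by simp
  have mono: "\<bar>l t\<bar> \<le> \<bar>l s\<bar>" if "s \<le> t" "t < n" for s t
    using vl(3) that by simp
  have vc: "v s \<in> carrier_vec n" if "s < n" for s
    using eig[OF that] by (simp add: eigenvector_def surrogate_def)
  define w where "w s j = v s $ j" for s j
  have worth: "ip n (w s) (w t) = (if s = t then 1 else 0)" if "s < n" "t < n" for s t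
    using orth[OF that] vc[OF that(2)] by (simp add: ip_def w_def scalar_prod_def atLeast0LessThan)
  have weig: "mv n Xf (w s) j + mv n B (w s) j = l s / 2 * w s j" if s: "s < n" and j: "j < n" for s j
  proof -
    have "(surrogate n m A (measurement A X) *\<^sub>v v s) $ j = l s * w s j"
      using eig[OF s] vc[OF s] j by (simp add: eigenvector_def w_def)
    moreover have "(surrogate n m A (measurement A X) *\<^sub>v v s) $ j = (\<Sum>k<n. surrogate n m A (measurement A X) $$ (j, k) * w s k)"
      using vc[OF s] j by (simp add: surrogate_def w_def scalar_prod_def atLeast0LessThan)
    moreover have "surrogate n m A (measurement A X) $$ (j, k) = 2 * N j k" if "k < n" for k
      using j that b by (simp add: surrogate_def N_def a_def)
    ultimately have "(\<Sum>k<n. 2 * N j k * w s k) = l s * w s j" by simp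
    moreover have "mv n Xf (w s) j + mv n B (w s) j = (\<Sum>k<n. N j k * w s k)"
      by (simp add: mv_def B_def sum.distrib[symmetric] left_diff_distrib)
    ultimately show ?thesis by (simp add: sum_distrib_left[symmetric] mult.assoc)
  qed
  have Z0c: "Z0 \<in> carrier_mat n r" by (simp add: Z0 mat_of_cols_def)
  have Z0e: "colfun Z0 s j = sqrt (\<bar>l s\<bar> / 2) * w s j" if "s < r" "j < n" for s j
  proof -
    have "v s \<in> carrier_vec n" using vc that r_le_n by simp
    then show ?thesis using that by (simp add: colfun_def Z0 mat_of_cols_def w_def)
  qed
  have err: "(\<Sum>j<n. \<Sum>k<n. (outer r (colfun Z0) (colfun Z0) j k - Xf j k)\<^sup>2) \<le> 16 * (real r)\<^sup>2 * \<tau>\<^sup>2"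
  proof -
    have "outer r (colfun Z0) (colfun Z0) j k = (\<Sum>s<r. \<bar>l s / 2\<bar> * w s j * w s k)" if "j < n" "k < n" for j k
      unfolding outer_def
    proof (intro sum.cong refl)
      fix s assume "s \<in> {..<r}"
      then have "colfun Z0 s j * colfun Z0 s k = (sqrt (\<bar>l s\<bar> / 2) * sqrt (\<bar>l s\<bar> / 2)) * w s j * w s k"
        using that by (simp only: Z0e lessThan_iff mult_ac)
      also have "sqrt (\<bar>l s\<bar> / 2) * sqrt (\<bar>l s\<bar> / 2) = \<bar>l s / 2\<bar>" by (simp only: real_sqrt_mult_self)
      finally show "colfun Z0 s j * colfun Z0 s k = \<bar>l s / 2\<bar> * w s j * w s k" .
    qed
    moreover have "(\<Sum>j<n. \<Sum>k<n. ((\<Sum>s<r. \<bar>l s / 2\<bar> * w s j * w s k) - Xf j k)\<^sup>2) \<le> 16 * (real r)\<^sup>2 * \<tau>\<^sup>2"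
      unfolding Xf_def
    proof (rule spectral_truncation_error[where B = B])
      show "mv n (\<lambda>j k. \<Sum>s<r. \<sigma> s * colfun U s j * colfun U s k) (w s) j + mv n B (w s) j = l s / 2 * w s j" if "s < n" "j < n" for s j
        using weig[OF that] by (simp add: Xf_def)
    qed (use U_orthonormal worth r r_le_n \<sigma>_pos \<tau> Bsym op mono in \<open>auto simp: less_imp_le\<close>)
    ultimately show ?thesis by simp
  qed
  obtain Q where Q: "Q \<in> ortho r" "proc_dist r Z0 Zs = frob_norm (Z0 - Zs * Q)"
    and dQ: "proc_dist r Z0 Zs = frob_norm (Z0 * Q\<^sup>T - Zs)"
    and Qsym: "\<And>s q. s < r \<Longrightarrow> q < r \<Longrightarrow> ip n (colfun (Z0 * Q\<^sup>T) s) (colfun Zs q) = ip n (colfun (Z0 * Q\<^sup>T) q) (colfun Zs s)"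
    and Qpsd: "\<And>v. 0 \<le> (\<Sum>s<r. \<Sum>q<r. ip n (colfun (Z0 * Q\<^sup>T) s) (colfun Zs q) * v s * v q)"
    by (rule proc_dist_aligned[OF Z0c Zs_carrier]) (rule that)
  define Y where "Y = Z0 * Q\<^sup>T"
  have c: "Q \<in> carrier_mat r r" "Q\<^sup>T \<in> carrier_mat r r" "Q\<^sup>T * Q = 1\<^sub>m r" using Q by (auto simp: ortho_def)
  have Y: "Y \<in> carrier_mat n r" using Z0c c by (simp add: Y_def)
  \<comment> \<open>Aligning \<open>Z0\<close> leaves \<open>Z0 Z0\<^sup>T\<close> unchanged, so the
    spectral estimate carries over to the aligned factor.\<close>
  have outerY: "outer r (colfun Y) (colfun Y) j k = outer r (colfun Z0) (colfun Z0) j k" if jk: "j < n" "k < n" for j k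
  proof -
    have Ye: "colfun Y q j = (\<Sum>s<r. colfun Z0 s j * Q $$ (q, s))" if "q < r" "j < n" for q j
      unfolding Y_def colfun_def by (rule index_mult_transpose[OF Z0c c(1) that(2) that(1)])
    have QQ: "(\<Sum>q<r. Q $$ (q, s) * Q $$ (q, t)) = (if s = t then 1 else 0)" if "s < r" "t < r" for s t
    proof -
      have "(Q\<^sup>T * Q) $$ (s, t) = (\<Sum>q<r. Q $$ (q, s) * Q $$ (q, t))"
        using c(1) that by (simp add: scalar_prod_def atLeast0LessThan)
      then show ?thesis using c(3) that by simp
    qed
    have "outer r (colfun Y) (colfun Y) j k = (\<Sum>q<r. \<Sum>s<r. \<Sum>t<r. colfun Z0 s j * colfun Z0 t k * (Q $$ (q, s) * Q $$ (q, t)))"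
      unfolding outer_def using jk by (intro sum.cong refl) (simp add: Ye sum_product mult_ac)
    also have "\<dots> = (\<Sum>s<r. \<Sum>q<r. \<Sum>t<r. colfun Z0 s j * colfun Z0 t k * (Q $$ (q, s) * Q $$ (q, t)))"
      by (rule sum.swap)
    also have "\<dots> = (\<Sum>s<r. \<Sum>t<r. \<Sum>q<r. colfun Z0 s j * colfun Z0 t k * (Q $$ (q, s) * Q $$ (q, t)))"
      by (intro sum.cong refl sum.swap)
    also have "\<dots> = (\<Sum>s<r. \<Sum>t<r. if t = s then colfun Z0 s j * colfun Z0 t k else 0)"
      unfolding sum_distrib_left[symmetric] using QQ by (intro sum.cong refl) auto
    finally show ?thesis by (simp add: outer_def)
  qed
  have "4 / 5 * \<sigma> (r - 1) * fsq n r (\<lambda>q j. colfun Y q j - colfun Zs q j)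
      \<le> (\<Sum>j<n. \<Sum>k<n. (outer r (colfun Y) (colfun Y) j k - outer r (colfun Zs) (colfun Zs) j k)\<^sup>2)"
    by (rule factor_distance_bound[where \<sigma> = \<sigma>]) (use Zs_ip \<sigma>_bounds Qsym Qpsd in \<open>auto simp: Y_def\<close>)
  also have "\<dots> = (\<Sum>j<n. \<Sum>k<n. (outer r (colfun Z0) (colfun Z0) j k - Xf j k)\<^sup>2)"
    by (intro sum.cong refl) (simp add: outerY outer_Zs)
  also note err
  also have "16 * (real r)\<^sup>2 * \<tau>\<^sup>2 \<le> 9 / 100 * (\<sigma> (r - 1))\<^sup>2"
  proof -
    have "(\<Sum>s<r. (\<sigma> s)\<^sup>2) \<le> (\<Sum>s<r. (\<sigma> 0)\<^sup>2)"
      using \<sigma>_bounds(2) \<sigma>_pos by (intro sum_mono power_mono) (auto simp: less_imp_le)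
    then have "f\<^sup>2 \<le> real r * (\<sigma> 0)\<^sup>2" by (simp add: f2)
    then have le: "16 * (real r)\<^sup>2 * (36 / 25 * (t\<^sup>2 * f\<^sup>2)) \<le> 16 * (real r)\<^sup>2 * (36 / 25 * (t\<^sup>2 * (real r * (\<sigma> 0)\<^sup>2)))"
      by (intro mult_left_mono) auto
    have t2: "t\<^sup>2 = 1 / (256 * \<kappa>\<^sup>2 * real r ^ 3)"
      by (simp add: t power_mult_distrib power_divide)
    have s0: "\<sigma> 0 = \<kappa> * \<sigma> (r - 1)" using \<kappa> \<sigma>_bounds(3) by simp
    have "16 * R\<^sup>2 * (36 / 25 * (1 / (256 * k\<^sup>2 * R ^ 3) * (R * (k * S)\<^sup>2))) = 9 / 100 * S\<^sup>2"
      if "k > 0" "R > 0" for k R S :: real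
      using that by (simp add: power2_eq_square power3_eq_cube field_simps)
    from this[OF \<kappa>pos, of "real r" "\<sigma> (r - 1)"] r
    have "16 * (real r)\<^sup>2 * (36 / 25 * (t\<^sup>2 * (real r * (\<sigma> 0)\<^sup>2))) = 9 / 100 * (\<sigma> (r - 1))\<^sup>2"
      unfolding t2 s0 by simp
    moreover have "16 * (real r)\<^sup>2 * \<tau>\<^sup>2 = 16 * (real r)\<^sup>2 * (36 / 25 * (t\<^sup>2 * f\<^sup>2))"
      by (simp add: \<tau>_def power_mult_distrib power_divide)
    ultimately show ?thesis using le by linarith
  qed
  finally have "4 / 5 * \<sigma> (r - 1) * fsq n r (\<lambda>q j. colfun Y q j - colfun Zs q j) \<le> \<sigma> (r - 1) * (9 / 100 * \<sigma> (r - 1))"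
    by (simp add: power2_eq_square mult_ac)
  then have "\<sigma> (r - 1) * (4 / 5 * fsq n r (\<lambda>q j. colfun Y q j - colfun Zs q j)) \<le> \<sigma> (r - 1) * (9 / 100 * \<sigma> (r - 1))"
    by (simp only: mult_ac)
  then have "4 / 5 * fsq n r (\<lambda>q j. colfun Y q j - colfun Zs q j) \<le> 9 / 100 * \<sigma> (r - 1)"
    using \<sigma>_bounds(3) by (simp only: mult_le_cancel_left_pos)
  then have "fsq n r (\<lambda>q j. colfun Y q j - colfun Zs q j) \<le> 3 / 16 * \<sigma> (r - 1)"
    using \<sigma>_bounds(3) by linarith
  moreover have "fsq n r (colfun (Y - Zs)) = fsq n r (\<lambda>q j. colfun Y q j - colfun Zs q j)"
    using Y Zs_carrier by (intro fsq_cong) (auto simp: colfun_def)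
  ultimately show ?thesis
    using frob_norm_colfun[OF minus_carrier_mat[OF Zs_carrier, of Y]] dQ by (simp add: Y_def)
qed

end

section \<open>The main theorem\<close>

text \<open>For \<open>n \<ge> 2\<close> one has 33 \<le> \<open>n ^ 6\<close>, so the grid has at
  most \<open>exp (7 * D * ln n)\<close> points up to the factor 2. The exponent
  \<open>8 * D * ln n\<close> leaves \<open>exp (- D * ln n)\<close>, at most
  \<open>1 / n\<close>.\<close>

lemma grid_union_bound:
  assumes n: "n \<ge> 2" and D: "D \<ge> 1" and N: "N \<le> 2 * (33 * n) ^ D" and x: "x \<ge> 8 * real D * ln (real n)"
  shows "real N * (2 * exp (- x)) \<le> 4 * real n powr (- 1)"
proof -
  have ln0: "0 \<le> ln (real n)" using n by simp
  have "(2::nat) ^ 6 \<le> n ^ 6" using n by (intro power_mono) auto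
  then have "33 * n \<le> n ^ 6 * n" by (intro mult_right_mono) auto
  then have "real (33 * n) \<le> real (n ^ 7)" by (simp only: of_nat_le_iff power_Suc2[symmetric]) (simp add: eval_nat_numeral)
  then have "ln (real (33 * n)) \<le> ln (real (n ^ 7))" using n by (subst ln_le_cancel_iff) auto
  also have "\<dots> = 7 * ln (real n)" using n by (simp add: ln_realpow)
  finally have "ln (real (33 * n)) \<le> 7 * ln (real n)" .
  then have "real D * ln (real (33 * n)) \<le> real D * (7 * ln (real n))" by (intro mult_left_mono) auto
  moreover have "real ((33 * n) ^ D) = exp (real D * ln (real (33 * n)))" using n by (simp add: exp_of_nat_mult)
  ultimately have "real ((33 * n) ^ D) * exp (- x) \<le> exp (real D * (7 * ln (real n))) * exp (- (8 * real D * ln (real n)))"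
    using x by (intro mult_mono) auto
  also have "\<dots> = exp (- (real D * ln (real n)))" by (simp add: exp_add[symmetric] algebra_simps)
  also have "\<dots> \<le> exp (- ln (real n))"
    using D ln0 mult_right_mono[of 1 "real D" "ln (real n)"] by simp
  also have "\<dots> = real n powr (- 1)" using n by (simp add: powr_def)
  finally have "real ((33 * n) ^ D) * exp (- x) \<le> real n powr (- 1)" .
  moreover have "real N * (2 * exp (- x)) \<le> real (2 * (33 * n) ^ D) * (2 * exp (- x))"
    using N by (intro mult_right_mono) (simp_all only: of_nat_le_iff, simp)
  moreover have "real (2 * (33 * n) ^ D) * (2 * exp (- x)) = 4 * (real ((33 * n) ^ D) * exp (- x))" by simp
  ultimately show ?thesis by linarith
qed

lemma goe_mat_carrier: "goe_mat n \<omega> i \<in> carrier_mat n n" and goe_mat_sym: "(goe_mat n \<omega> i)\<^sup>T = goe_mat n \<omega> i"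
  by (auto simp: goe_mat_def min.commute max.commute)

lemma goe_form_eq_mat_ip: "goe_form n \<omega> M i = mat_ip n (\<lambda>j k. goe_mat n \<omega> i $$ (j, k)) M"
  unfolding goe_form_def mat_ip_def goe_mat_def by (intro sum.cong refl) simp

lemma goe_concentrated_event:
  assumes t: "0 < t" "t \<le> 2" and fin: "finite \<M>" and n: "n \<ge> 2" and D: "D \<ge> 1"
    and card: "card \<M> \<le> 2 * (33 * n) ^ D" and m: "real m * t\<^sup>2 / 16 \<ge> 8 * real D * ln (real n)"
  shows "\<exists>E\<in>sets (goe_space m n). measure (goe_space m n) E \<ge> 1 - 4 * real n powr (- 1) \<and>
    (\<forall>\<omega>\<in>E. \<forall>M\<in>\<M>. concentrated n m (\<lambda>i j k. goe_mat n \<omega> i $$ (j, k)) t M)"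
proof -
  obtain E where E: "E \<in> sets (goe_space m n)"
    "measure (goe_space m n) E \<ge> 1 - real (card \<M>) * (2 * exp (- (real m * t\<^sup>2 / 16)))"
    "\<forall>\<omega>\<in>E. \<forall>M\<in>\<M>. \<bar>(\<Sum>i<m. (goe_form n \<omega> M i)\<^sup>2) - real m * goe_var n M\<bar> \<le> t * (real m * goe_var n M)"
    using goe_form_uniform_concentration[OF t fin, of m n] by blast
  show ?thesis
    using E grid_union_bound[OF n D card m] by (intro bexI[of _ E]) (auto simp: concentrated_def goe_form_eq_mat_ip)
qed

context low_rank
begin

lemma \<kappa>_ge_1: "1 \<le> \<sigma> 0 / \<sigma> (r - 1)"
  using \<sigma>_bounds \<sigma>_mono[of 0 "r - 1"] r by simp

lemma spectral_init_event:
  assumes n: "n \<ge> 2" and \<kappa>: "\<kappa> = \<sigma> 0 / \<sigma> (r - 1)"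
    and m: "real m \<ge> 2 ^ 18 * \<kappa>\<^sup>2 * real r ^ 3 * real n * ln (real n)"
  shows "\<exists>E\<in>sets (goe_space m n). measure (goe_space m n) E \<ge> 1 - 4 * real n powr (- 1) \<and>
    (\<forall>\<omega>\<in>E. \<forall>Z0. spectral_init n r m (goe_mat n \<omega>) (measurement (goe_mat n \<omega>) X) Z0 \<longrightarrow>
      proc_dist r Z0 Zs \<le> sqrt (3 / 16 * \<sigma> (r - 1)))"
proof -
  define t where "t = 1 / (16 * \<kappa> * sqrt (real r ^ 3))"
  define f where "f = sqrt (\<Sum>s<r. (\<sigma> s)\<^sup>2)"
  let ?G = "ball_grid {..<n} n :: (nat \<Rightarrow> real) set"
  let ?p = "\<lambda>h j k. Xf j k + f * (h j * h k)" and ?m = "\<lambda>h j k. Xf j k - f * (h j * h k)"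
  define \<M> where "\<M> = ?p ` ?G \<union> ?m ` ?G"
  have \<kappa>1: "\<kappa> \<ge> 1" using \<kappa>_ge_1 \<kappa> by simp
  have ln: "ln (real n) > 0" using n by simp
  have K: "\<kappa>\<^sup>2 * real r ^ 3 > 0" using \<kappa>1 r by simp
  have "2 ^ 18 * (\<kappa>\<^sup>2 * real r ^ 3) * (real n * ln (real n)) > 0" using K ln n by simp
  then have mpos: "m > 0" using m by (auto simp: mult.assoc intro!: gr0I)
  have fin: "finite ?G" by (rule finite_ball_grid) simp
  have card: "card \<M> \<le> 2 * (33 * n) ^ n"
  proof -
    have "card \<M> \<le> card (?p ` ?G) + card (?m ` ?G)" unfolding \<M>_def by (rule card_Un_le)
    also have "\<dots> \<le> card ?G + card ?G" by (intro add_mono card_image_le fin)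
    finally show ?thesis using card_ball_grid[of "{..<n}" n] n by simp
  qed
  have t2: "t\<^sup>2 = 1 / (256 * (\<kappa>\<^sup>2 * real r ^ 3))"
    by (simp add: t_def power_mult_distrib power_divide)
  have tpos: "0 < t" using \<kappa>1 r by (simp add: t_def)
  have t_le: "t \<le> 2"
  proof -
    have "1 * 1 \<le> \<kappa>\<^sup>2 * real r ^ 3" using \<kappa>1 r by (intro mult_mono) auto
    then have "t\<^sup>2 \<le> 2\<^sup>2" unfolding t2 by (simp add: divide_le_eq)
    then show ?thesis by (rule power2_le_imp_le) simp
  qed
  \<comment> \<open>With this \<open>t\<close> the exponent is
    \<open>m / (2 ^ 12 * \<kappa>\<^sup>2 * r ^ 3)\<close>, so the sample size gives
    \<open>64 * n * ln n\<close>.\<close>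
  have "8 * real n * ln (real n) \<le> real m * t\<^sup>2 / 16"
  proof -
    have "2 ^ 18 * (\<kappa>\<^sup>2 * real r ^ 3) * (real n * ln (real n)) \<le> real m" using m by (simp add: mult.assoc)
    then have "2 ^ 18 * (\<kappa>\<^sup>2 * real r ^ 3) * (real n * ln (real n)) / (4096 * (\<kappa>\<^sup>2 * real r ^ 3)) \<le> real m / (4096 * (\<kappa>\<^sup>2 * real r ^ 3))"
      using K by (intro divide_right_mono) auto
    moreover have "2 ^ 18 * (\<kappa>\<^sup>2 * real r ^ 3) * (real n * ln (real n)) / (4096 * (\<kappa>\<^sup>2 * real r ^ 3)) = 64 * (real n * ln (real n))"
    proof -
      have "2 ^ 18 * k * x / (4096 * k) = 64 * x" if "k > 0" for k x :: real using that by simp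
      from this[OF K] show ?thesis .
    qed
    moreover have "real m * t\<^sup>2 / 16 = real m / (4096 * (\<kappa>\<^sup>2 * real r ^ 3))" by (simp add: t2)
    moreover have "0 \<le> real n * ln (real n)" using ln by simp
    ultimately show ?thesis by simp
  qed
  from goe_concentrated_event[OF tpos t_le _ n _ card this] fin n
  obtain E where E: "E \<in> sets (goe_space m n)" "measure (goe_space m n) E \<ge> 1 - 4 * real n powr (- 1)"
    and conc: "\<And>\<omega> M. \<omega> \<in> E \<Longrightarrow> M \<in> \<M> \<Longrightarrow> concentrated n m (\<lambda>i j k. goe_mat n \<omega> i $$ (j, k)) t M"
    unfolding \<M>_def by auto
  have "proc_dist r Z0 Zs \<le> sqrt (3 / 16 * \<sigma> (r - 1))"
    if "\<omega> \<in> E" "spectral_init n r m (goe_mat n \<omega>) (measurement (goe_mat n \<omega>) X) Z0" for \<omega> Z0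
  proof (rule spectral_init_close[OF mpos _ \<kappa> f_def t_def _ _ that(2)])
    show "concentrated n m (\<lambda>i j k. goe_mat n \<omega> i $$ (j, k)) t (?p h)" "concentrated n m (\<lambda>i j k. goe_mat n \<omega> i $$ (j, k)) t (?m h)" if "h \<in> ?G" for h
      using that by (auto intro!: conc[OF \<open>\<omega> \<in> E\<close>] simp: \<M>_def)
  qed (simp_all add: goe_mat_carrier goe_mat_sym)
  then show ?thesis using E by blast
qed

lemma gradient_descent_event:
  assumes n: "n \<ge> 2" and \<kappa>: "\<kappa> = \<sigma> 0 / \<sigma> (r - 1)"
    and m: "real m \<ge> 2 ^ 18 * \<kappa>\<^sup>2 * real r ^ 3 * real n * ln (real n)"
  shows "\<exists>E\<in>sets (goe_space m n). measure (goe_space m n) E \<ge> 1 - 4 * real n powr (- 1) \<and>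
    (\<forall>\<omega>\<in>E. \<forall>\<mu>. \<forall>Z0\<in>carrier_mat n r. \<forall>k. 0 < \<mu> \<longrightarrow> \<mu> \<le> 1 / 2000 / (\<kappa> * real n) \<longrightarrow>
      proc_dist r Z0 Zs \<le> sqrt (3 / 16 * \<sigma> (r - 1)) \<longrightarrow>
      proc_dist r (grad_descent m (goe_mat n \<omega>) (measurement (goe_mat n \<omega>) X) (\<mu> / (frob_norm Zs)\<^sup>2) Z0 k) Zs
        \<le> sqrt (3 / 16 * \<sigma> (r - 1)) * (1 - \<mu> / (12 * \<kappa> * real r)) powr (real k / 2))"
proof -
  let ?G = "ball_grid {..<n} n :: (nat \<Rightarrow> real) set" and ?H = "ball_grid ({..<n} \<times> {..<r}) n :: (nat \<times> nat \<Rightarrow> real) set"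
  let ?p = "\<lambda>(g, x) j k. g j * x k :: real" and ?q = "\<lambda>x. outer r (\<lambda>s j. x (j, s)) (colfun U)"
  define \<M> where "\<M> = ?p ` (?G \<times> ?G) \<union> ?q ` ?H"
  have \<kappa>1: "\<kappa> \<ge> 1" using \<kappa>_ge_1 \<kappa> by simp
  have ln: "ln (real n) > 0" using n by simp
  have fin: "finite ?G" "finite ?H" by (auto intro!: finite_ball_grid)
  have card: "card \<M> \<le> 2 * (33 * n) ^ (2 * n * r)"
  proof -
    have "card \<M> \<le> card (?p ` (?G \<times> ?G)) + card (?q ` ?H)" unfolding \<M>_def by (rule card_Un_le)
    also have "\<dots> \<le> card (?G \<times> ?G) + card ?H" using fin by (intro add_mono card_image_le) auto
    also have "card (?G \<times> ?G) \<le> (33 * n) ^ n * (33 * n) ^ n"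
      using card_ball_grid[of "{..<n}" n] n by (simp add: card_cartesian_product mult_mono)
    also have "\<dots> = (33 * n) ^ (2 * n)" by (simp only: power_add[symmetric] mult_2)
    also have "\<dots> \<le> (33 * n) ^ (2 * n * r)" using n r by (intro power_increasing) auto
    also have "card ?H \<le> (33 * n) ^ (n * r)"
      using card_ball_grid[of "{..<n} \<times> {..<r}" n] n by (simp add: card_cartesian_product)
    also have "\<dots> \<le> (33 * n) ^ (2 * n * r)" using n by (intro power_increasing) auto
    finally show ?thesis by simp
  qed
  have "1 * real r \<le> \<kappa>\<^sup>2 * real r ^ 3"
  proof (rule mult_mono)
    have "real r * 1 \<le> real r * (real r * real r)" using r by (intro mult_left_mono) (auto intro: mult_ge1_I)
    then show "real r \<le> real r ^ 3" by (simp add: power3_eq_cube mult.assoc)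
  qed (use \<kappa>1 in auto)
  then have "2 ^ 18 * (1 * real r) * (real n * ln (real n)) \<le> 2 ^ 18 * (\<kappa>\<^sup>2 * real r ^ 3) * (real n * ln (real n))"
    using ln by (intro mult_right_mono mult_left_mono) auto
  then have m': "2 ^ 18 * (real r * real n * ln (real n)) \<le> real m" using m by (simp add: mult_ac)
  have pos: "0 < real r * real n * ln (real n)" using r n ln by simp
  then have mpos: "m > 0" using m' by (auto intro!: gr0I)
  \<comment> \<open>The constant \<open>2 ^ 18\<close> is tight here: tolerance 1/32 makes the
    exponent \<open>m / 2 ^ 14\<close>, and the grid dimension \<open>2 * n * r\<close> asks for
    \<open>16 * n * r * ln n\<close>.\<close>
  have "8 * real (2 * n * r) * ln (real n) \<le> real m * (1 / 32)\<^sup>2 / 16"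
    using m' by (simp add: power2_eq_square mult_ac)
  from goe_concentrated_event[OF _ _ _ n _ card this] fin n r
  obtain E where E: "E \<in> sets (goe_space m n)" "measure (goe_space m n) E \<ge> 1 - 4 * real n powr (- 1)"
    and conc: "\<And>\<omega> M. \<omega> \<in> E \<Longrightarrow> M \<in> \<M> \<Longrightarrow> concentrated n m (\<lambda>i j k. goe_mat n \<omega> i $$ (j, k)) (1 / 32) M"
    unfolding \<M>_def by auto
  have "proc_dist r (grad_descent m (goe_mat n \<omega>) (measurement (goe_mat n \<omega>) X) (\<mu> / (frob_norm Zs)\<^sup>2) Z0 k) Zs
        \<le> sqrt (3 / 16 * \<sigma> (r - 1)) * (1 - \<mu> / (12 * \<kappa> * real r)) powr (real k / 2)"
    if \<omega>: "\<omega> \<in> E" and "Z0 \<in> carrier_mat n r" "0 < \<mu>" "\<mu> \<le> 1 / 2000 / (\<kappa> * real n)"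
      "proc_dist r Z0 Zs \<le> sqrt (3 / 16 * \<sigma> (r - 1))" for \<omega> \<mu> Z0 k
  proof (rule gradient_descent_converges[OF mpos _ _ _ that(2) that(5) \<kappa> that(3) that(4)])
    show "concentrated n m (\<lambda>i j k. goe_mat n \<omega> i $$ (j, k)) (1 / 32) (\<lambda>j k. g j * x k)" if "g \<in> ?G" "x \<in> ?G" for g x
      using that by (intro conc[OF \<omega>]) (auto simp: \<M>_def intro!: image_eqI[of _ _ "(g, x)"])
    show "concentrated n m (\<lambda>i j k. goe_mat n \<omega> i $$ (j, k)) (1 / 32) (?q x)" if "x \<in> ?H" for x
      using that by (intro conc[OF \<omega>]) (auto simp: \<M>_def)
  qed (simp_all add: goe_mat_carrier goe_mat_sym)
  then show ?thesis using E by blast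
qed

end

text \<open>The constants are \<open>c0 = 2 ^ 18\<close>, \<open>c1 = 1 / 2000\<close>,
  \<open>C = 4\<close> and \<open>p = 1\<close>. In the second half the event is chosen before the
  step size, the starting point and the iteration count, so the starting point may depend on the
  sample.\<close>

theorem theorem2:
  shows "\<exists>c0>0. \<exists>C>0. \<exists>p>0.
    (\<forall>n r m :: nat. \<forall>X U :: real mat. \<forall>\<sigma> :: nat \<Rightarrow> real. \<forall>\<kappa> :: real.
       r \<ge> 1 \<longrightarrow> sym_psd n X \<longrightarrow> mat_rank n X = r \<longrightarrow> eigendecomposition n r X U \<sigma> \<longrightarrow>
       \<kappa> = \<sigma> 0 / \<sigma> (r - 1) \<longrightarrow>
       real m \<ge> c0 * \<kappa>\<^sup>2 * real r ^ 3 * real n * ln (real n) \<longrightarrow>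
       (\<exists>E \<in> sets (goe_space m n).
          measure (goe_space m n) E \<ge> 1 - C * real n powr (- p) \<and>
          (\<forall>\<omega>\<in>E. \<forall>Z0.
             spectral_init n r m (goe_mat n \<omega>) (measurement (goe_mat n \<omega>) X) Z0 \<longrightarrow>
             proc_dist r Z0 (factor r U \<sigma>) \<le> sqrt (3 / 16 * \<sigma> (r - 1))))) \<and>
    (\<exists>c1>0.
      \<forall>n r m :: nat. \<forall>X U :: real mat. \<forall>\<sigma> :: nat \<Rightarrow> real. \<forall>\<kappa> :: real.
       r \<ge> 1 \<longrightarrow> sym_psd n X \<longrightarrow> mat_rank n X = r \<longrightarrow> eigendecomposition n r X U \<sigma> \<longrightarrow>
       \<kappa> = \<sigma> 0 / \<sigma> (r - 1) \<longrightarrow>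
       real m \<ge> c0 * \<kappa>\<^sup>2 * real r ^ 3 * real n * ln (real n) \<longrightarrow>
       (\<exists>E \<in> sets (goe_space m n).
          measure (goe_space m n) E \<ge> 1 - C * real n powr (- p) \<and>
          (\<forall>\<omega>\<in>E. \<forall>\<mu>. \<forall>Z0 \<in> carrier_mat n r. \<forall>k.
             0 < \<mu> \<longrightarrow> \<mu> \<le> c1 / (\<kappa> * real n) \<longrightarrow>
             proc_dist r Z0 (factor r U \<sigma>) \<le> sqrt (3 / 16 * \<sigma> (r - 1)) \<longrightarrow>
             proc_dist r
               (grad_descent m (goe_mat n \<omega>) (measurement (goe_mat n \<omega>) X)
                  (\<mu> / (frob_norm (factor r U \<sigma>))\<^sup>2) Z0 k)
               (factor r U \<sigma>)
             \<le> sqrt (3 / 16 * \<sigma> (r - 1)) * (1 - \<mu> / (12 * \<kappa> * real r)) powr (real k / 2))))"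
proof -
  let ?c0 = "2 ^ 18 :: real"
  have init: "\<exists>E \<in> sets (goe_space m n). measure (goe_space m n) E \<ge> 1 - 4 * real n powr (- 1) \<and>
      (\<forall>\<omega>\<in>E. \<forall>Z0. spectral_init n r m (goe_mat n \<omega>) (measurement (goe_mat n \<omega>) X) Z0 \<longrightarrow>
        proc_dist r Z0 (factor r U \<sigma>) \<le> sqrt (3 / 16 * \<sigma> (r - 1)))"
    and descent: "\<exists>E \<in> sets (goe_space m n). measure (goe_space m n) E \<ge> 1 - 4 * real n powr (- 1) \<and>
      (\<forall>\<omega>\<in>E. \<forall>\<mu>. \<forall>Z0 \<in> carrier_mat n r. \<forall>k. 0 < \<mu> \<longrightarrow> \<mu> \<le> 1 / 2000 / (\<kappa> * real n) \<longrightarrow>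
        proc_dist r Z0 (factor r U \<sigma>) \<le> sqrt (3 / 16 * \<sigma> (r - 1)) \<longrightarrow>
        proc_dist r (grad_descent m (goe_mat n \<omega>) (measurement (goe_mat n \<omega>) X) (\<mu> / (frob_norm (factor r U \<sigma>))\<^sup>2) Z0 k)
          (factor r U \<sigma>) \<le> sqrt (3 / 16 * \<sigma> (r - 1)) * (1 - \<mu> / (12 * \<kappa> * real r)) powr (real k / 2))"
    if "r \<ge> 1" "eigendecomposition n r X U \<sigma>" "\<kappa> = \<sigma> 0 / \<sigma> (r - 1)"
      and m: "real m \<ge> ?c0 * \<kappa>\<^sup>2 * real r ^ 3 * real n * ln (real n)"
    for n r m X U \<sigma> \<kappa>
  proof -
    interpret low_rank n r X U \<sigma> by unfold_locales (use that in auto)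
    \<comment> \<open>For \<open>n = 1\<close> the logarithm vanishes and the sample condition says
      nothing, but the required probability is 1 - 4 < 0, so the empty event will do.\<close>
    consider "n = 1" | "n \<ge> 2" using r r_le_n by linarith
    then show "\<exists>E \<in> sets (goe_space m n). measure (goe_space m n) E \<ge> 1 - 4 * real n powr (- 1) \<and>
      (\<forall>\<omega>\<in>E. \<forall>Z0. spectral_init n r m (goe_mat n \<omega>) (measurement (goe_mat n \<omega>) X) Z0 \<longrightarrow>
        proc_dist r Z0 (factor r U \<sigma>) \<le> sqrt (3 / 16 * \<sigma> (r - 1)))"
    proof cases
      case 1
      then show ?thesis by (intro bexI[of _ "{}"]) auto
    next
      case 2
      then show ?thesis unfolding Zs_def[symmetric] by (rule spectral_init_event[OF _ that(3) m])
    qed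
    consider "n = 1" | "n \<ge> 2" using r r_le_n by linarith
    then show "\<exists>E \<in> sets (goe_space m n). measure (goe_space m n) E \<ge> 1 - 4 * real n powr (- 1) \<and>
      (\<forall>\<omega>\<in>E. \<forall>\<mu>. \<forall>Z0 \<in> carrier_mat n r. \<forall>k. 0 < \<mu> \<longrightarrow> \<mu> \<le> 1 / 2000 / (\<kappa> * real n) \<longrightarrow>
        proc_dist r Z0 (factor r U \<sigma>) \<le> sqrt (3 / 16 * \<sigma> (r - 1)) \<longrightarrow>
        proc_dist r (grad_descent m (goe_mat n \<omega>) (measurement (goe_mat n \<omega>) X) (\<mu> / (frob_norm (factor r U \<sigma>))\<^sup>2) Z0 k)
          (factor r U \<sigma>) \<le> sqrt (3 / 16 * \<sigma> (r - 1)) * (1 - \<mu> / (12 * \<kappa> * real r)) powr (real k / 2))"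
    proof cases
      case 1
      then show ?thesis by (intro bexI[of _ "{}"]) auto
    next
      case 2
      then show ?thesis unfolding Zs_def[symmetric] by (rule gradient_descent_event[OF _ that(3) m])
    qed
  qed
  have pos: "0 < ?c0" "0 < (4 :: real)" "0 < (1 :: real)" "0 < (1 / 2000 :: real)" by simp_all
  show ?thesis
    by (rule exI[of _ ?c0], rule conjI[OF pos(1)], rule exI[of _ 4], rule conjI[OF pos(2)], rule exI[of _ 1],
        rule conjI[OF pos(3)], rule conjI, (intro allI impI, rule init; assumption),
        rule exI[of _ "1 / 2000"], rule conjI[OF pos(4)], (intro allI impI, rule descent; assumption))
qed

end
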